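(* Let $P^{ij}=\partial_x\left(g^{ij}\partial_x+c^{ij}_k u^k_x\right)\partial_x$ be a non-degenerate third-order Hamiltonian operator of differential-geometric type in flat coordinates $u^1,\dots,u^n$ (as defined in the context), and let $u^i_t=(V^i(\mathbf u))_x$, $i=1,\dots,n$, be a strictly hyperbolic system of conservation laws. The system is Hamiltonian with respect to $P$, i.e. $\mathbf u_t=(V(\mathbf u))_x=P\,\frac{\delta H}{\delta \mathbf u}$ for some (possibly nonlocal) Hamiltonian functional $H$, if and only if the following conditions hold for all values of the free indices: $$g_{im}V^m_j=g_{jm}V^m_i,$$ $$c_{mkl}V^m_i+c_{mik}V^m_l+c_{mli}V^m_k=0,$$ $$V^k_{ij}=g^{ks}c_{smj}V^m_i+g^{ks}c_{smi}V^m_j,$$ where $V^m_i=\partial V^m/\partial u^i$ and $V^k_{ij}=\partial^2V^k/\partial u^i\partial u^j$.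
   Context: Summation over repeated indices is understood; a comma in a lower index denotes a partial derivative with respect to the corresponding $u^l$; $\partial_x$ is the total $x$-derivative. A system $u^i_t=(V^i(\mathbf u))_x$ is strictly hyperbolic if the eigenvalues of the Jacobian matrix $(\partial V^i/\partial u^j)$ are real and distinct. Third-order Hamiltonian operator. $g^{ij}(\mathbf u)$ is a symmetric matrix with $\det g^{ij}\ne0$, $g_{ij}$ is its inverse, $c^{ij}_k(\mathbf u)$ are functions, and $c_{ijk}=g_{iq}g_{jp}c^{pq}_k$. The operator $P^{ij}=\partial_x(g^{ij}\partial_x+c^{ij}_ku^k_x)\partial_x$ is Hamiltonian if the bracket $\{F,G\}=\int \frac{\delta F}{\delta u^i}P^{ij}\frac{\delta G}{\delta u^j}dx$ is skew-symmetric and satisfies the Jacobi identity; this is known to be equivalent to $$g_{mp,k}=-c_{mpk}-c_{pmk},\quad c_{mpk}=-c_{mkp},\quad c_{mpk}+c_{pkm}+c_{kmp}=0,\quad c_{mpk,l}=-g^{sq}c_{sml}c_{qpk}.$$ Nonlocal Hamiltonians. $H$ is allowed to be a functional $H=\int h\,dx$ whose density depends on $x$, the potentials $b^i$ defined by $b^i_x=u^i$, and finitely many $x$-derivatives of $b^i$. Since $\frac{\delta H}{\delta b^i}=-\partial_x\frac{\delta H}{\delta u^i}$, the Hamiltonian representation in potential coordinates reads $$b^i_t=V^i(\mathbf b_x)=\tilde P^{ij}\frac{\delta H}{\delta b^j},\qquad \tilde P^{ij}=-\left(g^{ij}(\mathbf b_x)\partial_x+c^{ij}_k(\mathbf b_x)b^k_{xx}\right),$$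 where the fluxes $V^i$ are considered up to additive constants. *)

theory Defs
  imports "HOL-Analysis.Analysis"
begin

definition pd :: "'n::finite \<Rightarrow> (real ^ 'n \<Rightarrow> real) \<Rightarrow> real ^ 'n \<Rightarrow> real" where
  "pd i f u = frechet_derivative f (at u) (axis i 1)"

(* Meant for open U, where differentiability within U is ordinary differentiability. *)
fun Ck_on :: "nat \<Rightarrow> (real ^ 'n::finite) set \<Rightarrow> (real ^ 'n \<Rightarrow> real) \<Rightarrow> bool" where
  "Ck_on 0 U f \<longleftrightarrow> continuous_on U f"
| "Ck_on (Suc k) U f \<longleftrightarrow> f differentiable_on U \<and> (\<forall>i. Ck_on k U (pd i f))"

definition smooth_on :: "(real ^ 'n::finite) set \<Rightarrow> (real ^ 'n \<Rightarrow> real) \<Rightarrow> bool" where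
  "smooth_on U f \<longleftrightarrow> (\<forall>k. Ck_on k U f)"

definition jac :: "(real ^ 'n::finite \<Rightarrow> real ^ 'n) \<Rightarrow> real ^ 'n \<Rightarrow> real ^ 'n ^ 'n" where
  "jac V u = (\<chi> i j. pd j (\<lambda>v. V v $ i) u)"

(* CARD('n) different real eigenvalues exhaust the spectrum of an n x n matrix,
   so this says that all eigenvalues are real and distinct. *)
definition strictly_hyperbolic ::
    "(real ^ 'n::finite) set \<Rightarrow> (real ^ 'n \<Rightarrow> real ^ 'n) \<Rightarrow> bool" where
  "strictly_hyperbolic U V \<longleftrightarrow>
     (\<forall>u\<in>U. card {r::real. \<exists>v. v \<noteq> 0 \<and> jac V u *v v = r *\<^sub>R v} = CARD('n))"

(* A point of the jet space of a field w(x) with n components assigns a real number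
   to the independent variable x and to each w^i_(s), the s-th x-derivative of w^i. *)
datatype 'n jvar = Indep | Dep nat 'n

type_synonym 'n jet = "'n jvar \<Rightarrow> real"

definition jvec :: "nat \<Rightarrow> 'n::finite jet \<Rightarrow> real ^ 'n" where
  "jvec s p = (\<chi> i. p (Dep s i))"

(* The field u = w_(s) is restricted to U: for s = 0 the jets are those of u itself,
   for s = 1 they are those of the potential b with b_x = u. *)
definition jdom :: "nat \<Rightarrow> (real ^ 'n::finite) set \<Rightarrow> 'n jet set" where
  "jdom s U = {p. jvec s p \<in> U}"

definition jpd :: "'n jvar \<Rightarrow> ('n jet \<Rightarrow> real) \<Rightarrow> 'n jet \<Rightarrow> real" where
  "jpd a f p = deriv (\<lambda>t. f (p(a := t))) (p a)"

(* Continuity refers to the product topology on jets; for functions of finite order it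
   is joint continuity in the finitely many jet variables involved. *)
fun jet_Ck_on :: "nat \<Rightarrow> 'n jet set \<Rightarrow> ('n jet \<Rightarrow> real) \<Rightarrow> bool" where
  "jet_Ck_on 0 D f \<longleftrightarrow> continuous_on D f"
| "jet_Ck_on (Suc k) D f \<longleftrightarrow> continuous_on D f \<and>
     (\<forall>a. (\<forall>p\<in>D. (\<lambda>t. f (p(a := t))) differentiable (at (p a))) \<and> jet_Ck_on k D (jpd a f))"

definition finite_order_on :: "'n jet set \<Rightarrow> ('n jet \<Rightarrow> real) \<Rightarrow> bool" where
  "finite_order_on D f \<longleftrightarrow> (\<exists>N. \<forall>p\<in>D. \<forall>q\<in>D.
     p Indep = q Indep \<and> (\<forall>s\<le>N. \<forall>i. p (Dep s i) = q (Dep s i)) \<longrightarrow> f p = f q)"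

definition diff_fun_on :: "'n jet set \<Rightarrow> ('n jet \<Rightarrow> real) \<Rightarrow> bool" where
  "diff_fun_on D f \<longleftrightarrow> finite_order_on D f \<and> (\<forall>k. jet_Ck_on k D f)"

(* For differential functions the series below have only finitely many nonzero terms. *)

definition total_deriv :: "('n::finite jet \<Rightarrow> real) \<Rightarrow> 'n jet \<Rightarrow> real" where
  "total_deriv f p = jpd Indep f p + (\<Sum>s. \<Sum>i\<in>UNIV. p (Dep (Suc s) i) * jpd (Dep s i) f p)"

definition var_deriv :: "('n::finite jet \<Rightarrow> real) \<Rightarrow> 'n \<Rightarrow> 'n jet \<Rightarrow> real" where
  "var_deriv f i p = (\<Sum>s. (-1) ^ s * (total_deriv ^^ s) (jpd (Dep s i) f) p)"

(* The functional with density f vanishes: f is a total x-derivative. *)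
definition null_density :: "'n::finite jet set \<Rightarrow> ('n jet \<Rightarrow> real) \<Rightarrow> bool" where
  "null_density D f \<longleftrightarrow> (\<exists>\<theta>. diff_fun_on D \<theta> \<and> (\<forall>p\<in>D. f p = total_deriv \<theta> p))"

(* c i j k u stands for c^{ij}_k(u).  The expression is
   (g^{ij} d/dx + c^{ij}_k u^k_x) psi_j with u = w_(s). *)
definition first_order_op ::
    "nat \<Rightarrow> (real ^ 'n::finite \<Rightarrow> real ^ 'n ^ 'n) \<Rightarrow> ('n \<Rightarrow> 'n \<Rightarrow> 'n \<Rightarrow> real ^ 'n \<Rightarrow> real) \<Rightarrow>
     ('n \<Rightarrow> 'n jet \<Rightarrow> real) \<Rightarrow> 'n \<Rightarrow> 'n jet \<Rightarrow> real" where
  "first_order_op s g c \<psi> i p =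
     (\<Sum>j\<in>UNIV. g (jvec s p) $ i $ j * total_deriv (\<psi> j) p
        + (\<Sum>k\<in>UNIV. c i j k (jvec s p) * p (Dep (Suc s) k)) * \<psi> j p)"

definition third_order_op ::
    "(real ^ 'n::finite \<Rightarrow> real ^ 'n ^ 'n) \<Rightarrow> ('n \<Rightarrow> 'n \<Rightarrow> 'n \<Rightarrow> real ^ 'n \<Rightarrow> real) \<Rightarrow>
     ('n \<Rightarrow> 'n jet \<Rightarrow> real) \<Rightarrow> 'n \<Rightarrow> 'n jet \<Rightarrow> real" where
  "third_order_op g c \<psi> i = total_deriv (first_order_op 0 g c (\<lambda>j. total_deriv (\<psi> j)) i)"

definition bracket ::
    "(real ^ 'n::finite \<Rightarrow> real ^ 'n ^ 'n) \<Rightarrow> ('n \<Rightarrow> 'n \<Rightarrow> 'n \<Rightarrow> real ^ 'n \<Rightarrow> real) \<Rightarrow>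
     ('n jet \<Rightarrow> real) \<Rightarrow> ('n jet \<Rightarrow> real) \<Rightarrow> 'n jet \<Rightarrow> real" where
  "bracket g c F G p = (\<Sum>i\<in>UNIV. var_deriv F i p * third_order_op g c (var_deriv G) i p)"

definition hamiltonian_operator ::
    "(real ^ 'n::finite) set \<Rightarrow> (real ^ 'n \<Rightarrow> real ^ 'n ^ 'n) \<Rightarrow>
     ('n \<Rightarrow> 'n \<Rightarrow> 'n \<Rightarrow> real ^ 'n \<Rightarrow> real) \<Rightarrow> bool" where
  "hamiltonian_operator U g c \<longleftrightarrow>
     (\<forall>F G. diff_fun_on (jdom 0 U) F \<and> diff_fun_on (jdom 0 U) G \<longrightarrow>
        null_density (jdom 0 U) (\<lambda>p. bracket g c F G p + bracket g c G F p)) \<and>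
     (\<forall>F G H. diff_fun_on (jdom 0 U) F \<and> diff_fun_on (jdom 0 U) G \<and> diff_fun_on (jdom 0 U) H \<longrightarrow>
        null_density (jdom 0 U) (\<lambda>p. bracket g c (bracket g c F G) H p
          + bracket g c (bracket g c G H) F p + bracket g c (bracket g c H F) G p))"

(* c_{ijk} = g_{iq} g_{jp} c^{pq}_k *)
definition c_low ::
    "(real ^ 'n::finite \<Rightarrow> real ^ 'n ^ 'n) \<Rightarrow> ('n \<Rightarrow> 'n \<Rightarrow> 'n \<Rightarrow> real ^ 'n \<Rightarrow> real) \<Rightarrow>
     'n \<Rightarrow> 'n \<Rightarrow> 'n \<Rightarrow> real ^ 'n \<Rightarrow> real" where
  "c_low g c i j k u = (\<Sum>q\<in>UNIV. \<Sum>p\<in>UNIV.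
     matrix_inv (g u) $ i $ q * matrix_inv (g u) $ j $ p * c p q k u)"

(* The system u_t = (V(u))_x in potential coordinates, b_t = V(b_x), where b_x = u.  The
   Hamiltonian density h depends on x and finitely many x-derivatives of b (including b
   itself), and d/dx (g d/dx + c u_x) d/dx applied to delta H / delta u becomes
   -(g d/dx + c b_xx) applied to delta H / delta b, because
   delta H / delta b = - d/dx (delta H / delta u).  The vector k reflects that only the
   x-derivative of the flux V enters the system. *)
definition hamiltonian_system ::
    "(real ^ 'n::finite) set \<Rightarrow> (real ^ 'n \<Rightarrow> real ^ 'n ^ 'n) \<Rightarrow>
     ('n \<Rightarrow> 'n \<Rightarrow> 'n \<Rightarrow> real ^ 'n \<Rightarrow> real) \<Rightarrow> (real ^ 'n \<Rightarrow> real ^ 'n) \<Rightarrow> bool" where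
  "hamiltonian_system U g c V \<longleftrightarrow>
     (\<exists>h k. diff_fun_on (jdom 1 U) h \<and>
        (\<forall>p\<in>jdom 1 U. \<forall>i. V (jvec 1 p) $ i + k $ i = - first_order_op 1 g c (var_deriv h) i p))"

end

theory Submission
  imports Defs
begin

text \<open>Testing the skew-symmetry and the Jacobi identity of the bracket on functionals that are linear or
  quadratic in \<open>u\<close>, with coefficients polynomial in \<open>x\<close>, yields the differential equations for \<open>g\<close> and \<open>c\<close>;
  they say that \<open>\<Gamma>\<^sup>j\<^bsub>m l\<^esub> = g\<^sup>j\<^sup>q c\<^bsub>q m l\<^esub>\<close> are the coefficients of a flat connection, skew in \<open>m, l\<close>.
  If \<open>\<psi>\<close> is the variational derivative of \<open>H\<close> with respect to \<open>b\<close>, then \<open>b\<^sub>t = V(b\<^sub>x)\<close> reads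
  \<open>D \<psi>\<^sub>a + \<Gamma>\<^sup>m\<^bsub>a k\<^esub> u\<^sup>k\<^sub>x \<psi>\<^sub>m = - g\<^bsub>a i\<^esub> V\<^sup>i\<close>. Hence \<open>\<psi>\<close> depends on \<open>x, b, u\<close> only and is parallel in \<open>u\<close>;
  the compatibility of this overdetermined system is the condition on the second derivatives of \<open>V\<close>,
  and the Helmholtz condition for \<open>\<psi>\<close> is the symmetry of \<open>g\<^bsub>i m\<^esub> V\<^sup>m\<^sub>j\<close>. The cyclic condition follows from these two
  by differentiation. Conversely, parallel covectors of the flat connection are affine in \<open>u\<close>, so that \<open>\<psi>\<close> is an explicit
  polynomial defined for all \<open>u\<close>, and the Helmholtz conditions give a polynomial density.\<close>

subsection \<open>Differential functions on jet spaces\<close>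

text \<open>The axioms for the operator only assert that certain densities have primitives, so
  coefficients cannot be compared directly. Explicit dependence on x localises them: if Z times
  every power of x is null, then Z cannot depend on the field, and if the same holds for u^i Z, then
  Z = 0. The Jacobi identity thereby becomes a pointwise identity between commutators of Hamiltonian
  fields. For two linear functionals it is explicit, and the equations for \<open>c\<close> are its
  coefficients at u_xxx, at u_xx, and at x on constant fields; the degrees of the polynomial weights
  are chosen so that one relation at a time is isolated. What results for \<open>\<Gamma>\<close> is
  stronger than vanishing curvature: its derivative is a single product of two
  \<open>\<Gamma>\<close>, without antisymmetrisation. A second differentiation of the equation for
  parallel covectors therefore gives zero, which makes them affine with constants that are global on
  U, and the density arises without integration along paths in U.\<close>

lemma clairaut:
  fixes f fs ft fst fts :: "real \<Rightarrow> real \<Rightarrow> real"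
  assumes W: "open W" "(s0,t0) \<in> W"
    and 1: "\<And>s t. (s,t) \<in> W \<Longrightarrow> ((\<lambda>s. f s t) has_field_derivative fs s t) (at s)"
    and 2: "\<And>s t. (s,t) \<in> W \<Longrightarrow> ((\<lambda>t. f s t) has_field_derivative ft s t) (at t)"
    and 3: "\<And>s t. (s,t) \<in> W \<Longrightarrow> ((\<lambda>t. fs s t) has_field_derivative fst s t) (at t)"
    and 4: "\<And>s t. (s,t) \<in> W \<Longrightarrow> ((\<lambda>s. ft s t) has_field_derivative fts s t) (at s)"
    and c1: "continuous_on W (\<lambda>(s,t). fst s t)"
    and c2: "continuous_on W (\<lambda>(s,t). fts s t)"
  shows "fst s0 t0 = fts s0 t0"
proof (rule ccontr)
  assume ne: "fst s0 t0 \<noteq> fts s0 t0"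
  \<comment> \<open>Half the gap: one number cannot lie within less than \<open>e\<close> of both
    \<open>fst s0 t0\<close> and \<open>fts s0 t0\<close>.\<close>
  define e where "e = \<bar>fst s0 t0 - fts s0 t0\<bar> / 2"
  have e: "e > 0" using ne by (simp add: e_def)
  have "isCont (\<lambda>(s,t). fst s t) (s0,t0)" using c1 W continuous_on_eq_continuous_at by blast
  then have "\<forall>\<^sub>F q in nhds (s0,t0). dist (case q of (s,t) \<Rightarrow> fst s t) (fst s0 t0) < e"
    using e unfolding isCont_def tendsto_iff eventually_at_filter
    by (auto elim!: allE[of _ e] eventually_mono)
  moreover have "isCont (\<lambda>(s,t). fts s t) (s0,t0)" using c2 W continuous_on_eq_continuous_at by blast
  then have "\<forall>\<^sub>F q in nhds (s0,t0). dist (case q of (s,t) \<Rightarrow> fts s t) (fts s0 t0) < e"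
    using e unfolding isCont_def tendsto_iff eventually_at_filter
    by (auto elim!: allE[of _ e] eventually_mono)
  moreover have "\<forall>\<^sub>F q in nhds (s0,t0). q \<in> W" using W by (rule eventually_nhds_in_open)
  ultimately have "\<forall>\<^sub>F q in nhds (s0,t0). q \<in> W \<and> dist (case q of (s,t) \<Rightarrow> fst s t) (fst s0 t0) < e
    \<and> dist (case q of (s,t) \<Rightarrow> fts s t) (fts s0 t0) < e" by eventually_elim auto
  then obtain d where d: "d > 0" and dW: "\<And>q. dist q (s0,t0) < d \<Longrightarrow> q \<in> W \<and> dist (case q of (s,t) \<Rightarrow> fst s t) (fst s0 t0) < e
    \<and> dist (case q of (s,t) \<Rightarrow> fts s t) (fts s0 t0) < e"
    unfolding eventually_nhds_metric by auto
  define h where "h = d / 3"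
  have h: "h > 0" using d by (simp add: h_def)
  have box: "(s,t) \<in> W \<and> dist (fst s t) (fst s0 t0) < e \<and> dist (fts s t) (fts s0 t0) < e"
    if "s0 \<le> s" "s \<le> s0 + h" "t0 \<le> t" "t \<le> t0 + h" for s t
  proof -
    have "dist (s,t) (s0,t0) \<le> \<bar>s - s0\<bar> + \<bar>t - t0\<bar>"
      by (simp add: dist_prod_def dist_real_def sqrt_sum_squares_le_sum_abs)
    also have "\<dots> < d" using that d by (simp add: h_def)
    finally show ?thesis using dW[of "(s,t)"] by auto
  qed
  \<comment> \<open>The second difference over a small square. The mean value theorem, applied twice
    in either order, writes it as \<open>h * h\<close> times \<open>fst\<close> and as
    \<open>h * h\<close> times \<open>fts\<close>, each at some point of the square.\<close>
  define \<Delta> where "\<Delta> = f (s0+h) (t0+h) - f (s0+h) t0 - (f s0 (t0+h) - f s0 t0)"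
  have "\<exists>\<xi>. s0 < \<xi> \<and> \<xi> < s0 + h \<and>
     (\<lambda>s. f s (t0+h) - f s t0) (s0+h) - (\<lambda>s. f s (t0+h) - f s t0) s0 = (s0 + h - s0) * (fs \<xi> (t0+h) - fs \<xi> t0)"
    by (rule MVT2) (use h box in \<open>auto intro!: derivative_eq_intros 1\<close>)
  then obtain \<xi> where xi: "s0 < \<xi>" "\<xi> < s0 + h" "\<Delta> = h * (fs \<xi> (t0+h) - fs \<xi> t0)"
    by (auto simp: \<Delta>_def)
  have "\<exists>\<eta>. t0 < \<eta> \<and> \<eta> < t0 + h \<and> fs \<xi> (t0+h) - fs \<xi> t0 = (t0 + h - t0) * fst \<xi> \<eta>"
    by (rule MVT2) (use h box xi in \<open>auto intro!: 3\<close>)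
  then obtain \<eta> where eta: "t0 < \<eta>" "\<eta> < t0 + h" "\<Delta> = h * (h * fst \<xi> \<eta>)"
    using xi by auto
  have "\<exists>\<xi>. t0 < \<xi> \<and> \<xi> < t0 + h \<and>
     (\<lambda>t. f (s0+h) t - f s0 t) (t0+h) - (\<lambda>t. f (s0+h) t - f s0 t) t0 = (t0 + h - t0) * (ft (s0+h) \<xi> - ft s0 \<xi>)"
    by (rule MVT2) (use h box in \<open>auto intro!: derivative_eq_intros 2\<close>)
  then obtain \<xi>' where xi': "t0 < \<xi>'" "\<xi>' < t0 + h" "\<Delta> = h * (ft (s0+h) \<xi>' - ft s0 \<xi>')"
    by (auto simp: \<Delta>_def algebra_simps)
  have "\<exists>\<eta>. s0 < \<eta> \<and> \<eta> < s0 + h \<and> ft (s0+h) \<xi>' - ft s0 \<xi>' = (s0 + h - s0) * fts \<eta> \<xi>'"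
    by (rule MVT2[where f="\<lambda>s. ft s \<xi>'"]) (use h box xi' in \<open>auto intro!: 4\<close>)
  then obtain \<eta>' where eta': "s0 < \<eta>'" "\<eta>' < s0 + h" "\<Delta> = h * (h * fts \<eta>' \<xi>')"
    using xi' by auto
  have "fst \<xi> \<eta> = fts \<eta>' \<xi>'" using eta(3) eta'(3) h by simp
  moreover have "dist (fst \<xi> \<eta>) (fst s0 t0) < e" using box xi eta by auto
  moreover have "dist (fts \<eta>' \<xi>') (fts s0 t0) < e" using box xi' eta' by auto
  ultimately show False by (auto simp: dist_real_def e_def abs_if split: if_splits)
qed

lemma jet_Ck_on_mono: "jet_Ck_on (Suc k) A f \<Longrightarrow> jet_Ck_on k A f"
  by (induction k arbitrary: f) auto

lemma jpd_eqI:
  "((\<lambda>t. f (p(a := t))) has_field_derivative d) (at (p a)) \<Longrightarrow> jpd a f p = d"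
  unfolding jpd_def by (rule DERIV_imp_deriv)

lemma line_DERIV_mult:
  assumes "((\<lambda>t. f (p(a := t))) has_field_derivative f') (at (p a))"
    "((\<lambda>t. g (p(a := t))) has_field_derivative g') (at (p a))"
  shows "((\<lambda>t. f (p(a := t)) * g (p(a := t))) has_field_derivative f p * g' + f' * g p) (at (p a))"
  using DERIV_mult'[OF assms] by simp

lemma jvec_nth [simp]: "jvec s p $ i = p (Dep s i)"
  by (simp add: jvec_def)

lemma continuous_on_jvec: "continuous_on A (jvec s :: 'n::finite jet \<Rightarrow> real ^ 'n)"
  unfolding jvec_def
  by (intro continuous_on_vec_lambda) (rule continuous_on_subset[OF continuous_on_product_coordinates], simp)

lemma continuous_on_fun_upd:
  "continuous_on T (\<lambda>t. (p::'n jet)(a := t))"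
proof (rule continuous_on_coordinatewise_then_product)
  show "continuous_on T (\<lambda>t. (p(a := t)) i)" for i
    by (cases "i = a") (auto intro: continuous_intros)
qed

lemma open_jdom: "open U \<Longrightarrow> open (jdom s U :: 'n::finite jet set)"
proof -
  assume "open U"
  have "jdom s U = jvec s -` U" by (auto simp: jdom_def)
  then show ?thesis using continuous_on_open_vimage[of UNIV "jvec s :: 'n jet \<Rightarrow> _"] \<open>open U\<close> continuous_on_jvec
    by auto
qed

section \<open>Calculus of smooth functions on an open set of jets\<close>

locale jet_domain =
  fixes A :: "'n::finite jet set"
  assumes open_A: "open A"
begin

text \<open>Changing one coordinate is continuous in the product topology. Every argument that
  \<open>jpd\<close> is local goes through this fact.\<close>

lemma eventually_line: "p \<in> A \<Longrightarrow> \<forall>\<^sub>F t in nhds (p a). p(a := t) \<in> A"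
proof -
  assume p: "p \<in> A"
  have "open ((\<lambda>t. p(a := t)) -` A)"
    using continuous_on_open_vimage[of UNIV "\<lambda>t. p(a := t)"] continuous_on_fun_upd open_A by auto
  then have "\<forall>\<^sub>F t in nhds (p a). t \<in> (\<lambda>t. p(a := t)) -` A"
    by (rule eventually_nhds_in_open) (use p in auto)
  then show ?thesis by simp
qed

lemma line_DERIV_cong:
  assumes "\<And>q. q \<in> A \<Longrightarrow> f q = g q" "p \<in> A"
  shows "((\<lambda>t. f (p(a := t))) has_field_derivative d) (at (p a)) \<longleftrightarrow>
         ((\<lambda>t. g (p(a := t))) has_field_derivative d) (at (p a))"
proof (rule DERIV_cong_ev)
  show "\<forall>\<^sub>F t in nhds (p a). f (p(a := t)) = g (p(a := t))"
    using eventually_line[OF assms(2), of a] by eventually_elim (use assms in auto)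
qed auto

lemma jpd_cong:
  assumes "\<And>q. q \<in> A \<Longrightarrow> f q = g q" "p \<in> A"
  shows "jpd a f p = jpd a g p"
  unfolding jpd_def deriv_def using line_DERIV_cong[of f g, OF assms] by simp

lemma jet_Ck_on_cong:
  assumes "\<And>q. q \<in> A \<Longrightarrow> f q = g q" "jet_Ck_on k A f"
  shows "jet_Ck_on k A g"
  using assms
proof (induction k arbitrary: f g)
  case 0
  then show ?case using continuous_on_cong[of A A f g] by auto
next
  case (Suc k)
  have "continuous_on A g" using continuous_on_cong[of A A f g] Suc by auto
  moreover have "(\<lambda>t. g (p(a := t))) differentiable (at (p a))" if "p \<in> A" for p a
    using Suc.prems(2) line_DERIV_cong[of f g, OF Suc.prems(1) that, where a=a] that
    unfolding jet_Ck_on.simps real_differentiable_def by blast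
  moreover have "jet_Ck_on k A (jpd a g)" for a
    by (rule Suc.IH[of "jpd a f"]) (use Suc.prems jpd_cong[of f g, OF Suc.prems(1)] in auto)
  ultimately show ?case by auto
qed

lemma jet_Ck_on_SucI:
  assumes "continuous_on A f"
    "\<And>a p. p \<in> A \<Longrightarrow> ((\<lambda>t. f (p(a := t))) has_field_derivative f' a p) (at (p a))"
    "\<And>a. jet_Ck_on k A (f' a)"
  shows "jet_Ck_on (Suc k) A f"
proof -
  have "jet_Ck_on k A (jpd a f)" for a
    by (rule jet_Ck_on_cong[OF _ assms(3)[of a]]) (simp add: jpd_eqI[OF assms(2)])
  then show ?thesis using assms by (auto simp: real_differentiable_def)
qed

lemma line_DERIV:
  assumes "jet_Ck_on (Suc k) A f" "p \<in> A"
  shows "((\<lambda>t. f (p(a := t))) has_field_derivative jpd a f p) (at (p a))"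
  using assms unfolding jpd_def by (simp add: DERIV_deriv_iff_real_differentiable)

lemma jet_Ck_on_const: "jet_Ck_on k A (\<lambda>p. c)"
proof (induction k arbitrary: c)
  case (Suc k)
  show ?case by (rule jet_Ck_on_SucI[where f'="\<lambda>a p. 0"]) (auto intro: Suc)
qed simp

lemma jet_Ck_on_coord: "jet_Ck_on k A (\<lambda>p. p b)"
proof (cases k)
  case 0
  then show ?thesis by (auto intro: continuous_on_subset[OF continuous_on_product_coordinates])
next
  case (Suc k)
  show ?thesis unfolding Suc
    by (rule jet_Ck_on_SucI[where f'="\<lambda>a p. if a = b then 1 else 0"])
      (auto intro: continuous_on_subset[OF continuous_on_product_coordinates] jet_Ck_on_const)
qed

lemma jet_Ck_on_add: "jet_Ck_on k A f \<Longrightarrow> jet_Ck_on k A g \<Longrightarrow> jet_Ck_on k A (\<lambda>p. f p + g p)"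
proof (induction k arbitrary: f g)
  case (Suc k)
  show ?case
    by (rule jet_Ck_on_SucI[where f'="\<lambda>a p. jpd a f p + jpd a g p"])
     (use Suc in \<open>auto intro!: DERIV_add line_DERIV[of k] continuous_intros simp del: fun_upd_apply\<close>)
qed (auto intro: continuous_intros)

lemma jet_Ck_on_mult: "jet_Ck_on k A f \<Longrightarrow> jet_Ck_on k A g \<Longrightarrow> jet_Ck_on k A (\<lambda>p. f p * g p)"
proof (induction k arbitrary: f g)
  case (Suc k)
  show ?case
    by (rule jet_Ck_on_SucI[where f'="\<lambda>a p. f p * jpd a g p + jpd a f p * g p"])
     (use Suc jet_Ck_on_mono[OF Suc.prems(1)] jet_Ck_on_mono[OF Suc.prems(2)]
       in \<open>auto intro!: line_DERIV_mult line_DERIV[of k] continuous_intros jet_Ck_on_add simp del: fun_upd_apply\<close>)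
qed (auto intro: continuous_intros)

end

section \<open>Functions of u alone, viewed as functions on jets\<close>

lemma line_jvec: "jvec s (p(Dep s i := t)) = jvec s p + (t - p (Dep s i)) *\<^sub>R axis i 1"
  by (auto simp: vec_eq_iff axis_def)

lemma line_jvec_other: "(\<And>i. a \<noteq> Dep s i) \<Longrightarrow> jvec s (p(a := t)) = jvec s p"
  by (auto simp: vec_eq_iff)

lemma DERIV_along_axis:
  assumes "f differentiable (at u)"
  shows "((\<lambda>t. f (u + (t - t0) *\<^sub>R axis i 1)) has_field_derivative pd i f u) (at t0)"
proof -
  have "(f has_derivative frechet_derivative f (at u)) (at u)"
    using assms frechet_derivative_works by blast
  then have f: "(f has_derivative frechet_derivative f (at u)) (at (u + (t0 - t0) *\<^sub>R axis i 1))" by simp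
  have "((\<lambda>t. u + (t - t0) *\<^sub>R axis i 1) has_derivative (\<lambda>h. h *\<^sub>R axis i 1)) (at t0)"
    by (auto intro!: derivative_eq_intros)
  from has_derivative_compose[OF this f]
  have "((\<lambda>t. f (u + (t - t0) *\<^sub>R axis i 1)) has_derivative (\<lambda>h. frechet_derivative f (at u) (h *\<^sub>R axis i 1))) (at t0)" .
  moreover have "frechet_derivative f (at u) (h *\<^sub>R axis i 1) = pd i f u * h" for h
    using linear_scale[OF linear_frechet_derivative[OF assms]] by (simp add: pd_def)
  ultimately show ?thesis by (simp add: has_field_derivative_def)
qed

lemma smooth_on_differentiable:
  assumes "open U" "smooth_on U f" "u \<in> U" shows "f differentiable (at u)"
proof -
  have "Ck_on 1 U f" using assms(2) by (simp add: smooth_on_def)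
  then show ?thesis using assms by (auto simp: differentiable_on_eq_differentiable_at)
qed

lemma smooth_on_pd: "smooth_on U f \<Longrightarrow> smooth_on U (pd i f)"
  unfolding smooth_on_def by (metis Ck_on.simps(2))

lemma smooth_on_continuous: "smooth_on U f \<Longrightarrow> continuous_on U f"
  unfolding smooth_on_def by (metis Ck_on.simps(1))

lemma line_DERIV_jvec:
  assumes "open U" "smooth_on U f" "jvec s p \<in> U"
  shows "((\<lambda>t. f (jvec s (p(a := t)))) has_field_derivative
     (case a of Indep \<Rightarrow> 0 | Dep r i \<Rightarrow> if r = s then pd i f (jvec s p) else 0)) (at (p a))"
proof (cases "\<exists>i. a = Dep s i")
  case True
  then obtain i where a: "a = Dep s i" by auto
  show ?thesis unfolding a line_jvec
    using DERIV_along_axis[OF smooth_on_differentiable[OF assms], of "p (Dep s i)" i] by simp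
next
  case False
  then have "\<And>t. jvec s (p(a := t)) = jvec s p" by (intro line_jvec_other) auto
  then show ?thesis using False by (auto split: jvar.split)
qed

context jet_domain begin

lemma jet_Ck_on_jvec:
  assumes "open U" "smooth_on U f" "A \<subseteq> jdom s U"
  shows "jet_Ck_on k A (\<lambda>p. f (jvec s p))"
  using assms(2)
proof (induction k arbitrary: f)
  case 0
  have "continuous_on (jvec s ` A) f"
    by (rule continuous_on_subset[OF smooth_on_continuous[OF 0]]) (use assms in \<open>auto simp: jdom_def\<close>)
  then show ?case by (auto intro: continuous_on_compose2 continuous_on_jvec)
next
  case (Suc k)
  have "continuous_on (jvec s ` A) f"
    by (rule continuous_on_subset[OF smooth_on_continuous[OF Suc.prems]]) (use assms in \<open>auto simp: jdom_def\<close>)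
  then have c: "continuous_on A (\<lambda>p. f (jvec s p))" by (auto intro: continuous_on_compose2 continuous_on_jvec)
  show ?case
  proof (rule jet_Ck_on_SucI[OF c line_DERIV_jvec[OF assms(1) Suc.prems]])
    show "jet_Ck_on k A (\<lambda>p. case a of Indep \<Rightarrow> 0 | Dep r i \<Rightarrow> if r = s then pd i f (jvec s p) else 0)" for a
    proof (cases a)
      case (Dep r i)
      then show ?thesis by (cases "r = s") (simp_all add: jet_Ck_on_const Suc.IH smooth_on_pd Suc.prems)
    qed (simp add: jet_Ck_on_const)
  qed (use assms in \<open>auto simp: jdom_def\<close>)
qed

end

lemma finite_order_on_cong:
  assumes "finite_order_on A f" "\<And>p. p \<in> A \<Longrightarrow> f p = g p"
  shows "finite_order_on A g"
proof -
  have "finite_order_on A f \<longleftrightarrow> finite_order_on A g"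
    unfolding finite_order_on_def by (simp add: assms(2) cong: ball_cong)
  then show ?thesis using assms(1) by simp
qed

lemma finite_order_on_compose2:
  assumes "finite_order_on A f" "finite_order_on A g"
  shows "finite_order_on A (\<lambda>p. F (f p) (g p))"
proof -
  obtain N M where N: "\<And>p q. p \<in> A \<Longrightarrow> q \<in> A \<Longrightarrow> p Indep = q Indep \<Longrightarrow> \<forall>s\<le>N. \<forall>i. p (Dep s i) = q (Dep s i) \<Longrightarrow> f p = f q"
    and M: "\<And>p q. p \<in> A \<Longrightarrow> q \<in> A \<Longrightarrow> p Indep = q Indep \<Longrightarrow> \<forall>s\<le>M. \<forall>i. p (Dep s i) = q (Dep s i) \<Longrightarrow> g p = g q"
    using assms unfolding finite_order_on_def by metis
  show ?thesis unfolding finite_order_on_def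
    by (rule exI[of _ "max N M"]) (auto intro!: arg_cong2[of _ _ _ _ F] N M)
qed

lemma finite_order_on_const: "finite_order_on A (\<lambda>p. c)"
  by (auto simp: finite_order_on_def)

lemma finite_order_on_coord: "finite_order_on A (\<lambda>p. p a)"
  by (cases a) (auto simp: finite_order_on_def)

lemma finite_order_on_jvec: "finite_order_on A (\<lambda>p. f (jvec s p))"
  unfolding finite_order_on_def
  by (rule exI[of _ s]) (auto simp: vec_eq_iff intro!: arg_cong[of _ _ f])

context jet_domain begin

lemma finite_order_on_jpd:
  assumes "finite_order_on A f"
  shows "finite_order_on A (jpd a f)"
proof -
  obtain N where N: "\<And>p q. p \<in> A \<Longrightarrow> q \<in> A \<Longrightarrow> p Indep = q Indep \<Longrightarrow> \<forall>s\<le>N. \<forall>i. p (Dep s i) = q (Dep s i) \<Longrightarrow> f p = f q"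
    using assms unfolding finite_order_on_def by metis
  \<comment> \<open>The order bound is raised to cover the variable \<open>a\<close> itself, so that
    \<open>p a = q a\<close> and both lines are differentiated at the same parameter.\<close>
  have "jpd a f p = jpd a f q"
    if p: "p \<in> A" and q: "q \<in> A" and eq: "p Indep = q Indep" "\<forall>s\<le>max N (case a of Indep \<Rightarrow> 0 | Dep s i \<Rightarrow> s). \<forall>i. p (Dep s i) = q (Dep s i)" for p q
  proof -
    have a: "p a = q a" using eq by (cases a) auto
    have "\<forall>\<^sub>F t in nhds (p a). f (p(a := t)) = f (q(a := t))"
      using eventually_line[OF p, of a] eventually_line[OF q, of a, folded a]
      by eventually_elim (rule N, use eq in auto)
    then show ?thesis unfolding jpd_def using a by (intro deriv_cong_ev)
  qed
  then show ?thesis unfolding finite_order_on_def by meson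
qed

lemma jpd_eq_0_high_order:
  assumes "finite_order_on A f"
  shows "\<exists>n. \<forall>s\<ge>n. \<forall>i. \<forall>p\<in>A. jpd (Dep s i) f p = 0"
proof -
  obtain N where N: "\<And>p q. p \<in> A \<Longrightarrow> q \<in> A \<Longrightarrow> p Indep = q Indep \<Longrightarrow> \<forall>s\<le>N. \<forall>i. p (Dep s i) = q (Dep s i) \<Longrightarrow> f p = f q"
    using assms unfolding finite_order_on_def by metis
  have "jpd (Dep s i) f p = 0" if "s \<ge> Suc N" "p \<in> A" for s i p
  proof (rule jpd_eqI)
    have "\<forall>\<^sub>F t in nhds (p (Dep s i)). f (p(Dep s i := t)) = f p"
      using eventually_line[OF that(2), of "Dep s i"]
      by eventually_elim (rule N, use that in auto)
    then show "((\<lambda>t. f (p(Dep s i := t))) has_real_derivative 0) (at (p (Dep s i)))"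
      using DERIV_cong_ev[of "p (Dep s i)" "p (Dep s i)" "\<lambda>t. f (p(Dep s i := t))" "\<lambda>t. f p" 0 0] by auto
  qed
  then show ?thesis by blast
qed

lemma diff_fun_cong:
  "diff_fun_on A f \<Longrightarrow> (\<And>p. p \<in> A \<Longrightarrow> f p = g p) \<Longrightarrow> diff_fun_on A g"
  unfolding diff_fun_on_def using finite_order_on_cong jet_Ck_on_cong by metis

lemma diff_fun_add: "diff_fun_on A f \<Longrightarrow> diff_fun_on A g \<Longrightarrow> diff_fun_on A (\<lambda>p. f p + g p)"
  unfolding diff_fun_on_def by (auto intro: jet_Ck_on_add finite_order_on_compose2)

lemma diff_fun_mult: "diff_fun_on A f \<Longrightarrow> diff_fun_on A g \<Longrightarrow> diff_fun_on A (\<lambda>p. f p * g p)"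
  unfolding diff_fun_on_def by (auto intro: jet_Ck_on_mult finite_order_on_compose2)

lemma diff_fun_const: "diff_fun_on A (\<lambda>p. c)"
  unfolding diff_fun_on_def by (auto intro: jet_Ck_on_const finite_order_on_const)

lemma diff_fun_coord: "diff_fun_on A (\<lambda>p. p a)"
  unfolding diff_fun_on_def by (auto intro: jet_Ck_on_coord finite_order_on_coord)

lemma diff_fun_jvec:
  "open U \<Longrightarrow> smooth_on U f \<Longrightarrow> A \<subseteq> jdom s U \<Longrightarrow> diff_fun_on A (\<lambda>p. f (jvec s p))"
  unfolding diff_fun_on_def by (auto intro: jet_Ck_on_jvec finite_order_on_jvec)

lemma diff_fun_jpd: "diff_fun_on A f \<Longrightarrow> diff_fun_on A (jpd a f)"
  unfolding diff_fun_on_def by (metis finite_order_on_jpd jet_Ck_on.simps(2))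

lemma diff_fun_uminus: "diff_fun_on A f \<Longrightarrow> diff_fun_on A (\<lambda>p. - f p)"
  using diff_fun_mult[OF diff_fun_const[of "-1"]] by simp

lemma diff_fun_diff: "diff_fun_on A f \<Longrightarrow> diff_fun_on A g \<Longrightarrow> diff_fun_on A (\<lambda>p. f p - g p)"
  using diff_fun_add[OF _ diff_fun_uminus] by simp

lemma diff_fun_sum: "(\<And>i. i \<in> I \<Longrightarrow> diff_fun_on A (f i)) \<Longrightarrow> diff_fun_on A (\<lambda>p. \<Sum>i\<in>I. f i p)"
  by (induction I rule: infinite_finite_induct) (auto intro: diff_fun_const diff_fun_add)

lemma diff_fun_power: "diff_fun_on A f \<Longrightarrow> diff_fun_on A (\<lambda>p. f p ^ n)"
  by (induction n) (auto intro: diff_fun_const diff_fun_mult)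

lemma diff_fun_continuous: "diff_fun_on A f \<Longrightarrow> continuous_on A f"
  unfolding diff_fun_on_def by (metis jet_Ck_on.simps(1))

lemma diff_fun_line:
  "diff_fun_on A f \<Longrightarrow> p \<in> A \<Longrightarrow> ((\<lambda>t. f (p(a := t))) has_field_derivative jpd a f p) (at (p a))"
  unfolding diff_fun_on_def by (metis line_DERIV)

lemma jpd_const: "jpd a (\<lambda>p. c) p = 0"
  by (rule jpd_eqI) simp

lemma jpd_coord: "jpd a (\<lambda>p. p b) p = (if a = b then 1 else 0)"
  by (rule jpd_eqI) auto

lemma jpd_add: "diff_fun_on A f \<Longrightarrow> diff_fun_on A g \<Longrightarrow> p \<in> A \<Longrightarrow> jpd a (\<lambda>p. f p + g p) p = jpd a f p + jpd a g p"
  by (rule jpd_eqI) (intro DERIV_add diff_fun_line)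

lemma jpd_mult: "diff_fun_on A f \<Longrightarrow> diff_fun_on A g \<Longrightarrow> p \<in> A \<Longrightarrow>
    jpd a (\<lambda>p. f p * g p) p = f p * jpd a g p + jpd a f p * g p"
  by (rule jpd_eqI) (intro line_DERIV_mult diff_fun_line)

lemma jpd_uminus: "diff_fun_on A f \<Longrightarrow> p \<in> A \<Longrightarrow> jpd a (\<lambda>p. - f p) p = - jpd a f p"
  by (rule jpd_eqI) (intro DERIV_minus diff_fun_line)

lemma jpd_diff: "diff_fun_on A f \<Longrightarrow> diff_fun_on A g \<Longrightarrow> p \<in> A \<Longrightarrow> jpd a (\<lambda>p. f p - g p) p = jpd a f p - jpd a g p"
  by (rule jpd_eqI) (intro DERIV_diff diff_fun_line)

lemma jpd_sum:
  "(\<And>i. i \<in> I \<Longrightarrow> diff_fun_on A (f i)) \<Longrightarrow> p \<in> A \<Longrightarrow> jpd a (\<lambda>p. \<Sum>i\<in>I. f i p) p = (\<Sum>i\<in>I. jpd a (f i) p)"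
  by (rule jpd_eqI) (intro DERIV_sum diff_fun_line)

lemma jpd_jvec:
  assumes "open U" "smooth_on U f" "A \<subseteq> jdom s U" "p \<in> A"
  shows "jpd a (\<lambda>p. f (jvec s p)) p =
    (case a of Indep \<Rightarrow> 0 | Dep r i \<Rightarrow> if r = s then pd i f (jvec s p) else 0)"
  by (rule jpd_eqI) (rule line_DERIV_jvec, use assms in \<open>auto simp: jdom_def\<close>)

text \<open>Since \<open>jpd\<close> is a derivative along a single line, it suffices to look at the
  two-dimensional slice through \<open>p\<close> in the directions \<open>a\<close> and
  \<open>b\<close>, where continuity in the product topology becomes joint continuity in two real
  variables.\<close>

lemma jpd_commute:
  assumes f: "diff_fun_on A f" and p: "p \<in> A"
  shows "jpd a (jpd b f) p = jpd b (jpd a f) p"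
proof (cases "a = b")
  case False
  define q where "q = (\<lambda>s t. p(a := s, b := t))"
  have cq: "continuous_on T (\<lambda>(s,t). q s t)" for T
    unfolding q_def case_prod_beta
  proof (rule continuous_on_coordinatewise_then_product)
    show "continuous_on T (\<lambda>x. (p(a := fst x, b := snd x)) i)" for i
      by (cases "i = b"; cases "i = a") (auto intro: continuous_intros)
  qed
  define W where "W = (\<lambda>(s,t). q s t) -` A"
  have W: "open W" unfolding W_def
    using continuous_on_open_vimage[of UNIV "\<lambda>(s,t). q s t"] cq open_A by auto
  have qp: "q (p a) (p b) = p" by (simp add: q_def)
  have qa: "q s t a = s" "q s t b = t" for s t using False by (auto simp: q_def)
  have qu: "(q s t)(a := s') = q s' t" "(q s t)(b := t') = q s t'" for s t s' t'
    using False by (auto simp: q_def fun_upd_twist)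
  have inW: "(s,t) \<in> W \<longleftrightarrow> q s t \<in> A" for s t by (simp add: W_def)
  have la: "((\<lambda>s. F (q s t)) has_field_derivative jpd a F (q s t)) (at s)"
    if "diff_fun_on A F" "(s,t) \<in> W" for F s t
    using diff_fun_line[OF that(1), of "q s t" a] that by (simp add: inW qa qu)
  have lb: "((\<lambda>t. F (q s t)) has_field_derivative jpd b F (q s t)) (at t)"
    if "diff_fun_on A F" "(s,t) \<in> W" for F s t
    using diff_fun_line[OF that(1), of "q s t" b] that by (simp add: inW qa qu)
  have c: "continuous_on W (\<lambda>(s,t). F (q s t))" if "diff_fun_on A F" for F
  proof -
    have "continuous_on W (\<lambda>z. F (case z of (s,t) \<Rightarrow> q s t))"
      by (rule continuous_on_compose2[OF diff_fun_continuous[OF that] cq]) (auto simp: inW)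
    then show ?thesis by (simp add: case_prod_beta)
  qed
  have "jpd b (jpd a f) (q (p a) (p b)) = jpd a (jpd b f) (q (p a) (p b))"
    by (rule clairaut[OF W _ la[OF f] lb[OF f] lb la c c])
      (auto simp: inW qp p intro: f diff_fun_jpd)
  then show ?thesis by (simp add: qp)
qed simp

text \<open>A strict bound for the order, so that \<open>n = 0\<close> means that no field variable
  enters and only x is left. It turns the series in the definitions into finite sums.\<close>

definition dep_below :: "nat \<Rightarrow> ('n jet \<Rightarrow> real) \<Rightarrow> bool" where
  "dep_below n f \<longleftrightarrow> (\<forall>s\<ge>n. \<forall>i. \<forall>p\<in>A. jpd (Dep s i) f p = 0)"

lemma dep_belowD: "dep_below n f \<Longrightarrow> s \<ge> n \<Longrightarrow> p \<in> A \<Longrightarrow> jpd (Dep s i) f p = 0"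
  by (auto simp: dep_below_def)

lemma dep_below_mono: "dep_below n f \<Longrightarrow> n \<le> m \<Longrightarrow> dep_below m f"
  by (auto simp: dep_below_def)

lemma ex_dep_below: "diff_fun_on A f \<Longrightarrow> \<exists>n. dep_below n f"
  using jpd_eq_0_high_order unfolding diff_fun_on_def dep_below_def by auto

lemma ex_dep_below2:
  assumes "diff_fun_on A f" "diff_fun_on A g" shows "\<exists>n. dep_below n f \<and> dep_below n g"
proof -
  obtain n m where "dep_below n f" "dep_below m g" using ex_dep_below assms by meson
  then have "dep_below (max n m) f \<and> dep_below (max n m) g" using dep_below_mono by fastforce
  then show ?thesis by blast
qed

lemma ex_dep_below_family:
  assumes "\<And>i::'b::finite. diff_fun_on A (f i)" shows "\<exists>n. \<forall>i. dep_below n (f i)"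
proof -
  have "\<forall>i. \<exists>n. dep_below n (f i)" using ex_dep_below assms by blast
  then obtain n where "\<And>i. dep_below (n i) (f i)" using choice[of "\<lambda>i n. dep_below n (f i)"] by auto
  then have "dep_below (Max (range n)) (f i)" for i by (rule dep_below_mono) simp
  then show ?thesis by blast
qed

lemma dep_below_jpd: "diff_fun_on A f \<Longrightarrow> dep_below n f \<Longrightarrow> dep_below n (jpd a f)"
  unfolding dep_below_def
proof (intro allI impI ballI)
  fix s i p assume f: "diff_fun_on A f" "\<forall>s\<ge>n. \<forall>i. \<forall>p\<in>A. jpd (Dep s i) f p = 0" "n \<le> s" "p \<in> A"
  have "jpd (Dep s i) (jpd a f) p = jpd a (jpd (Dep s i) f) p" using jpd_commute f by blast
  also have "\<dots> = jpd a (\<lambda>_. 0) p" by (rule jpd_cong) (use f in auto)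
  finally show "jpd (Dep s i) (jpd a f) p = 0" by (simp add: jpd_const)
qed

lemma total_deriv_eq:
  assumes "dep_below n f" "p \<in> A"
  shows "total_deriv f p = jpd Indep f p + (\<Sum>s<n. \<Sum>i\<in>UNIV. p (Dep (Suc s) i) * jpd (Dep s i) f p)"
  unfolding total_deriv_def
  by (subst suminf_finite[of "{..<n}"]) (use assms in \<open>auto simp: dep_below_def intro!: sum.neutral\<close>)

lemma total_deriv_cong:
  assumes "\<And>q. q \<in> A \<Longrightarrow> f q = g q" "p \<in> A"
  shows "total_deriv f p = total_deriv g p"
  unfolding total_deriv_def using jpd_cong[of f g, OF assms] by simp

lemma diff_fun_total_deriv: assumes "diff_fun_on A f" shows "diff_fun_on A (total_deriv f)"
proof -
  obtain n where n: "dep_below n f" using ex_dep_below assms by blast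
  have "diff_fun_on A (\<lambda>p. jpd Indep f p + (\<Sum>s<n. \<Sum>i\<in>UNIV. p (Dep (Suc s) i) * jpd (Dep s i) f p))"
    by (intro diff_fun_add diff_fun_sum diff_fun_mult diff_fun_coord diff_fun_jpd assms)
  then show ?thesis by (rule diff_fun_cong) (simp add: total_deriv_eq[OF n])
qed

lemma diff_fun_total_deriv_pow: "diff_fun_on A f \<Longrightarrow> diff_fun_on A ((total_deriv ^^ k) f)"
  by (induction k) (auto intro: diff_fun_total_deriv)

lemma total_deriv_const: "total_deriv (\<lambda>p. c) p = 0"
  by (simp add: total_deriv_def jpd_const)

lemma total_deriv_add:
  assumes "diff_fun_on A f" "diff_fun_on A g" "p \<in> A"
  shows "total_deriv (\<lambda>p. f p + g p) p = total_deriv f p + total_deriv g p"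
proof -
  obtain n where n: "dep_below n f" "dep_below n g" using ex_dep_below2 assms by blast
  have "dep_below n (\<lambda>p. f p + g p)" using n assms by (auto simp: dep_below_def jpd_add)
  from total_deriv_eq[OF this assms(3)] show ?thesis
    using total_deriv_eq[OF n(1) assms(3)] total_deriv_eq[OF n(2) assms(3)] assms
    by (simp add: jpd_add algebra_simps sum.distrib)
qed

lemma total_deriv_mult:
  assumes "diff_fun_on A f" "diff_fun_on A g" "p \<in> A"
  shows "total_deriv (\<lambda>p. f p * g p) p = f p * total_deriv g p + total_deriv f p * g p"
proof -
  obtain n where n: "dep_below n f" "dep_below n g" using ex_dep_below2 assms by blast
  have "dep_below n (\<lambda>p. f p * g p)" using n assms by (auto simp: dep_below_def jpd_mult)
  from total_deriv_eq[OF this assms(3)] show ?thesis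
    using total_deriv_eq[OF n(1) assms(3)] total_deriv_eq[OF n(2) assms(3)] assms
    by (simp add: jpd_mult algebra_simps sum.distrib sum_distrib_left sum_distrib_right)
qed

lemma total_deriv_uminus:
  assumes "diff_fun_on A f" "p \<in> A"
  shows "total_deriv (\<lambda>p. - f p) p = - total_deriv f p"
  using total_deriv_mult[OF diff_fun_const[of "-1"] assms] by (simp add: total_deriv_const)

lemma total_deriv_diff:
  assumes "diff_fun_on A f" "diff_fun_on A g" "p \<in> A"
  shows "total_deriv (\<lambda>p. f p - g p) p = total_deriv f p - total_deriv g p"
  using total_deriv_add[OF assms(1) diff_fun_uminus[OF assms(2)] assms(3)] total_deriv_uminus[OF assms(2,3)] by simp

lemma total_deriv_sum:
  assumes "\<And>i. i \<in> I \<Longrightarrow> diff_fun_on A (f i)" "p \<in> A"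
  shows "total_deriv (\<lambda>p. \<Sum>i\<in>I. f i p) p = (\<Sum>i\<in>I. total_deriv (f i) p)"
  using assms(1)
  by (induction I rule: infinite_finite_induct)
    (use assms(2) in \<open>auto simp: total_deriv_const total_deriv_add diff_fun_sum\<close>)

lemma total_deriv_coord: "p \<in> A \<Longrightarrow> total_deriv (\<lambda>p. p a) p = (case a of Indep \<Rightarrow> 1 | Dep s i \<Rightarrow> p (Dep (Suc s) i))"
proof (cases a)
  case (Dep s i)
  assume p: "p \<in> A"
  have "dep_below (Suc s) (\<lambda>p. p a)" by (auto simp: dep_below_def jpd_coord Dep)
  from total_deriv_eq[OF this p] show ?thesis unfolding Dep
    by (simp add: jpd_coord mult_delta_right if_distrib[where f="\<lambda>x. _ * x"] cong: if_cong)
next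
  case Indep
  assume p: "p \<in> A"
  have "dep_below 0 (\<lambda>p. p a)" by (auto simp: dep_below_def jpd_coord Indep)
  from total_deriv_eq[OF this p] show ?thesis unfolding Indep by (simp add: jpd_coord)
qed

lemma total_deriv_jvec:
  assumes "open U" "smooth_on U f" "A \<subseteq> jdom s U" "p \<in> A"
  shows "total_deriv (\<lambda>p. f (jvec s p)) p = (\<Sum>i\<in>UNIV. p (Dep (Suc s) i) * pd i f (jvec s p))"
proof -
  have j: "jpd a (\<lambda>p. f (jvec s p)) q = (case a of Indep \<Rightarrow> 0 | Dep r i \<Rightarrow> if r = s then pd i f (jvec s q) else 0)"
    if "q \<in> A" for a q
    by (rule jpd_jvec[OF assms(1-3) that])
  have "dep_below (Suc s) (\<lambda>p. f (jvec s p))"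
    by (auto simp: dep_below_def j)
  from total_deriv_eq[OF this assms(4)] show ?thesis
    by (simp add: j[OF assms(4)])
qed

text \<open>The extra sum comes from differentiating the explicit factor
  \<open>p (Dep (Suc s) i)\<close> of the total derivative; in all other terms the partial
  derivatives commute.\<close>

lemma jpd_total_deriv_aux:
  assumes f: "diff_fun_on A f" and n: "dep_below n f" and p: "p \<in> A"
  shows "jpd b (total_deriv f) p = total_deriv (jpd b f) p + (\<Sum>s<n. \<Sum>i\<in>UNIV. if b = Dep (Suc s) i then jpd (Dep s i) f p else 0)"
proof -
  have "jpd b (total_deriv f) p = jpd b (\<lambda>p. jpd Indep f p + (\<Sum>s<n. \<Sum>i\<in>UNIV. p (Dep (Suc s) i) * jpd (Dep s i) f p)) p"
    by (rule jpd_cong[OF _ p]) (rule total_deriv_eq[OF n])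
  also have "\<dots> = jpd b (jpd Indep f) p + (\<Sum>s<n. \<Sum>i\<in>UNIV. p (Dep (Suc s) i) * jpd b (jpd (Dep s i) f) p
      + (if b = Dep (Suc s) i then jpd (Dep s i) f p else 0))"
    using f p by (simp add: jpd_add jpd_sum jpd_mult jpd_coord diff_fun_add diff_fun_sum diff_fun_mult diff_fun_coord diff_fun_jpd
      if_distrib[where f="\<lambda>x. x * _"] cong: if_cong)
  also have "\<dots> = jpd Indep (jpd b f) p + (\<Sum>s<n. \<Sum>i\<in>UNIV. p (Dep (Suc s) i) * jpd (Dep s i) (jpd b f) p)
      + (\<Sum>s<n. \<Sum>i\<in>UNIV. if b = Dep (Suc s) i then jpd (Dep s i) f p else 0)"
    using jpd_commute[OF f p] by (simp add: sum.distrib)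
  finally show ?thesis using total_deriv_eq[OF dep_below_jpd[OF f n] p, of b] by simp
qed

lemma jpd_total_deriv:
  assumes f: "diff_fun_on A f" and p: "p \<in> A"
  shows "jpd Indep (total_deriv f) p = total_deriv (jpd Indep f) p"
    and "jpd (Dep 0 i) (total_deriv f) p = total_deriv (jpd (Dep 0 i) f) p"
    and "jpd (Dep (Suc s) i) (total_deriv f) p = total_deriv (jpd (Dep (Suc s) i) f) p + jpd (Dep s i) f p"
proof -
  obtain n0 where "dep_below n0 f" using ex_dep_below f by blast
  \<comment> \<open>The bound is enlarged so that the index \<open>s\<close> occurs in the finite
    sum.\<close>
  then have n: "dep_below (max n0 (Suc s)) f" by (rule dep_below_mono) simp
  note * = jpd_total_deriv_aux[OF f n p]
  show "jpd Indep (total_deriv f) p = total_deriv (jpd Indep f) p" using *[of Indep] by simp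
  show "jpd (Dep 0 i) (total_deriv f) p = total_deriv (jpd (Dep 0 i) f) p" using *[of "Dep 0 i"] by simp
  show "jpd (Dep (Suc s) i) (total_deriv f) p = total_deriv (jpd (Dep (Suc s) i) f) p + jpd (Dep s i) f p"
  proof -
    have "(\<Sum>i'\<in>UNIV. if Dep (Suc s) i = Dep (Suc s') i' then jpd (Dep s' i') f p else 0)
        = (if s = s' then jpd (Dep s i) f p else 0)" for s'
      by (cases "s = s'") simp_all
    then show ?thesis using *[of "Dep (Suc s) i"] by simp
  qed
qed

lemma dep_below_total_deriv: "diff_fun_on A f \<Longrightarrow> dep_below n f \<Longrightarrow> dep_below (Suc n) (total_deriv f)"
  unfolding dep_below_def
proof (intro allI impI ballI)
  fix s i p assume f: "diff_fun_on A f" "\<forall>s\<ge>n. \<forall>i. \<forall>p\<in>A. jpd (Dep s i) f p = 0" "Suc n \<le> s" "p \<in> A"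
  obtain r where r: "s = Suc r" using f(3) by (cases s) auto
  have "total_deriv (jpd (Dep s i) f) p = total_deriv (\<lambda>_. 0) p" by (rule total_deriv_cong) (use f in auto)
  then show "jpd (Dep s i) (total_deriv f) p = 0"
    using f unfolding r by (simp add: jpd_total_deriv(3) total_deriv_const)
qed

lemma total_deriv_pow_cong:
  assumes "\<And>q. q \<in> A \<Longrightarrow> f q = g q" "p \<in> A"
  shows "(total_deriv ^^ k) f p = (total_deriv ^^ k) g p"
  using assms(2) by (induction k arbitrary: p) (auto simp: assms(1) intro: total_deriv_cong)

lemma total_deriv_pow_zero:
  "(\<And>q. q \<in> A \<Longrightarrow> f q = 0) \<Longrightarrow> p \<in> A \<Longrightarrow> (total_deriv ^^ k) f p = 0"
proof (induction k arbitrary: p)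
  case (Suc k)
  have "total_deriv ((total_deriv ^^ k) f) p = total_deriv (\<lambda>_. 0) p"
    by (rule total_deriv_cong) (use Suc in auto)
  then show ?case by (simp add: total_deriv_const)
qed auto

lemma total_deriv_pow_add:
  assumes "diff_fun_on A f" "diff_fun_on A g" "p \<in> A"
  shows "(total_deriv ^^ k) (\<lambda>p. f p + g p) p = (total_deriv ^^ k) f p + (total_deriv ^^ k) g p"
  using assms(3)
proof (induction k arbitrary: p)
  case (Suc k)
  have "total_deriv ((total_deriv ^^ k) (\<lambda>p. f p + g p)) p
      = total_deriv (\<lambda>p. (total_deriv ^^ k) f p + (total_deriv ^^ k) g p) p"
    by (rule total_deriv_cong) (use Suc in auto)
  then show ?case using Suc.prems assms by (simp add: total_deriv_add diff_fun_total_deriv_pow)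
qed simp

lemma total_deriv_pow_uminus:
  assumes "diff_fun_on A f" "p \<in> A"
  shows "(total_deriv ^^ k) (\<lambda>p. - f p) p = - (total_deriv ^^ k) f p"
  using assms(2)
proof (induction k arbitrary: p)
  case (Suc k)
  have "total_deriv ((total_deriv ^^ k) (\<lambda>p. - f p)) p = total_deriv (\<lambda>p. - (total_deriv ^^ k) f p) p"
    by (rule total_deriv_cong) (use Suc in auto)
  then show ?case using Suc.prems assms by (simp add: total_deriv_uminus diff_fun_total_deriv_pow)
qed simp

lemma jpd_total_deriv_pow_0:
  assumes "diff_fun_on A f" "p \<in> A"
  shows "jpd (Dep 0 i) ((total_deriv ^^ k) f) p = (total_deriv ^^ k) (jpd (Dep 0 i) f) p"
  using assms(2)
proof (induction k arbitrary: p)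
  case (Suc k)
  have "jpd (Dep 0 i) (total_deriv ((total_deriv ^^ k) f)) p = total_deriv (jpd (Dep 0 i) ((total_deriv ^^ k) f)) p"
    by (rule jpd_total_deriv(2)[OF diff_fun_total_deriv_pow[OF assms(1)] Suc.prems])
  also have "\<dots> = total_deriv ((total_deriv ^^ k) (jpd (Dep 0 i) f)) p"
    by (rule total_deriv_cong[OF Suc.IH Suc.prems])
  finally show ?case by simp
qed simp

subsection \<open>Null densities\<close>

lemma null_density_total_deriv: "diff_fun_on A f \<Longrightarrow> null_density A (total_deriv f)"
  unfolding null_density_def by blast

lemma null_density_cong:
  "null_density A f \<Longrightarrow> (\<And>p. p \<in> A \<Longrightarrow> f p = g p) \<Longrightarrow> null_density A g"
  unfolding null_density_def by metis

lemma diff_fun_null_density: "null_density A f \<Longrightarrow> diff_fun_on A f"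
  unfolding null_density_def using diff_fun_cong diff_fun_total_deriv by metis

lemma null_density_add:
  assumes "null_density A f" "null_density A g" shows "null_density A (\<lambda>p. f p + g p)"
proof -
  obtain a b where "diff_fun_on A a" "\<forall>p\<in>A. f p = total_deriv a p"
    "diff_fun_on A b" "\<forall>p\<in>A. g p = total_deriv b p" using assms unfolding null_density_def by blast
  then show ?thesis unfolding null_density_def
    by (intro exI[of _ "\<lambda>p. a p + b p"]) (auto simp: diff_fun_add total_deriv_add)
qed

lemma null_density_cmult:
  assumes "null_density A f" shows "null_density A (\<lambda>p. c * f p)"
proof -
  obtain a where "diff_fun_on A a" "\<forall>p\<in>A. f p = total_deriv a p"
    using assms unfolding null_density_def by blast
  then show ?thesis unfolding null_density_def
    by (intro exI[of _ "\<lambda>p. c * a p"]) (auto simp: diff_fun_mult diff_fun_const total_deriv_mult total_deriv_const)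
qed

lemma null_density_uminus: "null_density A f \<Longrightarrow> null_density A (\<lambda>p. - f p)"
  using null_density_cmult[of f "-1"] by simp

lemma null_density_diff:
  "null_density A f \<Longrightarrow> null_density A g \<Longrightarrow> null_density A (\<lambda>p. f p - g p)"
  using null_density_add[OF _ null_density_uminus] by simp

lemma null_density_zero: "null_density A (\<lambda>p. 0)"
  using null_density_total_deriv[OF diff_fun_const[of 0]] by (rule null_density_cong) (simp add: total_deriv_const)

lemma null_density_sum:
  "(\<And>i. i \<in> I \<Longrightarrow> null_density A (f i)) \<Longrightarrow> null_density A (\<lambda>p. \<Sum>i\<in>I. f i p)"
  by (induction I rule: infinite_finite_induct) (auto intro: null_density_zero null_density_add)

lemma null_density_by_parts:
  assumes "diff_fun_on A f" "diff_fun_on A g"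
  shows "null_density A (\<lambda>p. f p * total_deriv g p + total_deriv f p * g p)"
  by (rule null_density_cong[OF null_density_total_deriv[OF diff_fun_mult[OF assms]]])
    (simp add: total_deriv_mult assms)

lemma null_density_by_parts_pow:
  assumes "diff_fun_on A f" "diff_fun_on A g"
  shows "null_density A (\<lambda>p. f p * ((-1) ^ s * (total_deriv ^^ s) g p) - (total_deriv ^^ s) f p * g p)"
  using assms(2)
proof (induction s arbitrary: g)
  case 0
  show ?case by (rule null_density_cong[OF null_density_zero]) simp
next
  case (Suc s)
  note f = diff_fun_total_deriv_pow[OF assms(1)]
  have "null_density A (\<lambda>p. - (f p * ((-1) ^ s * (total_deriv ^^ s) (total_deriv g) p) - (total_deriv ^^ s) f p * total_deriv g p)
     - ((total_deriv ^^ s) f p * total_deriv g p + total_deriv ((total_deriv ^^ s) f) p * g p))"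
    by (intro null_density_diff null_density_uminus Suc.IH null_density_by_parts diff_fun_total_deriv Suc.prems f)
  then show ?case by (rule null_density_cong) (simp add: funpow_swap1)
qed

subsection \<open>The Euler operator\<close>

lemma var_deriv_eq:
  assumes "dep_below n f" "p \<in> A"
  shows "var_deriv f i p = (\<Sum>s<n. (-1) ^ s * (total_deriv ^^ s) (jpd (Dep s i) f) p)"
  unfolding var_deriv_def
  by (rule suminf_finite) (use assms in \<open>auto simp: dep_below_def intro!: total_deriv_pow_zero\<close>)

lemma var_deriv_cong:
  assumes "\<And>q. q \<in> A \<Longrightarrow> f q = g q" "p \<in> A"
  shows "var_deriv f i p = var_deriv g i p"
  unfolding var_deriv_def using total_deriv_pow_cong[OF jpd_cong[of f g, OF assms(1)] assms(2)] by simp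

lemma diff_fun_var_deriv: assumes "diff_fun_on A f" shows "diff_fun_on A (var_deriv f i)"
proof -
  obtain n where n: "dep_below n f" using ex_dep_below assms by blast
  have "diff_fun_on A (\<lambda>p. \<Sum>s<n. (-1) ^ s * (total_deriv ^^ s) (jpd (Dep s i) f) p)"
    by (intro diff_fun_sum diff_fun_mult diff_fun_const diff_fun_total_deriv_pow diff_fun_jpd assms)
  then show ?thesis by (rule diff_fun_cong) (simp add: var_deriv_eq[OF n])
qed

lemma var_deriv_add:
  assumes "diff_fun_on A f" "diff_fun_on A g" "p \<in> A"
  shows "var_deriv (\<lambda>p. f p + g p) i p = var_deriv f i p + var_deriv g i p"
proof -
  obtain n where n: "dep_below n f" "dep_below n g" using ex_dep_below2 assms by blast
  have nn: "dep_below n (\<lambda>p. f p + g p)" using n assms by (auto simp: dep_below_def jpd_add)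
  have "(total_deriv ^^ s) (jpd (Dep s i) (\<lambda>p. f p + g p)) p
    = (total_deriv ^^ s) (jpd (Dep s i) f) p + (total_deriv ^^ s) (jpd (Dep s i) g) p" for s
    using total_deriv_pow_cong[of "jpd (Dep s i) (\<lambda>p. f p + g p)" "\<lambda>p. jpd (Dep s i) f p + jpd (Dep s i) g p" p s]
    by (simp add: assms jpd_add total_deriv_pow_add diff_fun_jpd)
  then show ?thesis
    by (simp add: var_deriv_eq[OF nn assms(3)] var_deriv_eq[OF n(1) assms(3)] var_deriv_eq[OF n(2) assms(3)]
        sum.distrib algebra_simps)
qed

lemma var_deriv_uminus:
  assumes "diff_fun_on A f" "p \<in> A"
  shows "var_deriv (\<lambda>p. - f p) i p = - var_deriv f i p"
proof -
  obtain n where n: "dep_below n f" using ex_dep_below assms by blast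
  have nn: "dep_below n (\<lambda>p. - f p)" using n assms by (auto simp: dep_below_def jpd_uminus)
  have "(total_deriv ^^ s) (jpd (Dep s i) (\<lambda>p. - f p)) p = - (total_deriv ^^ s) (jpd (Dep s i) f) p" for s
    using total_deriv_pow_cong[of "jpd (Dep s i) (\<lambda>p. - f p)" "\<lambda>p. - jpd (Dep s i) f p" p s]
    by (simp add: assms jpd_uminus total_deriv_pow_uminus diff_fun_jpd)
  then show ?thesis
    by (simp add: var_deriv_eq[OF nn assms(2)] var_deriv_eq[OF n assms(2)] sum_negf)
qed

text \<open>The commutator of d/du_(s+1) with D is d/du_(s), so the alternating Euler sum
  telescopes. Its partial sums leave one term, which vanishes beyond the order of
  \<open>f\<close>.\<close>

lemma var_deriv_total_deriv:
  assumes f: "diff_fun_on A f" and p: "p \<in> A"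
  shows "var_deriv (total_deriv f) i p = 0"
proof -
  obtain n where n: "dep_below n f" using ex_dep_below f by blast
  have *: "(\<Sum>s<Suc m. (-1) ^ s * (total_deriv ^^ s) (jpd (Dep s i) (total_deriv f)) p)
      = (-1) ^ m * (total_deriv ^^ Suc m) (jpd (Dep m i) f) p" for m
  proof (induction m)
    case 0
    show ?case by (simp add: jpd_total_deriv(2) f p)
  next
    case (Suc m)
    have "(total_deriv ^^ Suc m) (jpd (Dep (Suc m) i) (total_deriv f)) p
       = (total_deriv ^^ Suc m) (\<lambda>p. total_deriv (jpd (Dep (Suc m) i) f) p + jpd (Dep m i) f p) p"
      by (rule total_deriv_pow_cong) (simp_all add: jpd_total_deriv(3) f p)
    also have "\<dots> = (total_deriv ^^ Suc (Suc m)) (jpd (Dep (Suc m) i) f) p + (total_deriv ^^ Suc m) (jpd (Dep m i) f) p"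
      by (simp only: total_deriv_pow_add diff_fun_total_deriv diff_fun_jpd f p) (simp add: funpow_swap1)
    finally show ?case using Suc by (simp only: sum.lessThan_Suc[of _ "Suc m"]) (simp add: algebra_simps)
  qed
  have "(total_deriv ^^ Suc n) (jpd (Dep n i) f) p = 0"
    by (rule total_deriv_pow_zero) (use n p dep_belowD in auto)
  then show ?thesis
    unfolding var_deriv_eq[OF dep_below_total_deriv[OF f n] p] * by simp
qed

lemma var_deriv_null_density: "null_density A f \<Longrightarrow> p \<in> A \<Longrightarrow> var_deriv f i p = 0"
  unfolding null_density_def using var_deriv_total_deriv var_deriv_cong by metis

lemma var_deriv_eq_if_null_density:
  assumes "diff_fun_on A g" "null_density A (\<lambda>p. f p - g p)" "p \<in> A"
  shows "var_deriv f i p = var_deriv g i p"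
proof -
  have "var_deriv (\<lambda>p. (f p - g p) + g p) i p = var_deriv (\<lambda>p. f p - g p) i p + var_deriv g i p"
    using assms diff_fun_null_density by (intro var_deriv_add) auto
  then show ?thesis using var_deriv_null_density[OF assms(2,3)] by simp
qed

lemma var_deriv_order0: "dep_below (Suc 0) f \<Longrightarrow> p \<in> A \<Longrightarrow> var_deriv f i p = jpd (Dep 0 i) f p"
  by (simp add: var_deriv_eq)

lemma var_deriv_order1:
  "dep_below (Suc (Suc 0)) f \<Longrightarrow> p \<in> A \<Longrightarrow>
    var_deriv f i p = jpd (Dep 0 i) f p - total_deriv (jpd (Dep (Suc 0) i) f) p"
  by (simp add: var_deriv_eq)

text \<open>The derivative in the undifferentiated field commutes with D without a lower-order
  correction, and so passes through each term of the Euler sum.\<close>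

lemma jpd_var_deriv:
  assumes f: "diff_fun_on A f" and p: "p \<in> A"
  shows "jpd (Dep 0 j) (var_deriv f i) p = var_deriv (jpd (Dep 0 j) f) i p"
proof -
  obtain n where n: "dep_below n f" using ex_dep_below f by blast
  have "jpd (Dep 0 j) (var_deriv f i) p
     = jpd (Dep 0 j) (\<lambda>p. \<Sum>s<n. (-1) ^ s * (total_deriv ^^ s) (jpd (Dep s i) f) p) p"
    by (rule jpd_cong[OF _ p]) (simp add: var_deriv_eq[OF n])
  also have "\<dots> = (\<Sum>s<n. (-1) ^ s * jpd (Dep 0 j) ((total_deriv ^^ s) (jpd (Dep s i) f)) p)"
    by (simp add: jpd_sum jpd_mult jpd_const diff_fun_mult diff_fun_const diff_fun_total_deriv_pow diff_fun_jpd f p)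
  also have "\<dots> = (\<Sum>s<n. (-1) ^ s * (total_deriv ^^ s) (jpd (Dep s i) (jpd (Dep 0 j) f)) p)"
  proof -
    have "jpd (Dep 0 j) ((total_deriv ^^ s) (jpd (Dep s i) f)) p = (total_deriv ^^ s) (jpd (Dep s i) (jpd (Dep 0 j) f)) p" for s
      unfolding jpd_total_deriv_pow_0[OF diff_fun_jpd[OF f] p]
      by (rule total_deriv_pow_cong[OF _ p]) (rule jpd_commute[OF f])
    then show ?thesis by simp
  qed
  finally show ?thesis by (simp add: var_deriv_eq[OF dep_below_jpd[OF f n] p])
qed

text \<open>The Helmholtz condition for a variational derivative, tested only against constant variations.\<close>

lemma helmholtz:
  assumes f: "diff_fun_on A f" and p: "p \<in> A"
  shows "var_deriv (var_deriv f i) j p = jpd (Dep 0 i) (var_deriv f j) p"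
proof -
  obtain n0 where "dep_below n0 f" using ex_dep_below f by blast
  then have n: "dep_below (Suc n0) f" by (rule dep_below_mono) simp
  \<comment> \<open>All terms of the Euler sum except the first are total derivatives, so
    \<open>var_deriv f i\<close> and \<open>jpd (Dep 0 i) f\<close> define the same functional. The
    order bound has the form \<open>Suc n0\<close> in order to split off that first term.\<close>
  have "null_density A (\<lambda>p. \<Sum>s<n0. (-1) ^ Suc s * (total_deriv ^^ Suc s) (jpd (Dep (Suc s) i) f) p)"
    unfolding funpow.simps comp_def
    by (intro null_density_sum null_density_cmult null_density_total_deriv diff_fun_total_deriv_pow diff_fun_jpd f)
  then have "null_density A (\<lambda>p. var_deriv f i p - jpd (Dep 0 i) f p)"
    by (rule null_density_cong) (simp add: var_deriv_eq[OF n] sum.lessThan_Suc_shift del: sum.lessThan_Suc)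
  then have "var_deriv (var_deriv f i) j p = var_deriv (jpd (Dep 0 i) f) j p"
    by (rule var_deriv_eq_if_null_density[OF diff_fun_jpd[OF f] _ p])
  then show ?thesis by (simp add: jpd_var_deriv f p)
qed

subsection \<open>Evolutionary derivations\<close>

text \<open>The prolonged evolutionary vector field with characteristic \<open>\<eta>\<close>: the
  time derivative of \<open>f\<close> along the flow u_t = \<open>\<eta>\<close>.\<close>

definition pr :: "('n \<Rightarrow> 'n jet \<Rightarrow> real) \<Rightarrow> ('n jet \<Rightarrow> real) \<Rightarrow> 'n jet \<Rightarrow> real" where
  "pr \<eta> f p = (\<Sum>s. \<Sum>i\<in>UNIV. (total_deriv ^^ s) (\<eta> i) p * jpd (Dep s i) f p)"

lemma pr_eq:
  assumes "dep_below n f" "p \<in> A"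
  shows "pr \<eta> f p = (\<Sum>s<n. \<Sum>i\<in>UNIV. (total_deriv ^^ s) (\<eta> i) p * jpd (Dep s i) f p)"
  unfolding pr_def
  by (rule suminf_finite) (use assms in \<open>auto simp: dep_below_def intro!: sum.neutral\<close>)

lemma pr_cong:
  assumes "\<And>q. q \<in> A \<Longrightarrow> f q = g q" "p \<in> A"
  shows "pr \<eta> f p = pr \<eta> g p"
  unfolding pr_def using jpd_cong[of f g, OF assms] by simp

lemma pr_add:
  assumes "diff_fun_on A f" "diff_fun_on A g" "p \<in> A"
  shows "pr \<eta> (\<lambda>p. f p + g p) p = pr \<eta> f p + pr \<eta> g p"
proof -
  obtain n where n: "dep_below n f" "dep_below n g" using ex_dep_below2 assms by blast
  have "dep_below n (\<lambda>p. f p + g p)" using n assms by (auto simp: dep_below_def jpd_add)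
  then show ?thesis using assms n by (simp add: pr_eq jpd_add sum.distrib algebra_simps)
qed

lemma pr_mult:
  assumes "diff_fun_on A f" "diff_fun_on A g" "p \<in> A"
  shows "pr \<eta> (\<lambda>p. f p * g p) p = f p * pr \<eta> g p + pr \<eta> f p * g p"
proof -
  obtain n where n: "dep_below n f" "dep_below n g" using ex_dep_below2 assms by blast
  have "dep_below n (\<lambda>p. f p * g p)" using n assms by (auto simp: dep_below_def jpd_mult)
  then show ?thesis using assms n
    by (simp add: pr_eq jpd_mult sum.distrib sum_distrib_left sum_distrib_right algebra_simps)
qed

lemma pr_const: "pr \<eta> (\<lambda>p. c) p = 0"
  by (simp add: pr_def jpd_const)

lemma pr_sum:
  assumes "\<And>i. i \<in> I \<Longrightarrow> diff_fun_on A (f i)" "p \<in> A"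
  shows "pr \<eta> (\<lambda>p. \<Sum>i\<in>I. f i p) p = (\<Sum>i\<in>I. pr \<eta> (f i) p)"
  using assms(1)
  by (induction I rule: infinite_finite_induct)
    (use assms(2) in \<open>auto simp: pr_const pr_add diff_fun_sum\<close>)

lemma diff_fun_pr:
  assumes "\<And>i. diff_fun_on A (\<eta> i)" "diff_fun_on A f"
  shows "diff_fun_on A (pr \<eta> f)"
proof -
  obtain n where n: "dep_below n f" using ex_dep_below assms by blast
  have "diff_fun_on A (\<lambda>p. \<Sum>s<n. \<Sum>i\<in>UNIV. (total_deriv ^^ s) (\<eta> i) p * jpd (Dep s i) f p)"
    by (intro diff_fun_sum diff_fun_mult diff_fun_total_deriv_pow diff_fun_jpd assms)
  then show ?thesis by (rule diff_fun_cong) (simp add: pr_eq[OF n])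
qed

text \<open>The lower-order term in \<open>jpd_total_deriv(3)\<close> supplies exactly the summands
  in which the Leibniz rule differentiates \<open>\<eta>\<close>. The summand left over at the top
  carries a vanishing derivative of \<open>f\<close>.\<close>

lemma pr_total_deriv:
  assumes \<eta>: "\<And>i. diff_fun_on A (\<eta> i)" and f: "diff_fun_on A f" and p: "p \<in> A"
  shows "pr \<eta> (total_deriv f) p = total_deriv (pr \<eta> f) p"
proof -
  obtain n where n: "dep_below n f" using ex_dep_below f by blast
  define T where "T m = (\<Sum>s<m. \<Sum>i\<in>UNIV. total_deriv ((total_deriv ^^ s) (\<eta> i)) p * jpd (Dep s i) f p
      + (total_deriv ^^ s) (\<eta> i) p * total_deriv (jpd (Dep s i) f) p)" for m
  have *: "(\<Sum>s<Suc m. \<Sum>i\<in>UNIV. (total_deriv ^^ s) (\<eta> i) p * jpd (Dep s i) (total_deriv f) p)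
     = T m + (\<Sum>i\<in>UNIV. (total_deriv ^^ m) (\<eta> i) p * total_deriv (jpd (Dep m i) f) p)" for m
  proof (induction m)
    case 0
    show ?case by (simp add: T_def jpd_total_deriv(2) f p)
  next
    case (Suc m)
    show ?case
      by (simp only: sum.lessThan_Suc[of _ "Suc m"] Suc jpd_total_deriv(3)[OF f p])
        (simp add: T_def sum.distrib algebra_simps)
  qed
  have "(\<Sum>i\<in>UNIV. (total_deriv ^^ n) (\<eta> i) p * total_deriv (jpd (Dep n i) f) p) = 0"
  proof (intro sum.neutral ballI)
    fix i
    have "total_deriv (jpd (Dep n i) f) p = total_deriv (\<lambda>_. 0) p"
      by (rule total_deriv_cong[OF _ p]) (use n dep_belowD in auto)
    then show "(total_deriv ^^ n) (\<eta> i) p * total_deriv (jpd (Dep n i) f) p = 0" by (simp add: total_deriv_const)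
  qed
  then have "pr \<eta> (total_deriv f) p = T n"
    using pr_eq[OF dep_below_total_deriv[OF f n] p] * by simp
  also have "\<dots> = total_deriv (\<lambda>p. \<Sum>s<n. \<Sum>i\<in>UNIV. (total_deriv ^^ s) (\<eta> i) p * jpd (Dep s i) f p) p"
    unfolding T_def
    by (simp add: total_deriv_sum total_deriv_mult diff_fun_sum diff_fun_mult diff_fun_total_deriv_pow diff_fun_jpd \<eta> f p
      add.commute)
  also have "\<dots> = total_deriv (pr \<eta> f) p"
    by (rule total_deriv_cong[OF _ p]) (simp add: pr_eq[OF n])
  finally show ?thesis .
qed

text \<open>The first variation formula: integration by parts moves every power of D from
  \<open>\<eta>\<close> onto the derivatives of \<open>f\<close>.\<close>

lemma null_density_var_deriv_pr:
  assumes \<eta>: "\<And>i. diff_fun_on A (\<eta> i)" and f: "diff_fun_on A f"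
  shows "null_density A (\<lambda>p. (\<Sum>i\<in>UNIV. var_deriv f i p * \<eta> i p) - pr \<eta> f p)"
proof -
  obtain n where n: "dep_below n f" using ex_dep_below f by blast
  have "null_density A (\<lambda>p. \<Sum>s<n. \<Sum>i\<in>UNIV. \<eta> i p * ((-1) ^ s * (total_deriv ^^ s) (jpd (Dep s i) f) p)
       - (total_deriv ^^ s) (\<eta> i) p * jpd (Dep s i) f p)"
    by (intro null_density_sum null_density_by_parts_pow \<eta> diff_fun_jpd f)
  then show ?thesis
  proof (rule null_density_cong)
    fix p assume p: "p \<in> A"
    have "(\<Sum>i\<in>UNIV. var_deriv f i p * \<eta> i p) = (\<Sum>s<n. \<Sum>i\<in>UNIV. \<eta> i p * ((-1) ^ s * (total_deriv ^^ s) (jpd (Dep s i) f) p))"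
      by (subst sum.swap) (simp add: var_deriv_eq[OF n p] sum_distrib_left mult.commute)
    then show "(\<Sum>s<n. \<Sum>i\<in>UNIV. \<eta> i p * ((-1) ^ s * (total_deriv ^^ s) (jpd (Dep s i) f) p)
       - (total_deriv ^^ s) (\<eta> i) p * jpd (Dep s i) f p) = (\<Sum>i\<in>UNIV. var_deriv f i p * \<eta> i p) - pr \<eta> f p"
      by (simp add: pr_eq[OF n p] sum_subtractf)
  qed
qed

subsection \<open>Order counting\<close>

text \<open>D raises the top order by one and keeps the leading derivative. Any bound for
  \<open>f\<close> can therefore be lowered step by step until it reaches \<open>n\<close>.\<close>

lemma dep_below_if_total_deriv:
  assumes f: "diff_fun_on A f" and "dep_below (Suc n) (total_deriv f)"
  shows "dep_below n f"
proof -
  have step: "dep_below r f" if "dep_below (Suc r) f" "n \<le> r" for r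
    unfolding dep_below_def
  proof (intro allI impI ballI)
    fix s i p assume s: "r \<le> s" and p: "p \<in> A"
    show "jpd (Dep s i) f p = 0"
    proof (cases "s = r")
      case True
      have "total_deriv (jpd (Dep (Suc s) i) f) p = total_deriv (\<lambda>_. 0) p"
        by (rule total_deriv_cong[OF _ p]) (use that(1) s dep_belowD in auto)
      moreover have "jpd (Dep (Suc s) i) (total_deriv f) p = 0"
        using assms(2) True that p by (intro dep_belowD) auto
      ultimately show ?thesis using jpd_total_deriv(3)[OF f p, of s i] by (simp add: total_deriv_const)
    qed (use that(1) s p in \<open>auto intro: dep_belowD\<close>)
  qed
  obtain m where m: "dep_below m f" using ex_dep_below f by blast
  then have "dep_below (max m n) f" by (rule dep_below_mono) simp
  moreover have "n \<le> max m n" by simp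
  ultimately show ?thesis
    using step inc_induct[of n "max m n" "\<lambda>r. dep_below r f"] by blast
qed

lemma dep_below_if_total_deriv_pow:
  assumes f: "diff_fun_on A f" and "dep_below k ((total_deriv ^^ k) f)"
  shows "dep_below 0 f"
  using assms(2)
proof (induction k)
  case (Suc k)
  then show ?case using dep_below_if_total_deriv[OF diff_fun_total_deriv_pow[OF f], of k k] by simp
qed simp

lemma dep_below_0_total_deriv:
  assumes f: "diff_fun_on A f" and "dep_below 0 f"
  shows "dep_below 0 (total_deriv f)"
  unfolding dep_below_def
proof (intro allI impI ballI)
  fix s i p assume p: "p \<in> A"
  have z: "jpd (Dep r i) f q = 0" if "q \<in> A" for r q using assms(2) that dep_belowD by blast
  have "total_deriv (jpd (Dep s i) f) p = total_deriv (\<lambda>_. 0) p"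
    by (rule total_deriv_cong[OF z p])
  then show "jpd (Dep s i) (total_deriv f) p = 0"
    using f p by (cases s) (simp_all add: jpd_total_deriv(2,3) z total_deriv_const)
qed

text \<open>By order counting no field variable enters \<open>f\<close>, and on such functions D is
  the derivative in x.\<close>

lemma total_deriv_zero_imp_jpd_zero:
  assumes f: "diff_fun_on A f" and D: "\<And>p. p \<in> A \<Longrightarrow> total_deriv f p = 0" and p: "p \<in> A"
  shows "jpd a f p = 0"
proof -
  have "jpd a (total_deriv f) q = 0" if "q \<in> A" for a q
    using jpd_cong[of "total_deriv f" "\<lambda>_. 0", OF D that] by (simp add: jpd_const)
  then have "dep_below 0 f" by (intro dep_below_if_total_deriv[OF f]) (auto simp: dep_below_def)
  then show ?thesis
    using total_deriv_eq[of 0 f, OF _ p] D[OF p] p by (cases a) (auto dest: dep_belowD)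
qed

lemma total_deriv_Indep_power:
  assumes p: "p \<in> A"
  shows "total_deriv (\<lambda>p. p Indep ^ Suc k) p = real (Suc k) * p Indep ^ k"
proof (induction k)
  case 0
  show ?case using total_deriv_coord[OF p, of Indep] by simp
next
  case (Suc k)
  have "total_deriv (\<lambda>p. p Indep * p Indep ^ Suc k) p = p Indep * (real (Suc k) * p Indep ^ k) + p Indep ^ Suc k"
    using total_deriv_mult[OF diff_fun_coord[of Indep] diff_fun_power[OF diff_fun_coord[of Indep], of "Suc k"] p]
      Suc total_deriv_coord[OF p, of Indep] by simp
  then show ?case by (simp add: algebra_simps)
qed

text \<open>Integrating by parts against all powers of \<open>x\<close> makes \<open>Z\<close> a total derivative of every order,
  which exceeds the order of \<open>Z\<close> unless \<open>Z\<close> depends on \<open>x\<close> only.\<close>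

lemma moments_null_density:
  assumes Z: "\<And>k. null_density A (\<lambda>p. p Indep ^ k * Z p)" and p: "p \<in> A"
  shows "jpd (Dep s i) Z p = 0"
proof -
  have ex: "\<exists>\<theta>. diff_fun_on A \<theta> \<and> (\<forall>p\<in>A. Z p = (total_deriv ^^ m) \<theta> p) \<and> (\<forall>k. null_density A (\<lambda>p. p Indep ^ k * \<theta> p))" for m
  proof (induction m)
    case 0
    show ?case using Z diff_fun_null_density[OF Z[of 0]] by (intro exI[of _ Z]) simp
  next
    case (Suc m)
    then obtain \<theta> where t: "diff_fun_on A \<theta>" "\<And>p. p \<in> A \<Longrightarrow> Z p = (total_deriv ^^ m) \<theta> p" "\<And>k. null_density A (\<lambda>p. p Indep ^ k * \<theta> p)"
      by blast
    from t(3)[of 0] obtain \<theta>' where t': "diff_fun_on A \<theta>'" "\<And>p. p \<in> A \<Longrightarrow> \<theta> p = total_deriv \<theta>' p"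
      unfolding null_density_def by auto
    have "Z p = (total_deriv ^^ Suc m) \<theta>' p" if "p \<in> A" for p
      using t(2)[OF that] total_deriv_pow_cong[of \<theta> "total_deriv \<theta>'", OF t'(2) that, of m] by (simp add: funpow_swap1)
    moreover have "null_density A (\<lambda>p. p Indep ^ k * \<theta>' p)" for k
    proof -
      \<comment> \<open>Integration by parts against x^(k+1) trades D \<open>\<theta>'\<close> for
        (k+1) x^k \<open>\<theta>'\<close>, so the new primitive satisfies all moment conditions
        again.\<close>
      have "null_density A (\<lambda>p. (1 / real (Suc k)) * ((p Indep ^ Suc k * total_deriv \<theta>' p + total_deriv (\<lambda>p. p Indep ^ Suc k) p * \<theta>' p)
         - p Indep ^ Suc k * \<theta> p))"
        by (intro null_density_cmult null_density_diff null_density_by_parts diff_fun_power diff_fun_coord t' t)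
      then show ?thesis by (rule null_density_cong) (simp add: total_deriv_Indep_power t'(2) del: power_Suc of_nat_Suc)
    qed
    ultimately show ?case using t' by blast
  qed
  \<comment> \<open>As many primitives are taken as the order bound of \<open>Z\<close>: if D^n
    \<open>\<theta>\<close> has order below n, no field variable is left in
    \<open>\<theta>\<close>.\<close>
  obtain n where n: "dep_below n Z" using ex_dep_below diff_fun_null_density[OF Z[of 0]] by auto
  from ex[of n] obtain \<theta> where t: "diff_fun_on A \<theta>" "\<And>p. p \<in> A \<Longrightarrow> Z p = (total_deriv ^^ n) \<theta> p" by blast
  have "jpd (Dep s i) ((total_deriv ^^ n) \<theta>) q = jpd (Dep s i) Z q" if "q \<in> A" for s i q
    by (rule jpd_cong[OF _ that]) (simp add: t)
  then have "dep_below n ((total_deriv ^^ n) \<theta>)" using n by (simp add: dep_below_def)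
  then have "dep_below 0 \<theta>" by (rule dep_below_if_total_deriv_pow[OF t(1)])
  then have "dep_below 0 ((total_deriv ^^ m) \<theta>)" for m
    by (induction m) (auto intro: dep_below_0_total_deriv diff_fun_total_deriv_pow t(1))
  then have "jpd (Dep s i) ((total_deriv ^^ n) \<theta>) p = 0" using p dep_belowD by blast
  then show ?thesis using jpd_cong[of Z "(total_deriv ^^ n) \<theta>", OF t(2) p] by simp
qed

end

text \<open>Such a point is the jet of a constant field, where the chain rule terms of D
  vanish.\<close>

lemma (in jet_domain) jpd_Indep_total_deriv_static:
  assumes "diff_fun_on A f" "p \<in> A" "\<And>s i. p (Dep (Suc s) i) = 0"
  shows "total_deriv f p = jpd Indep f p"
proof -
  obtain n where "dep_below n f" using ex_dep_below assms by blast
  from total_deriv_eq[OF this assms(2)] show ?thesis using assms(3) by simp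
qed

subsection \<open>Third-order Hamiltonian operators\<close>

locale third_order_hamiltonian =
  fixes U :: "(real ^ 'n::finite) set"
    and g :: "real ^ 'n \<Rightarrow> real ^ 'n ^ 'n"
    and c :: "'n \<Rightarrow> 'n \<Rightarrow> 'n \<Rightarrow> real ^ 'n \<Rightarrow> real"
  assumes open_U: "open U"
    and smooth_g: "\<And>i j. smooth_on U (\<lambda>u. g u $ i $ j)"
    and smooth_c: "\<And>i j k. smooth_on U (c i j k)"
    and sym_g: "\<And>u. u \<in> U \<Longrightarrow> transpose (g u) = g u"
    and det_g: "\<And>u. u \<in> U \<Longrightarrow> det (g u) \<noteq> 0"
    and ham: "hamiltonian_operator U g c"

sublocale third_order_hamiltonian \<subseteq> jet_domain "jdom 0 U"
  by unfold_locales (rule open_jdom[OF open_U])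

context third_order_hamiltonian begin

abbreviation "A \<equiv> jdom 0 U"

lemma g_sym: "u \<in> U \<Longrightarrow> g u $ i $ j = g u $ j $ i"
  using sym_g[of u] by (metis transpose_def vec_lambda_beta)

definition Cx :: "'n \<Rightarrow> 'n \<Rightarrow> 'n jet \<Rightarrow> real" where
  "Cx i j p = (\<Sum>k\<in>UNIV. c i j k (jvec 0 p) * p (Dep (Suc 0) k))"

lemma jvec_in: "p \<in> A \<Longrightarrow> jvec 0 p \<in> U"
  by (simp add: jdom_def)

lemma diff_fun_g: "diff_fun_on A (\<lambda>p. g (jvec 0 p) $ i $ j)"
  by (rule diff_fun_jvec[OF open_U smooth_g]) simp

lemma diff_fun_c: "diff_fun_on A (\<lambda>p. c i j k (jvec 0 p))"
  by (rule diff_fun_jvec[OF open_U smooth_c]) simp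

lemma diff_fun_Cx: "diff_fun_on A (Cx i j)"
  unfolding Cx_def by (intro diff_fun_sum diff_fun_mult diff_fun_c diff_fun_coord)

lemma first_order_op_eq:
  "first_order_op 0 g c \<psi> i p = (\<Sum>j\<in>UNIV. g (jvec 0 p) $ i $ j * total_deriv (\<psi> j) p + Cx i j p * \<psi> j p)"
  by (simp add: first_order_op_def Cx_def)

lemma diff_fun_first_order_op:
  "(\<And>j. diff_fun_on A (\<psi> j)) \<Longrightarrow> diff_fun_on A (first_order_op 0 g c \<psi> i)"
  unfolding first_order_op_eq
  by (intro diff_fun_sum diff_fun_mult diff_fun_add diff_fun_g diff_fun_Cx diff_fun_total_deriv)

lemma diff_fun_third_order_op:
  "(\<And>j. diff_fun_on A (\<psi> j)) \<Longrightarrow> diff_fun_on A (third_order_op g c \<psi> i)"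
  unfolding third_order_op_def
  by (intro diff_fun_first_order_op diff_fun_total_deriv)

lemma first_order_op_cong:
  "(\<And>j q. q \<in> A \<Longrightarrow> \<psi> j q = \<phi> j q) \<Longrightarrow> p \<in> A \<Longrightarrow> first_order_op 0 g c \<psi> i p = first_order_op 0 g c \<phi> i p"
  unfolding first_order_op_eq using total_deriv_cong[of "\<psi> _" "\<phi> _"] by (intro sum.cong) auto

lemma diff_fun_bracket:
  "diff_fun_on A F \<Longrightarrow> diff_fun_on A G \<Longrightarrow> diff_fun_on A (bracket g c F G)"
  unfolding bracket_def
  by (intro diff_fun_sum diff_fun_mult diff_fun_third_order_op diff_fun_var_deriv)

lemma null_density_skew:
  "diff_fun_on A F \<Longrightarrow> diff_fun_on A G \<Longrightarrow> null_density A (\<lambda>p. bracket g c F G p + bracket g c G F p)"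
  using ham unfolding hamiltonian_operator_def by blast

lemma null_density_jacobi:
  "diff_fun_on A F \<Longrightarrow> diff_fun_on A G \<Longrightarrow> diff_fun_on A H \<Longrightarrow>
    null_density A (\<lambda>p. bracket g c (bracket g c F G) H p
          + bracket g c (bracket g c G H) F p + bracket g c (bracket g c H F) G p)"
  using ham unfolding hamiltonian_operator_def by blast

subsection \<open>Functionals that are linear in the field\<close>

definition xpoly :: "real poly \<Rightarrow> 'n jet \<Rightarrow> real" where
  "xpoly b p = poly b (p Indep)"

lemma diff_fun_xpoly: "diff_fun_on A (xpoly b)"
proof (induction b)
  case 0
  show ?case by (rule diff_fun_cong[OF diff_fun_const[of 0]]) (simp add: xpoly_def)
next
  case (pCons a b)
  have "diff_fun_on A (\<lambda>p. a + p Indep * xpoly b p)"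
    by (intro diff_fun_add diff_fun_const diff_fun_mult diff_fun_coord pCons)
  then show ?case by (rule diff_fun_cong) (simp add: xpoly_def)
qed

lemma jpd_xpoly: "jpd a (xpoly b) p = (case a of Indep \<Rightarrow> xpoly (pderiv b) p | Dep s i \<Rightarrow> 0)"
  unfolding xpoly_def by (rule jpd_eqI) (auto split: jvar.split)

lemma total_deriv_xpoly: "p \<in> A \<Longrightarrow> total_deriv (xpoly b) p = xpoly (pderiv b) p"
proof -
  assume p: "p \<in> A"
  have "dep_below 0 (xpoly b)" by (auto simp: dep_below_def jpd_xpoly)
  from total_deriv_eq[OF this p] show ?thesis by (simp add: jpd_xpoly)
qed

definition lin :: "real poly \<Rightarrow> 'n \<Rightarrow> 'n jet \<Rightarrow> real" where
  "lin b m p = xpoly b p * p (Dep 0 m)"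

lemma diff_fun_lin: "diff_fun_on A (lin b m)"
  unfolding lin_def by (intro diff_fun_mult diff_fun_xpoly diff_fun_coord)

lemma var_deriv_lin: "p \<in> A \<Longrightarrow> var_deriv (lin b m) i p = (if i = m then xpoly b p else 0)"
proof -
  assume p: "p \<in> A"
  have j: "jpd (Dep s i) (lin b m) q = (if s = 0 \<and> i = m then xpoly b q else 0)" if "q \<in> A" for s i q
    unfolding lin_def using that by (simp add: jpd_mult diff_fun_xpoly diff_fun_coord jpd_xpoly jpd_coord)
  have "dep_below (Suc 0) (lin b m)" by (auto simp: dep_below_def j)
  from var_deriv_order0[OF this p] show ?thesis by (simp add: j p)
qed

text \<open>\<open>Lx b m\<close> is the first-order operator applied to the covector with the single entry \<open>b(x)\<close> in position \<open>m\<close>.\<close>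

definition Lx :: "real poly \<Rightarrow> 'n \<Rightarrow> 'n \<Rightarrow> 'n jet \<Rightarrow> real" where
  "Lx b m i p = g (jvec 0 p) $ i $ m * xpoly (pderiv b) p + Cx i m p * xpoly b p"

lemma diff_fun_Lx: "diff_fun_on A (Lx b m i)"
  unfolding Lx_def by (intro diff_fun_add diff_fun_mult diff_fun_g diff_fun_xpoly diff_fun_Cx)

lemma first_order_op_lin:
  assumes p: "p \<in> A"
  shows "first_order_op 0 g c (\<lambda>j. total_deriv (var_deriv (lin b m) j)) i p = Lx (pderiv b) m i p"
proof -
  have t: "total_deriv (var_deriv (lin b m) j) q = (if j = m then xpoly (pderiv b) q else 0)" if "q \<in> A" for j q
  proof (cases "j = m")
    case True
    have "total_deriv (var_deriv (lin b m) j) q = total_deriv (xpoly b) q"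
      by (rule total_deriv_cong[OF _ that]) (simp add: var_deriv_lin True)
    then show ?thesis using True by (simp add: total_deriv_xpoly that)
  next
    case False
    have "total_deriv (var_deriv (lin b m) j) q = total_deriv (\<lambda>_. 0) q"
      by (rule total_deriv_cong[OF _ that]) (simp add: var_deriv_lin False)
    then show ?thesis using False by (simp add: total_deriv_const)
  qed
  have t2: "total_deriv (total_deriv (var_deriv (lin b m) j)) p = (if j = m then xpoly (pderiv (pderiv b)) p else 0)" for j
  proof (cases "j = m")
    case True
    have "total_deriv (total_deriv (var_deriv (lin b m) j)) p = total_deriv (xpoly (pderiv b)) p"
      by (rule total_deriv_cong[OF _ p]) (simp add: t True)
    then show ?thesis using True by (simp add: total_deriv_xpoly p)
  next
    case False
    have "total_deriv (total_deriv (var_deriv (lin b m) j)) p = total_deriv (\<lambda>_. 0) p"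
      by (rule total_deriv_cong[OF _ p]) (simp add: t False)
    then show ?thesis using False by (simp add: total_deriv_const)
  qed
  show ?thesis
    by (simp add: first_order_op_eq t t2 p Lx_def if_distrib[where f="\<lambda>x. _ * x"] sum.distrib cong: if_cong)
qed

lemma third_order_op_lin:
  "p \<in> A \<Longrightarrow> third_order_op g c (var_deriv (lin b m)) i p = total_deriv (Lx (pderiv b) m i) p"
  unfolding third_order_op_def by (rule total_deriv_cong[OF first_order_op_lin])

lemma bracket_lin:
  assumes "p \<in> A"
  shows "bracket g c (lin a i) (lin b j) p = xpoly a p * total_deriv (Lx (pderiv b) j i) p"
  unfolding bracket_def
  by (simp add: var_deriv_lin third_order_op_lin assms if_distrib[where f="\<lambda>x. x * _"] cong: if_cong)

subsection \<open>Consequences of skew-symmetry\<close>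

lemma total_deriv_g_eq: "p \<in> A \<Longrightarrow> total_deriv (\<lambda>p. g (jvec 0 p) $ i $ j) p
   = (\<Sum>k\<in>UNIV. pd k (\<lambda>u. g u $ i $ j) (jvec 0 p) * p (Dep (Suc 0) k))"
  using total_deriv_jvec[OF open_U smooth_g, of 0 p i j] by (simp add: mult.commute)

lemma diff_fun_pd_g: "diff_fun_on A (\<lambda>p. pd k (\<lambda>u. g u $ i $ j) (jvec 0 p))"
  by (rule diff_fun_jvec[OF open_U smooth_on_pd[OF smooth_g]]) simp

lemma diff_fun_pd_c: "diff_fun_on A (\<lambda>p. pd l (c i j k) (jvec 0 p))"
  by (rule diff_fun_jvec[OF open_U smooth_on_pd[OF smooth_c]]) simp

lemmas jpd_g = jpd_jvec[OF open_U smooth_g order_refl]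
lemmas jpd_c = jpd_jvec[OF open_U smooth_c order_refl]
lemmas jpd_pd_g = jpd_jvec[OF open_U smooth_on_pd[OF smooth_g] order_refl]
lemmas jpd_pd_c = jpd_jvec[OF open_U smooth_on_pd[OF smooth_c] order_refl]

lemmas diff_fun_intros = diff_fun_add diff_fun_mult diff_fun_diff diff_fun_uminus diff_fun_sum diff_fun_const
  diff_fun_coord diff_fun_xpoly diff_fun_g diff_fun_c diff_fun_pd_g diff_fun_pd_c diff_fun_Cx diff_fun_Lx
  diff_fun_total_deriv diff_fun_jpd

lemma jvec_jet_const: "jvec 0 (case_jvar t (\<lambda>s i. if s = 0 then u $ i else v s i)) = u"
  by (simp add: vec_eq_iff)

text \<open>Skew-symmetry for linear functionals with weights x^(k+1) and x becomes, after
  integration by parts, nullity of x^k times an expression linear in u_x. By the moment argument the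
  coefficients of that expression vanish.\<close>

lemma pd_g:
  assumes u: "u \<in> U"
  shows "pd l (\<lambda>u. g u $ i $ j) u = c i j l u + c j i l u"
proof -
  define S where "S k u = c i j k u + c j i k u - pd k (\<lambda>u. g u $ i $ j) u" for k u
  define Z where "Z p = (\<Sum>k\<in>UNIV. S k (jvec 0 p) * p (Dep (Suc 0) k))" for p :: "'n jet"
  have dS: "diff_fun_on A (\<lambda>p. S k (jvec 0 p))" for k
    unfolding S_def by (intro diff_fun_intros)
  have "null_density A (\<lambda>p. p Indep ^ k * Z p)" for k
  proof -
    define a where "a = monom (1 :: real) (Suc k)"
    define b where "b = [:0, 1 :: real:]"
    have b: "pderiv b = 1" by (simp add: b_def pderiv_pCons one_pCons)
    have a: "xpoly (pderiv a) p = real (Suc k) * p Indep ^ k" for p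
      by (simp add: a_def xpoly_def pderiv_monom poly_monom)
    have 1: "null_density A (\<lambda>p. bracket g c (lin a i) (lin b j) p + bracket g c (lin b j) (lin a i) p)"
      by (intro null_density_skew diff_fun_lin)
    have 2: "null_density A (\<lambda>p. xpoly a p * total_deriv (Lx (pderiv b) j i) p + total_deriv (xpoly a) p * Lx (pderiv b) j i p)"
      by (intro null_density_by_parts diff_fun_xpoly diff_fun_Lx)
    have 3: "null_density A (\<lambda>p. xpoly b p * total_deriv (Lx (pderiv a) i j) p + total_deriv (xpoly b) p * Lx (pderiv a) i j p)"
      by (intro null_density_by_parts diff_fun_xpoly diff_fun_Lx)
    have 4: "null_density A (\<lambda>p. g (jvec 0 p) $ i $ j * total_deriv (xpoly (pderiv a)) p
        + total_deriv (\<lambda>p. g (jvec 0 p) $ i $ j) p * xpoly (pderiv a) p)"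
      by (intro null_density_by_parts diff_fun_xpoly diff_fun_g)
    have "null_density A (\<lambda>p. (1 / real (Suc k)) * (
      (xpoly a p * total_deriv (Lx (pderiv b) j i) p + total_deriv (xpoly a) p * Lx (pderiv b) j i p)
      + (xpoly b p * total_deriv (Lx (pderiv a) i j) p + total_deriv (xpoly b) p * Lx (pderiv a) i j p)
      - (bracket g c (lin a i) (lin b j) p + bracket g c (lin b j) (lin a i) p)
      - (g (jvec 0 p) $ i $ j * total_deriv (xpoly (pderiv a)) p
        + total_deriv (\<lambda>p. g (jvec 0 p) $ i $ j) p * xpoly (pderiv a) p)))"
      by (intro null_density_cmult null_density_diff null_density_add 1 2 3 4)
    then show ?thesis
    proof (rule null_density_cong, goal_cases)
      case p: (1 p)
      have one: "xpoly 1 p = 1" "xpoly 0 p = 0" by (simp_all add: xpoly_def)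
      have "Z p = Cx i j p + Cx j i p - total_deriv (\<lambda>p. g (jvec 0 p) $ i $ j) p"
        by (simp add: Z_def S_def Cx_def total_deriv_g_eq p algebra_simps sum.distrib sum_subtractf)
      then show ?case
        using p g_sym[OF jvec_in[OF p], of i j]
        by (simp add: bracket_lin total_deriv_xpoly b Lx_def one pderiv_1 a del: of_nat_Suc)
          (simp add: field_simps del: of_nat_Suc)
    qed
  qed
  note m = moments_null_density[OF this]
  define p where "p = case_jvar 0 (\<lambda>s i. if s = 0 then u $ i else (0::real))"
  have ju: "jvec 0 p = u" unfolding p_def by (rule jvec_jet_const)
  have p: "p \<in> A" using u by (simp add: jdom_def ju)
  have "0 = jpd (Dep (Suc 0) l) Z p" using m[OF p] by simp
  also have "\<dots> = S l u"
    unfolding Z_def using p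
    by (simp add: jpd_sum jpd_mult diff_fun_mult diff_fun_coord dS jpd_coord ju S_def jpd_add jpd_diff jpd_c jpd_pd_g diff_fun_intros
       if_distrib[where f="\<lambda>x. _ * x"] cong: if_cong)
  finally show ?thesis by (simp add: S_def)
qed

lemma total_deriv_g: "p \<in> A \<Longrightarrow> total_deriv (\<lambda>p. g (jvec 0 p) $ i $ j) p = Cx i j p + Cx j i p"
  by (simp add: total_deriv_g_eq pd_g jvec_in Cx_def sum.distrib algebra_simps)

text \<open>Once the derivative of \<open>g\<close> is known, the operator is formally skew-adjoint
  on arbitrary covectors and not only on variational derivatives: the symmetric part of the inner
  pairing is D of \<open>\<mu>\<close> g \<open>\<nu>\<close>.\<close>

lemma null_density_third_order_op_skew:
  assumes \<psi>: "\<And>i. diff_fun_on A (\<psi> i)" and \<phi>: "\<And>i. diff_fun_on A (\<phi> i)"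
  shows "null_density A (\<lambda>p. (\<Sum>i\<in>UNIV. \<psi> i p * third_order_op g c \<phi> i p) + (\<Sum>i\<in>UNIV. \<phi> i p * third_order_op g c \<psi> i p))"
proof -
  define \<mu> where "\<mu> i = total_deriv (\<psi> i)" for i
  define \<nu> where "\<nu> i = total_deriv (\<phi> i)" for i
  have d: "diff_fun_on A (\<mu> i)" "diff_fun_on A (\<nu> i)" for i
    unfolding \<mu>_def \<nu>_def by (intro diff_fun_total_deriv \<psi> \<phi>)+
  have 1: "null_density A (\<lambda>p. \<Sum>i\<in>UNIV. \<psi> i p * total_deriv (first_order_op 0 g c \<nu> i) p + total_deriv (\<psi> i) p * first_order_op 0 g c \<nu> i p)"
    by (intro null_density_sum null_density_by_parts \<psi> diff_fun_first_order_op d)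
  have 2: "null_density A (\<lambda>p. \<Sum>i\<in>UNIV. \<phi> i p * total_deriv (first_order_op 0 g c \<mu> i) p + total_deriv (\<phi> i) p * first_order_op 0 g c \<mu> i p)"
    by (intro null_density_sum null_density_by_parts \<phi> diff_fun_first_order_op d)
  have 3: "null_density A (total_deriv (\<lambda>p. \<Sum>i\<in>UNIV. \<Sum>j\<in>UNIV. \<mu> i p * (g (jvec 0 p) $ i $ j * \<nu> j p)))"
    by (intro null_density_total_deriv diff_fun_intros d)
  have eq: "total_deriv (\<lambda>p. \<Sum>i\<in>UNIV. \<Sum>j\<in>UNIV. \<mu> i p * (g (jvec 0 p) $ i $ j * \<nu> j p)) p
      = (\<Sum>i\<in>UNIV. \<mu> i p * first_order_op 0 g c \<nu> i p) + (\<Sum>i\<in>UNIV. \<nu> i p * first_order_op 0 g c \<mu> i p)"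
    if p: "p \<in> A" for p
  proof -
    have "(\<Sum>i\<in>UNIV. \<nu> i p * first_order_op 0 g c \<mu> i p)
      = (\<Sum>i\<in>UNIV. \<Sum>j\<in>UNIV. \<nu> i p * (g (jvec 0 p) $ i $ j * total_deriv (\<mu> j) p + Cx i j p * \<mu> j p))"
      by (simp add: first_order_op_eq sum_distrib_left)
    also have "\<dots> = (\<Sum>i\<in>UNIV. \<Sum>j\<in>UNIV. \<nu> j p * (g (jvec 0 p) $ j $ i * total_deriv (\<mu> i) p + Cx j i p * \<mu> i p))"
      by (rule sum.swap)
    also have "\<dots> = (\<Sum>i\<in>UNIV. \<Sum>j\<in>UNIV. \<nu> j p * (g (jvec 0 p) $ i $ j * total_deriv (\<mu> i) p + Cx j i p * \<mu> i p))"
      using g_sym[OF jvec_in[OF p]] by (intro sum.cong refl) simp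
    finally show ?thesis using p
      by (simp add: total_deriv_sum total_deriv_mult d diff_fun_intros total_deriv_g)
       (simp add: first_order_op_eq sum_distrib_left algebra_simps flip: sum.distrib)
  qed
  have "null_density A (\<lambda>p. (\<Sum>i\<in>UNIV. \<psi> i p * total_deriv (first_order_op 0 g c \<nu> i) p + total_deriv (\<psi> i) p * first_order_op 0 g c \<nu> i p)
    + (\<Sum>i\<in>UNIV. \<phi> i p * total_deriv (first_order_op 0 g c \<mu> i) p + total_deriv (\<phi> i) p * first_order_op 0 g c \<mu> i p)
    - total_deriv (\<lambda>p. \<Sum>i\<in>UNIV. \<Sum>j\<in>UNIV. \<mu> i p * (g (jvec 0 p) $ i $ j * \<nu> j p)) p)"
    by (intro null_density_add null_density_diff 1 2 3)
  then show ?thesis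
  proof (rule null_density_cong, goal_cases)
    case (1 p)
    have "third_order_op g c \<phi> i = total_deriv (first_order_op 0 g c \<nu> i)"
      "third_order_op g c \<psi> i = total_deriv (first_order_op 0 g c \<mu> i)" for i
      by (simp_all add: third_order_op_def \<mu>_def[abs_def] \<nu>_def[abs_def])
    with 1 show ?case
      using eq[OF 1] by (simp add: sum.distrib flip: \<mu>_def \<nu>_def)
  qed
qed

subsection \<open>Consequences of the Jacobi identity\<close>

abbreviation ham_field :: "('n jet \<Rightarrow> real) \<Rightarrow> 'n \<Rightarrow> 'n jet \<Rightarrow> real" where
  "ham_field G i \<equiv> third_order_op g c (var_deriv G) i"

lemma diff_fun_ham_field: "diff_fun_on A G \<Longrightarrow> diff_fun_on A (ham_field G i)"
  by (intro diff_fun_third_order_op diff_fun_var_deriv)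

text \<open>Pairing the commutator of Hamiltonian vector fields with the covector \<open>var_deriv F\<close>:
  for \<open>F\<close> of order zero the second variation of \<open>F\<close> is a symmetric matrix, so it drops out.\<close>

lemma null_density_commutator:
  assumes F: "diff_fun_on A F" and F0: "dep_below (Suc 0) F" and G: "diff_fun_on A G" and H: "diff_fun_on A H"
  shows "null_density A (\<lambda>p. \<Sum>i\<in>UNIV. var_deriv F i p *
     (pr (ham_field H) (ham_field G i) p - pr (ham_field G) (ham_field H i) p - ham_field (bracket g c G H) i p))"
proof -
  let ?W = "var_deriv (bracket g c G H)"
  note Q = diff_fun_ham_field[OF G] diff_fun_ham_field[OF H]
  note FG = diff_fun_bracket[OF F G] and FH = diff_fun_bracket[OF F H] and GH = diff_fun_bracket[OF G H]
  have n0: "null_density A (\<lambda>p. bracket g c (bracket g c F G) H p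
          + bracket g c (bracket g c G H) F p + bracket g c (bracket g c H F) G p)"
    by (rule null_density_jacobi[OF F G H])
  have n1: "null_density A (\<lambda>p. bracket g c (bracket g c F G) H p - pr (ham_field H) (bracket g c F G) p)"
    unfolding bracket_def[of _ _ _ H] by (rule null_density_var_deriv_pr[OF Q(2) FG])
  have n3: "null_density A (\<lambda>p. bracket g c (bracket g c F H) G p - pr (ham_field G) (bracket g c F H) p)"
    unfolding bracket_def[of _ _ _ G] by (rule null_density_var_deriv_pr[OF Q(1) FH])
  \<comment> \<open>Skew-adjointness moves the operator from \<open>var_deriv F\<close> onto the
    bracket of \<open>G\<close> and \<open>H\<close>.\<close>
  have n2: "null_density A (\<lambda>p. bracket g c (bracket g c G H) F p + (\<Sum>i\<in>UNIV. var_deriv F i p * ham_field (bracket g c G H) i p))"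
    unfolding bracket_def[of _ _ _ F]
    by (intro null_density_third_order_op_skew diff_fun_var_deriv GH F)
  \<comment> \<open>The inner bracket is skew only up to a null density, which the Euler operator
    does not see.\<close>
  have HF: "bracket g c (bracket g c H F) G p = - bracket g c (bracket g c F H) G p" if p: "p \<in> A" for p
  proof -
    have "var_deriv (bracket g c H F) i p = var_deriv (\<lambda>p. - bracket g c F H p) i p" for i
      by (rule var_deriv_eq_if_null_density[OF diff_fun_uminus[OF FH] _ p])
        (rule null_density_cong[OF null_density_skew[OF H F]], simp)
    then show ?thesis by (simp add: bracket_def[of _ _ _ G] var_deriv_uminus FH p sum_negf)
  qed
  have pr_bracket: "pr \<eta> (bracket g c F K) p
     = (\<Sum>i\<in>UNIV. pr \<eta> (var_deriv F i) p * ham_field K i p) + (\<Sum>i\<in>UNIV. var_deriv F i p * pr \<eta> (ham_field K i) p)"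
    if "p \<in> A" "diff_fun_on A K" for \<eta> K p
    unfolding bracket_def using that
    by (simp add: pr_sum pr_mult diff_fun_intros diff_fun_ham_field diff_fun_var_deriv F sum.distrib algebra_simps)
  have vF: "var_deriv F i p = jpd (Dep 0 i) F p" if "p \<in> A" for i p
    by (rule var_deriv_order0[OF F0 that])
  have pvF: "pr \<eta> (var_deriv F i) p = (\<Sum>l\<in>UNIV. \<eta> l p * jpd (Dep 0 l) (jpd (Dep 0 i) F) p)" if p: "p \<in> A" for \<eta> i p
  proof -
    have "pr \<eta> (var_deriv F i) p = pr \<eta> (jpd (Dep 0 i) F) p" by (rule pr_cong[OF vF p])
    then show ?thesis by (simp add: pr_eq[OF dep_below_jpd[OF F F0] p])
  qed
  have sym: "(\<Sum>i\<in>UNIV. pr (ham_field H) (var_deriv F i) p * ham_field G i p)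
      = (\<Sum>i\<in>UNIV. pr (ham_field G) (var_deriv F i) p * ham_field H i p)" if p: "p \<in> A" for p
  proof -
    have "(\<Sum>i\<in>UNIV. pr (ham_field H) (var_deriv F i) p * ham_field G i p)
      = (\<Sum>i\<in>UNIV. \<Sum>l\<in>UNIV. ham_field H l p * jpd (Dep 0 l) (jpd (Dep 0 i) F) p * ham_field G i p)"
      by (simp add: pvF p sum_distrib_right)
    also have "\<dots> = (\<Sum>l\<in>UNIV. \<Sum>i\<in>UNIV. ham_field H l p * jpd (Dep 0 l) (jpd (Dep 0 i) F) p * ham_field G i p)"
      by (rule sum.swap)
    also have "\<dots> = (\<Sum>l\<in>UNIV. \<Sum>i\<in>UNIV. ham_field G i p * jpd (Dep 0 i) (jpd (Dep 0 l) F) p * ham_field H l p)"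
      by (intro sum.cong refl) (simp add: jpd_commute[OF F p] mult_ac)
    finally show ?thesis by (simp add: pvF p sum_distrib_right)
  qed
  have "null_density A (\<lambda>p. (bracket g c (bracket g c F G) H p
          + bracket g c (bracket g c G H) F p + bracket g c (bracket g c H F) G p)
      - (bracket g c (bracket g c F G) H p - pr (ham_field H) (bracket g c F G) p)
      - (bracket g c (bracket g c G H) F p + (\<Sum>i\<in>UNIV. var_deriv F i p * ham_field (bracket g c G H) i p))
      + (bracket g c (bracket g c F H) G p - pr (ham_field G) (bracket g c F H) p))"
    by (intro null_density_add null_density_diff n0 n1 n2 n3)
  then show ?thesis
  proof (rule null_density_cong, goal_cases)
    case (1 p)
    then show ?case
      by (simp add: HF pr_bracket G H sym right_diff_distrib sum_subtractf)
  qed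
qed

text \<open>Linear functionals \<open>F\<close> only show that the commutator depends on \<open>x\<close> alone, since functions of \<open>x\<close> are
  null densities; the quadratic functionals exclude the remaining terms.\<close>

lemma commutator_eq_0:
  assumes G: "diff_fun_on A G" and H: "diff_fun_on A H" and p: "p \<in> A"
  shows "pr (ham_field H) (ham_field G i) p - pr (ham_field G) (ham_field H i) p - ham_field (bracket g c G H) i p = 0"
proof -
  define Z where "Z i p = pr (ham_field H) (ham_field G i) p - pr (ham_field G) (ham_field H i) p - ham_field (bracket g c G H) i p" for i p
  have dZ: "diff_fun_on A (Z i)"
    unfolding Z_def by (intro diff_fun_diff diff_fun_pr diff_fun_ham_field diff_fun_bracket G H)
  have 1: "null_density A (\<lambda>p. p Indep ^ k * Z i p)" for k
  proof -
    have "dep_below (Suc 0) (lin (monom 1 k) i)"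
      unfolding dep_below_def lin_def by (auto simp: jpd_mult diff_fun_intros jpd_xpoly jpd_coord)
    from null_density_commutator[OF diff_fun_lin this G H]
    show ?thesis
      by (rule null_density_cong)
        (simp add: var_deriv_lin Z_def xpoly_def poly_monom if_distrib[where f="\<lambda>x. x * _"] cong: if_cong)
  qed
  have 2: "null_density A (\<lambda>p. p Indep ^ k * (p (Dep 0 i) * Z i p))" for k
  proof -
    \<comment> \<open>The factor 1/2 makes the variational derivative equal to x^k u^i.\<close>
    define F where "F p = xpoly (monom (1/2) k) p * (p (Dep 0 i) * p (Dep 0 i))" for p
    have F: "diff_fun_on A F" unfolding F_def by (intro diff_fun_intros)
    have jF: "jpd (Dep s l) F p = (if s = 0 \<and> l = i then p Indep ^ k * p (Dep 0 i) else 0)" if "p \<in> A" for s l p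
      unfolding F_def using that by (auto simp: jpd_mult diff_fun_intros jpd_xpoly jpd_coord) (simp add: xpoly_def poly_monom)
    have d: "dep_below (Suc 0) F" unfolding dep_below_def by (auto simp: jF)
    have vF: "var_deriv F l p = (if l = i then p Indep ^ k * p (Dep 0 i) else 0)" if "p \<in> A" for l p
      using var_deriv_order0[OF d that] jF[OF that] by simp
    from null_density_commutator[OF F d G H]
    show ?thesis
      by (rule null_density_cong) (simp add: vF Z_def if_distrib[where f="\<lambda>x. x * _"] mult.assoc cong: if_cong)
  qed
  \<comment> \<open>Neither \<open>Z i\<close> nor its product with u^i depends on u^i, so the
    product rule leaves \<open>Z i\<close> equal to 0.\<close>
  have "jpd (Dep 0 i) (\<lambda>p. p (Dep 0 i) * Z i p) p = p (Dep 0 i) * jpd (Dep 0 i) (Z i) p + Z i p"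
    using p by (simp add: jpd_mult diff_fun_coord dZ jpd_coord)
  then have "Z i p = 0"
    using moments_null_density[OF 1 p, of 0 i] moments_null_density[OF 2 p, of 0 i] by simp
  then show ?thesis by (simp add: Z_def)
qed

text \<open>The commutator is the \<open>x\<close>-derivative of the function below, which is hence constant.\<close>

lemma jpd_commutator_potential:
  assumes G: "diff_fun_on A G" and H: "diff_fun_on A H" and p: "p \<in> A"
  defines "pot K \<equiv> first_order_op 0 g c (\<lambda>j. total_deriv (var_deriv K j))"
  shows "jpd a (\<lambda>p. pr (ham_field H) (pot G i) p - pr (ham_field G) (pot H i) p - pot (bracket g c G H) i p) p = 0"
proof (rule total_deriv_zero_imp_jpd_zero[OF _ _ p])
  have dp: "diff_fun_on A (pot K i)" if "diff_fun_on A K" for K i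
    unfolding pot_def by (intro diff_fun_first_order_op diff_fun_total_deriv diff_fun_var_deriv that)
  show "diff_fun_on A (\<lambda>p. pr (ham_field H) (pot G i) p - pr (ham_field G) (pot H i) p - pot (bracket g c G H) i p)"
    by (intro diff_fun_diff diff_fun_pr dp diff_fun_ham_field diff_fun_bracket G H)
  fix p assume p: "p \<in> A"
  have hp: "ham_field K i = total_deriv (pot K i)" for K i
    by (simp add: third_order_op_def pot_def)
  have "pr (ham_field K) (ham_field G i) p = total_deriv (pr (ham_field K) (pot G i)) p"
    if "diff_fun_on A K" "diff_fun_on A G" for K G
    unfolding hp[of G] by (rule pr_total_deriv[OF diff_fun_ham_field dp p]) fact+
  then show "total_deriv (\<lambda>p. pr (ham_field H) (pot G i) p - pr (ham_field G) (pot H i) p - pot (bracket g c G H) i p) p = 0"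
    using commutator_eq_0[OF G H p, of i] p
    by (simp add: total_deriv_diff diff_fun_diff diff_fun_pr dp diff_fun_ham_field diff_fun_bracket G H)
      (simp add: hp)
qed

text \<open>\<open>Lx0\<close> is the partial derivative of \<open>Lx\<close> in \<open>u\<^sup>l\<close>, \<open>Wx\<close> the variational derivative of a bracket of two linear
  functionals, and \<open>Nx\<close> the function of \<open>jpd_commutator_potential\<close> for two linear functionals.\<close>

definition Lx0 :: "real poly \<Rightarrow> 'n \<Rightarrow> 'n \<Rightarrow> 'n \<Rightarrow> 'n jet \<Rightarrow> real" where
  "Lx0 b m i l p = pd l (\<lambda>u. g u $ i $ m) (jvec 0 p) * xpoly (pderiv b) p
     + (\<Sum>k\<in>UNIV. pd l (c i m k) (jvec 0 p) * p (Dep (Suc 0) k)) * xpoly b p"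

definition Wx :: "real poly \<Rightarrow> real poly \<Rightarrow> real poly \<Rightarrow> 'n \<Rightarrow> 'n \<Rightarrow> 'n \<Rightarrow> 'n jet \<Rightarrow> real" where
  "Wx a a' a'' j m l p = c j m l (jvec 0 p) * xpoly a p
     - pd l (\<lambda>u. g u $ j $ m) (jvec 0 p) * xpoly a' p
     + (\<Sum>k\<in>UNIV. (pd k (c j m l) (jvec 0 p) - pd l (c j m k) (jvec 0 p)) * p (Dep (Suc 0) k)) * xpoly a'' p"

lemma diff_fun_Lx0: "diff_fun_on A (Lx0 b m i l)"
  unfolding Lx0_def by (intro diff_fun_intros)

lemma diff_fun_Wx: "diff_fun_on A (Wx a a' a'' j m l)"
  unfolding Wx_def by (intro diff_fun_intros diff_fun_Lx0)

lemma jpd_Cx: "p \<in> A \<Longrightarrow> jpd a (Cx i j) p = (case a of Indep \<Rightarrow> 0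
   | Dep s l \<Rightarrow> if s = 0 then (\<Sum>k\<in>UNIV. pd l (c i j k) (jvec 0 p) * p (Dep (Suc 0) k))
     else if s = Suc 0 then c i j l (jvec 0 p) else 0)"
  unfolding Cx_def
  by (auto simp: jpd_sum jpd_mult diff_fun_intros jpd_c jpd_coord if_distrib[where f="\<lambda>x. _ * x"] mult.commute
    cong: if_cong split: jvar.split)

lemma jpd_Lx: "p \<in> A \<Longrightarrow> jpd a (Lx b m i) p = (case a of Indep \<Rightarrow> Lx (pderiv b) m i p
   | Dep s l \<Rightarrow> if s = 0 then Lx0 b m i l p else if s = Suc 0 then c i m l (jvec 0 p) * xpoly b p else 0)"
  unfolding Lx_def Lx0_def
  by (auto simp: jpd_add jpd_mult diff_fun_intros jpd_g jpd_Cx jpd_xpoly split: jvar.split)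

lemma dep_below_Lx: "dep_below (Suc (Suc 0)) (Lx b m i)"
  by (auto simp: dep_below_def jpd_Lx)

text \<open>One integration by parts yields a density of order one, for which two terms of the Euler
  sum remain. Only derivatives of the weights occur, since the operator annihilates constant
  covectors.\<close>

lemma var_deriv_bracket_lin:
  assumes p: "p \<in> A"
  shows "var_deriv (bracket g c (lin b j) (lin h m)) l p = Wx (pderiv (pderiv b * pderiv h)) (pderiv b * pderiv (pderiv h)) (pderiv b * pderiv h) j m l p"
proof -
  let ?\<beta> = "pderiv b" and ?\<gamma> = "pderiv h"
  have "null_density A (\<lambda>p. xpoly b p * total_deriv (Lx ?\<gamma> m j) p + total_deriv (xpoly b) p * Lx ?\<gamma> m j p)"
    by (intro null_density_by_parts diff_fun_xpoly diff_fun_Lx)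
  then have n: "null_density A (\<lambda>p. bracket g c (lin b j) (lin h m) p - (- (xpoly ?\<beta> p * Lx ?\<gamma> m j p)))"
    by (rule null_density_cong) (simp add: bracket_lin total_deriv_xpoly)
  define K where "K p = - (xpoly ?\<beta> p * Lx ?\<gamma> m j p)" for p
  have dK: "diff_fun_on A K" unfolding K_def by (intro diff_fun_intros)
  have jK: "jpd (Dep s l) K p = - (xpoly ?\<beta> p * jpd (Dep s l) (Lx ?\<gamma> m j) p)" if "p \<in> A" for s l p
    unfolding K_def using that by (simp add: jpd_uminus jpd_mult diff_fun_intros jpd_xpoly)
  have K2: "dep_below (Suc (Suc 0)) K"
    unfolding dep_below_def by (auto simp: jK jpd_Lx)
  have "var_deriv (bracket g c (lin b j) (lin h m)) l p = var_deriv K l p"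
    by (rule var_deriv_eq_if_null_density[OF dK _ p]) (use n in \<open>simp add: K_def\<close>)
  also have "\<dots> = jpd (Dep 0 l) K p - total_deriv (jpd (Dep (Suc 0) l) K) p"
    by (rule var_deriv_order1[OF K2 p])
  also have "total_deriv (jpd (Dep (Suc 0) l) K) p = total_deriv (\<lambda>p. - (c j m l (jvec 0 p) * xpoly (?\<beta> * ?\<gamma>) p)) p"
    by (rule total_deriv_cong[OF _ p]) (simp add: jK jpd_Lx xpoly_def)
  also have "\<dots> = - (c j m l (jvec 0 p) * xpoly (pderiv (?\<beta> * ?\<gamma>)) p
     + (\<Sum>k\<in>UNIV. pd k (c j m l) (jvec 0 p) * p (Dep (Suc 0) k)) * xpoly (?\<beta> * ?\<gamma>) p)"
    using p by (simp add: total_deriv_uminus total_deriv_mult diff_fun_intros total_deriv_xpoly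
       total_deriv_jvec[OF open_U smooth_c order_refl] mult.commute)
  finally show ?thesis
    by (simp add: jK p jpd_Lx Wx_def Lx0_def xpoly_def algebra_simps sum.distrib sum_subtractf)
qed

definition Nx :: "real poly \<Rightarrow> real poly \<Rightarrow> 'n \<Rightarrow> 'n \<Rightarrow> 'n \<Rightarrow> 'n jet \<Rightarrow> real" where
  "Nx b h j m i p =
     (\<Sum>l\<in>UNIV. total_deriv (Lx h m l) p * Lx0 b j i l p
        + total_deriv (total_deriv (Lx h m l)) p * (c i j l (jvec 0 p) * xpoly b p))
   - (\<Sum>l\<in>UNIV. total_deriv (Lx b j l) p * Lx0 h m i l p
        + total_deriv (total_deriv (Lx b j l)) p * (c i m l (jvec 0 p) * xpoly h p))
   - (\<Sum>l\<in>UNIV. g (jvec 0 p) $ i $ l * total_deriv (total_deriv (Wx (pderiv (b * h)) (b * pderiv h) (b * h) j m l)) p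
        + Cx i l p * total_deriv (Wx (pderiv (b * h)) (b * pderiv h) (b * h) j m l) p)"

text \<open>The functions \<open>Lx\<close> have order at most one, so each prolongation in the
  commutator potential reduces to the two terms written out in \<open>Nx\<close>.\<close>

lemma jpd_Nx:
  assumes p: "p \<in> A"
  shows "jpd a (Nx (pderiv b) (pderiv h) j m i) p = 0"
proof -
  define pot where "pot K = first_order_op 0 g c (\<lambda>j. total_deriv (var_deriv K j))" for K
  have "Nx (pderiv b) (pderiv h) j m i p = pr (ham_field (lin h m)) (pot (lin b j) i) p - pr (ham_field (lin b j)) (pot (lin h m) i) p
     - pot (bracket g c (lin b j) (lin h m)) i p" if p: "p \<in> A" for p
  proof -
    have pl: "pot (lin b j) i q = Lx (pderiv b) j i q" if "q \<in> A" for q b j i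
      unfolding pot_def by (rule first_order_op_lin[OF that])
    have hl: "ham_field (lin b j) l q = total_deriv (Lx (pderiv b) j l) q" if "q \<in> A" for q b j l
      by (rule third_order_op_lin[OF that])
    have hl': "total_deriv (ham_field (lin b j) l) p = total_deriv (total_deriv (Lx (pderiv b) j l)) p" for b j l
      by (rule total_deriv_cong[OF hl p])
    have prl: "pr (ham_field (lin h m)) (pot (lin b j) i) p = (\<Sum>l\<in>UNIV. total_deriv (Lx (pderiv h) m l) p * Lx0 (pderiv b) j i l p
        + total_deriv (total_deriv (Lx (pderiv h) m l)) p * (c i j l (jvec 0 p) * xpoly (pderiv b) p))" for b j h m
    proof -
      have "pr (ham_field (lin h m)) (pot (lin b j) i) p = pr (ham_field (lin h m)) (Lx (pderiv b) j i) p"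
        by (rule pr_cong[OF pl p])
      then show ?thesis by (simp add: pr_eq[OF dep_below_Lx p] hl p hl' jpd_Lx sum.distrib)
    qed
    have "total_deriv (var_deriv (bracket g c (lin b j) (lin h m)) l) q = total_deriv (Wx (pderiv (pderiv b * pderiv h)) (pderiv b * pderiv (pderiv h)) (pderiv b * pderiv h) j m l) q"
      if "q \<in> A" for q l by (rule total_deriv_cong[OF var_deriv_bracket_lin that])
    then have "pot (bracket g c (lin b j) (lin h m)) i p = first_order_op 0 g c (\<lambda>l. total_deriv (Wx (pderiv (pderiv b * pderiv h)) (pderiv b * pderiv (pderiv h)) (pderiv b * pderiv h) j m l)) i p"
      unfolding pot_def by (rule first_order_op_cong[OF _ p])
    then show ?thesis by (simp add: prl Nx_def first_order_op_eq)
  qed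
  from jpd_cong[OF this p] show ?thesis
    using jpd_commutator_potential[OF diff_fun_lin[of b j] diff_fun_lin[of h m] p, of a i, folded pot_def] by simp
qed

end

section \<open>Coefficients of the commutator identity for linear functionals\<close>

context jet_domain begin

lemma jpd_Suc_total_deriv_top:
  assumes "diff_fun_on A f" "dep_below (Suc n) f" "p \<in> A"
  shows "jpd (Dep (Suc n) i) (total_deriv f) p = jpd (Dep n i) f p"
proof -
  have "total_deriv (jpd (Dep (Suc n) i) f) p = total_deriv (\<lambda>_. 0) p"
    by (rule total_deriv_cong[OF _ assms(3)]) (use assms dep_belowD in auto)
  then show ?thesis using assms by (simp add: jpd_total_deriv(3) total_deriv_const)
qed

text \<open>Both copies of D contribute one commutator with the derivative below the top order,
  whence the factor 2. The index \<open>r\<close> is the predecessor of \<open>n\<close>.\<close>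

lemma jpd_Suc_total_deriv_subtop:
  assumes f: "diff_fun_on A f" "dep_below (Suc n) f" and p: "p \<in> A"
  shows "jpd (Dep (Suc (Suc n)) i) (total_deriv (total_deriv f)) p = jpd (Dep n i) f p"
    and "n = Suc r \<Longrightarrow> jpd (Dep (Suc n) i) (total_deriv (total_deriv f)) p
      = 2 * total_deriv (jpd (Dep n i) f) p + jpd (Dep r i) f p"
proof -
  note Df = diff_fun_total_deriv[OF f(1)] dep_below_total_deriv[OF f]
  show "jpd (Dep (Suc (Suc n)) i) (total_deriv (total_deriv f)) p = jpd (Dep n i) f p"
    by (simp add: jpd_Suc_total_deriv_top Df f p)
  assume n: "n = Suc r"
  have "total_deriv (jpd (Dep (Suc n) i) (total_deriv f)) p = total_deriv (jpd (Dep n i) f) p"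
    by (rule total_deriv_cong[OF jpd_Suc_total_deriv_top[OF f] p])
  then show "jpd (Dep (Suc n) i) (total_deriv (total_deriv f)) p = 2 * total_deriv (jpd (Dep n i) f) p + jpd (Dep r i) f p"
    using p f Df by (simp add: jpd_total_deriv(3) n)
qed

end

context third_order_hamiltonian begin

lemma jpd_Lx0:
  assumes p: "p \<in> A"
  shows "jpd (Dep (Suc (Suc s)) k) (Lx0 b m i l) p = 0"
    and "jpd (Dep (Suc 0) k) (Lx0 b m i l) p = pd l (c i m k) (jvec 0 p) * xpoly b p"
  unfolding Lx0_def using p
  by (simp_all add: jpd_add jpd_mult jpd_sum diff_fun_intros jpd_pd_g jpd_pd_c jpd_xpoly jpd_coord
     if_distrib[where f="\<lambda>x. _ * x"] cong: if_cong)

lemma jpd_Wx: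
  assumes p: "p \<in> A"
  shows "jpd (Dep (Suc (Suc s)) k) (Wx a a' a'' j m l) p = 0"
    and "jpd (Dep (Suc 0) k) (Wx a a' a'' j m l) p = (pd k (c j m l) (jvec 0 p) - pd l (c j m k) (jvec 0 p)) * xpoly a'' p"
    and "jpd Indep (Wx a a' a'' j m l) p = Wx (pderiv a) (pderiv a') (pderiv a'') j m l p"
    and "(\<And>k. p (Dep (Suc 0) k) = 0) \<Longrightarrow> jpd (Dep 0 k) (Wx a a' a'' j m l) p
      = pd k (c j m l) (jvec 0 p) * xpoly a p - pd k (pd l (\<lambda>u. g u $ j $ m)) (jvec 0 p) * xpoly a' p"
  unfolding Wx_def using p
  by (simp_all add: jpd_add jpd_diff jpd_mult jpd_sum diff_fun_intros jpd_pd_g jpd_pd_c jpd_c jpd_xpoly jpd_coord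
     if_distrib[where f="\<lambda>x. x * _"] mult.commute cong: if_cong)

lemma dep_below_Wx: "dep_below (Suc (Suc 0)) (Wx a a' a'' j m l)"
  unfolding dep_below_def
proof (intro allI impI ballI)
  fix s i p assume "Suc (Suc 0) \<le> s" "p \<in> A"
  moreover then obtain r where "s = Suc (Suc r)" by (metis Suc_le_D Suc_le_mono)
  ultimately show "jpd (Dep s i) (Wx a a' a'' j m l) p = 0" by (simp add: jpd_Wx)
qed

lemmas top_Lx = jpd_Suc_total_deriv_top[OF diff_fun_Lx dep_below_Lx] jpd_Suc_total_deriv_subtop(1)[OF diff_fun_Lx dep_below_Lx]
  jpd_Suc_total_deriv_subtop(2)[OF diff_fun_Lx dep_below_Lx _ refl]
lemmas top_Wx = jpd_Suc_total_deriv_top[OF diff_fun_Wx dep_below_Wx] jpd_Suc_total_deriv_subtop(1)[OF diff_fun_Wx dep_below_Wx]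
  jpd_Suc_total_deriv_subtop(2)[OF diff_fun_Wx dep_below_Wx _ refl]

lemmas high_Lx = dep_belowD[OF dep_below_total_deriv[OF diff_fun_Lx dep_below_Lx]]
lemmas high_Wx = dep_belowD[OF dep_below_total_deriv[OF diff_fun_Wx dep_below_Wx]]

text \<open>Only the terms with two total derivatives of \<open>Lx\<close> or \<open>Wx\<close>
  reach order three, and they contribute their leading derivatives.\<close>

lemma jpd_third_Nx:
  assumes p: "p \<in> A"
  shows "jpd (Dep (Suc (Suc (Suc 0))) k) (Nx b h j m i) p =
     (\<Sum>l\<in>UNIV. (c l m k (jvec 0 p) * xpoly h p) * (c i j l (jvec 0 p) * xpoly b p))
   - (\<Sum>l\<in>UNIV. (c l j k (jvec 0 p) * xpoly b p) * (c i m l (jvec 0 p) * xpoly h p))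
   - (\<Sum>l\<in>UNIV. g (jvec 0 p) $ i $ l * ((pd k (c j m l) (jvec 0 p) - pd l (c j m k) (jvec 0 p)) * xpoly (b * h) p))"
  unfolding Nx_def using p
  by (simp add: jpd_add jpd_diff jpd_mult jpd_sum diff_fun_intros diff_fun_Lx0 diff_fun_Wx jpd_c jpd_g jpd_xpoly jpd_Cx
     top_Lx top_Wx high_Lx high_Wx jpd_Lx jpd_Lx0 jpd_Wx)

text \<open>The coefficient of u_xxx in the identity for two functionals with weight x, for which
  both weights of \<open>Nx\<close> are 1.\<close>

lemma curl_c:
  assumes u: "u \<in> U"
  shows "(\<Sum>l\<in>UNIV. g u $ i $ l * (pd k (c j m l) u - pd l (c j m k) u))
    = (\<Sum>l\<in>UNIV. c i j l u * c l m k u) - (\<Sum>l\<in>UNIV. c i m l u * c l j k u)"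
proof -
  define p where "p = case_jvar 0 (\<lambda>s i. if s = 0 then u $ i else (0::real))"
  have ju: "jvec 0 p = u" unfolding p_def by (rule jvec_jet_const)
  have p: "p \<in> A" using u by (simp add: jdom_def ju)
  have "pderiv [:0, 1:] = (1 :: real poly)" by (simp add: pderiv_pCons one_pCons)
  then have "jpd (Dep (Suc (Suc (Suc 0))) k) (Nx 1 1 j m i) p = 0"
    using jpd_Nx[OF p, of _ "[:0,1:]" "[:0,1:]"] by simp
  then show ?thesis by (simp add: jpd_third_Nx p ju) (simp add: xpoly_def mult.commute)
qed

text \<open>At x = 0 the weight x vanishes while its derivative is 1, so the terms with the
  undifferentiated second weight drop out.\<close>

lemma jpd_second_Nx:
  assumes p: "p \<in> A" and z: "\<And>s k. p (Dep (Suc s) k) = 0" and x: "p Indep = 0"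
  shows "jpd (Dep (Suc (Suc 0)) k) (Nx 1 [:0, 1:] j m i) p =
     (\<Sum>l\<in>UNIV. (2 * c l m k (jvec 0 p) + pd k (\<lambda>u. g u $ l $ m) (jvec 0 p)) * c i j l (jvec 0 p))
   - (\<Sum>l\<in>UNIV. c l j k (jvec 0 p) * pd l (\<lambda>u. g u $ i $ m) (jvec 0 p))
   - (\<Sum>l\<in>UNIV. g (jvec 0 p) $ i $ l * (2 * (pd k (c j m l) (jvec 0 p) - pd l (c j m k) (jvec 0 p))
        + pd k (c j m l) (jvec 0 p) - pd k (pd l (\<lambda>u. g u $ j $ m)) (jvec 0 p)))"
proof -
  have dL: "total_deriv (jpd (Dep (Suc 0) k) (Lx b m l)) p = c l m k (jvec 0 p) * xpoly (pderiv b) p" for b m l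
  proof -
    have "total_deriv (jpd (Dep (Suc 0) k) (Lx b m l)) p = total_deriv (\<lambda>p. c l m k (jvec 0 p) * xpoly b p) p"
      by (rule total_deriv_cong[OF _ p]) (simp add: jpd_Lx)
    also have "\<dots> = jpd Indep (\<lambda>p. c l m k (jvec 0 p) * xpoly b p) p"
      by (intro jpd_Indep_total_deriv_static diff_fun_intros p z)
    finally show ?thesis using p by (simp add: jpd_mult diff_fun_intros jpd_c jpd_xpoly)
  qed
  have dW: "total_deriv (jpd (Dep (Suc 0) k) (Wx a a' a'' j m l)) p
      = (pd k (c j m l) (jvec 0 p) - pd l (c j m k) (jvec 0 p)) * xpoly (pderiv a'') p" for a a' a'' j m l
  proof -
    have "total_deriv (jpd (Dep (Suc 0) k) (Wx a a' a'' j m l)) p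
      = total_deriv (\<lambda>p. (pd k (c j m l) (jvec 0 p) - pd l (c j m k) (jvec 0 p)) * xpoly a'' p) p"
      by (rule total_deriv_cong[OF _ p]) (simp add: jpd_Wx)
    also have "\<dots> = jpd Indep (\<lambda>p. (pd k (c j m l) (jvec 0 p) - pd l (c j m k) (jvec 0 p)) * xpoly a'' p) p"
      by (intro jpd_Indep_total_deriv_static diff_fun_intros p z)
    finally show ?thesis using p by (simp add: jpd_mult jpd_diff diff_fun_intros jpd_pd_c jpd_xpoly)
  qed
  have sL: "total_deriv (Lx b m l) p = Lx (pderiv b) m l p" for b m l
    using jpd_Indep_total_deriv_static[OF diff_fun_Lx p z] p by (simp add: jpd_Lx)
  have Cx0: "Cx i j p = 0" for i j by (simp add: Cx_def z)
  have Lx00: "Lx0 b m i l p = pd l (\<lambda>u. g u $ i $ m) (jvec 0 p) * xpoly (pderiv b) p" for b m i l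
    by (simp add: Lx0_def z)
  have x1: "xpoly [:0, 1:] p = 0" "xpoly 1 p = 1" "xpoly 0 p = 0" "pderiv [:0, 1::real:] = 1" "pderiv 1 = (0 :: real poly)"
    by (simp_all add: xpoly_def x pderiv_pCons one_pCons)
  show ?thesis
    unfolding Nx_def using p
    by (simp add: jpd_add jpd_diff jpd_mult jpd_sum diff_fun_intros diff_fun_Lx0 diff_fun_Wx jpd_c jpd_g jpd_xpoly jpd_Cx
       top_Lx top_Wx high_Lx high_Wx jpd_Lx jpd_Lx0 jpd_Wx dL dW sL Cx0 Lx00 x1 z)
      (simp add: algebra_simps sum.distrib sum_subtractf)
qed

text \<open>On a constant field each total derivative acts on the polynomial weights alone.\<close>

lemma Nx_static:
  assumes p: "p \<in> A" and z: "\<And>s k. p (Dep (Suc s) k) = 0"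
  shows "Nx b h j m i p =
     (\<Sum>l\<in>UNIV. g (jvec 0 p) $ l $ m * xpoly (pderiv (pderiv h)) p * (pd l (\<lambda>u. g u $ i $ j) (jvec 0 p) * xpoly (pderiv b) p)
        + g (jvec 0 p) $ l $ m * xpoly (pderiv (pderiv (pderiv h))) p * (c i j l (jvec 0 p) * xpoly b p))
   - (\<Sum>l\<in>UNIV. g (jvec 0 p) $ l $ j * xpoly (pderiv (pderiv b)) p * (pd l (\<lambda>u. g u $ i $ m) (jvec 0 p) * xpoly (pderiv h) p)
        + g (jvec 0 p) $ l $ j * xpoly (pderiv (pderiv (pderiv b))) p * (c i m l (jvec 0 p) * xpoly h p))
   - (\<Sum>l\<in>UNIV. g (jvec 0 p) $ i $ l * (c j m l (jvec 0 p) * xpoly (pderiv (pderiv (pderiv (b * h)))) p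
        - pd l (\<lambda>u. g u $ j $ m) (jvec 0 p) * xpoly (pderiv (pderiv (b * pderiv h))) p))"
proof -
  have Cx0: "Cx i j p = 0" for i j by (simp add: Cx_def z)
  have sL: "total_deriv (Lx b m l) p = Lx (pderiv b) m l p" for b m l
    using jpd_Indep_total_deriv_static[OF diff_fun_Lx p z] p by (simp add: jpd_Lx)
  have sLL: "total_deriv (total_deriv (Lx b m l)) p = Lx (pderiv (pderiv b)) m l p" for b m l
  proof -
    have "total_deriv (total_deriv (Lx b m l)) p = total_deriv (jpd Indep (Lx b m l)) p"
      using jpd_Indep_total_deriv_static[OF diff_fun_total_deriv[OF diff_fun_Lx] p z]
        jpd_total_deriv(1)[OF diff_fun_Lx p] by simp
    also have "\<dots> = total_deriv (Lx (pderiv b) m l) p"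
      by (rule total_deriv_cong[OF _ p]) (simp add: jpd_Lx)
    finally show ?thesis by (simp add: sL)
  qed
  have sW: "total_deriv (Wx a a' a'' j m l) p = Wx (pderiv a) (pderiv a') (pderiv a'') j m l p" for a a' a'' j m l
    using jpd_Indep_total_deriv_static[OF diff_fun_Wx p z] p by (simp add: jpd_Wx)
  have sWW: "total_deriv (total_deriv (Wx a a' a'' j m l)) p = Wx (pderiv (pderiv a)) (pderiv (pderiv a')) (pderiv (pderiv a'')) j m l p" for a a' a'' j m l
  proof -
    have "total_deriv (total_deriv (Wx a a' a'' j m l)) p = total_deriv (jpd Indep (Wx a a' a'' j m l)) p"
      using jpd_Indep_total_deriv_static[OF diff_fun_total_deriv[OF diff_fun_Wx] p z]
        jpd_total_deriv(1)[OF diff_fun_Wx p] by simp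
    also have "\<dots> = total_deriv (Wx (pderiv a) (pderiv a') (pderiv a'') j m l) p"
      by (rule total_deriv_cong[OF _ p]) (simp add: jpd_Wx)
    finally show ?thesis by (simp add: sW)
  qed
  show ?thesis
    by (simp add: Nx_def sL sLL sWW Cx0) (simp add: Lx_def Lx0_def Wx_def z Cx0)
qed

lemma ex_static_jet:
  assumes "u \<in> U"
  obtains p where "p \<in> A" "jvec 0 p = u" "\<And>s k. p (Dep (Suc s) k) = 0" "p Indep = x"
proof
  let ?p = "case_jvar x (\<lambda>s i. if s = 0 then u $ i else (0::real))"
  show ju: "jvec 0 ?p = u" by (rule jvec_jet_const)
  show "?p \<in> A" using assms by (simp add: jdom_def ju)
qed auto

text \<open>The coefficient of u_xx, after the curl of \<open>c\<close> has been eliminated by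
  \<open>curl_c\<close> and the second derivatives of \<open>g\<close> by \<open>pd_g\<close>. It
  turns into the equation \<open>pd_\<Gamma>\<close> of the connection.\<close>

lemma pd_c_sym:
  assumes u: "u \<in> U"
  shows "(\<Sum>l\<in>UNIV. g u $ i $ l * pd k (c m j l) u) + (\<Sum>l\<in>UNIV. c i j l u * pd k (\<lambda>u. g u $ l $ m) u)
    + (\<Sum>l\<in>UNIV. (c i m l u - c m i l u) * c l j k u) = 0"
proof -
  obtain p where p: "p \<in> A" "jvec 0 p = u" "\<And>s k. p (Dep (Suc s) k) = 0" "p Indep = 0"
    using ex_static_jet[OF u, of 0] by blast
  have "pderiv [:0, 1:] = (1 :: real poly)" "pderiv [:0, 0, 1/2:] = [:0, 1:: real:]" by (simp_all add: pderiv_pCons one_pCons)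
  then have "jpd (Dep (Suc (Suc 0)) k) (Nx 1 [:0,1:] j m i) p = 0"
    using jpd_Nx[OF p(1), of _ "[:0,1:]" "[:0,0,1/2:]"] by simp
  then have *: "(\<Sum>l\<in>UNIV. (2 * c l m k u + pd k (\<lambda>u. g u $ l $ m) u) * c i j l u)
   - (\<Sum>l\<in>UNIV. c l j k u * pd l (\<lambda>u. g u $ i $ m) u)
   - (\<Sum>l\<in>UNIV. g u $ i $ l * (2 * (pd k (c j m l) u - pd l (c j m k) u)
        + pd k (c j m l) u - pd k (pd l (\<lambda>u. g u $ j $ m)) u)) = 0"
    by (simp add: jpd_second_Nx p)
  have pp: "pd k (pd l (\<lambda>u. g u $ j $ m)) u = pd k (c j m l) u + pd k (c m j l) u" for l
  proof -
    have "jpd (Dep 0 k) (\<lambda>p. pd l (\<lambda>u. g u $ j $ m) (jvec 0 p)) p = jpd (Dep 0 k) (\<lambda>p. c j m l (jvec 0 p) + c m j l (jvec 0 p)) p"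
      by (rule jpd_cong[OF _ p(1)]) (simp add: pd_g jvec_in)
    then show ?thesis using p by (simp add: jpd_pd_g jpd_add jpd_c diff_fun_intros)
  qed
  have "(\<Sum>l\<in>UNIV. g u $ i $ l * (2 * (pd k (c j m l) u - pd l (c j m k) u)
        + pd k (c j m l) u - pd k (pd l (\<lambda>u. g u $ j $ m)) u))
     = 2 * (\<Sum>l\<in>UNIV. g u $ i $ l * (pd k (c j m l) u - pd l (c j m k) u)) - (\<Sum>l\<in>UNIV. g u $ i $ l * pd k (c m j l) u)"
    by (simp add: pp algebra_simps sum.distrib sum_subtractf flip: sum_distrib_left)
  with * show ?thesis
    unfolding curl_c[OF u] by (simp add: pd_g u algebra_simps sum.distrib sum_subtractf flip: sum_distrib_left)
qed

text \<open>The derivative of \<open>Nx\<close> in x vanishes, so a value proportional to x along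
  the jets of one constant field has slope zero.\<close>

lemma Nx_static_const:
  assumes u: "u \<in> U" and Nx: "\<And>p. p \<in> A \<Longrightarrow> jvec 0 p = u \<Longrightarrow> (\<And>s k. p (Dep (Suc s) k) = 0) \<Longrightarrow>
     Nx (pderiv b) (pderiv h) j m i p = p Indep * K"
  shows "K = 0"
proof -
  obtain p where p: "p \<in> A" "jvec 0 p = u" "\<And>s k. p (Dep (Suc s) k) = 0" "p Indep = 0"
    using ex_static_jet[OF u, of 0] by blast
  have "Nx (pderiv b) (pderiv h) j m i (p(Indep := t)) = t * K" for t
  proof -
    have j: "jvec 0 (p(Indep := t)) = u" using p(2) by (subst line_jvec_other) auto
    then have "p(Indep := t) \<in> A" using u by (simp add: jdom_def)
    from Nx[OF this j] show ?thesis using p(3) by simp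
  qed
  then have "((\<lambda>t. Nx (pderiv b) (pderiv h) j m i (p(Indep := t))) has_field_derivative K) (at (p Indep))"
    by (auto intro!: derivative_eq_intros)
  from jpd_eqI[OF this] show ?thesis using jpd_Nx[OF p(1)] by simp
qed

lemma c_skew:
  assumes u: "u \<in> U"
  shows "(\<Sum>l\<in>UNIV. c i j l u * g u $ l $ m) + (\<Sum>l\<in>UNIV. c m j l u * g u $ l $ i) = 0"
proof -
  \<comment> \<open>The weights in \<open>Nx\<close> are 1 and x^4/24: three derivatives fall on the
    latter in each surviving term and leave one factor x.\<close>
  define h where "h = [:0, 0, 0, 0, 0, 1/120 :: real:]"
  define b where "b = [:0, 1 :: real:]"
  have b: "pderiv b = 1" by (simp add: b_def pderiv_pCons one_pCons)
  have x: "xpoly (pderiv (pderiv (pderiv (pderiv h)))) p = p Indep" for p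
    by (simp add: h_def pderiv_pCons xpoly_def)
  have x0: "xpoly 0 p = 0" "xpoly 1 p = 1" "pderiv 1 = (0 :: real poly)" for p by (simp_all add: xpoly_def pderiv_1)
  have "(\<Sum>l\<in>UNIV. c i j l u * g u $ l $ m) + (\<Sum>l\<in>UNIV. g u $ i $ l * c m j l u) = 0"
  proof (rule Nx_static_const[OF u])
    fix p assume p: "p \<in> A" "jvec 0 p = u" "\<And>s k. p (Dep (Suc s) k) = 0"
    show "Nx (pderiv b) (pderiv h) j m i p = p Indep * ((\<Sum>l\<in>UNIV. c i j l u * g u $ l $ m) + (\<Sum>l\<in>UNIV. g u $ i $ l * c m j l u))"
      using u by (simp add: Nx_static[OF p(1,3)] b p(2) x x0 pd_g)
        (simp add: algebra_simps sum.distrib sum_subtractf sum_negf flip: sum_distrib_left)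
  qed
  then show ?thesis by (simp add: g_sym[OF u, of i] mult.commute)
qed

lemma c_cyclic:
  assumes u: "u \<in> U"
  shows "(\<Sum>l\<in>UNIV. c j i l u * g u $ l $ m) + (\<Sum>l\<in>UNIV. c m j l u * g u $ l $ i)
     + (\<Sum>l\<in>UNIV. c i m l u * g u $ l $ j) = 0"
proof -
  \<comment> \<open>The weights in \<open>Nx\<close> are x and x^3/6. The third derivative of their
    product is 4 x, and the second derivative of x times x^2/2 is 3 x; these numbers make the new
    relation independent of \<open>c_skew\<close>.\<close>
  define h where "h = [:0, 0, 0, 0, 1/24 :: real:]"
  define b where "b = [:0, 0, 1/2 :: real:]"
  have b: "pderiv b = [:0, 1:]" by (simp add: b_def pderiv_pCons)
  have h: "pderiv h = [:0, 0, 0, 1/6:]" by (simp add: h_def pderiv_pCons)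
  have "(\<Sum>l\<in>UNIV. g u $ l $ m * (c i j l u + c j i l u)) + (\<Sum>l\<in>UNIV. g u $ i $ l * (2 * c m j l u - c j m l u))
     + (\<Sum>l\<in>UNIV. c i j l u * g u $ l $ m) + (\<Sum>l\<in>UNIV. g u $ i $ l * c m j l u) = 0"
  proof (rule Nx_static_const[OF u])
    fix p assume p: "p \<in> A" "jvec 0 p = u" "\<And>s k. p (Dep (Suc s) k) = 0"
    show "Nx (pderiv b) (pderiv h) j m i p = p Indep * ((\<Sum>l\<in>UNIV. g u $ l $ m * (c i j l u + c j i l u)) + (\<Sum>l\<in>UNIV. g u $ i $ l * (2 * c m j l u - c j m l u))
     + (\<Sum>l\<in>UNIV. c i j l u * g u $ l $ m) + (\<Sum>l\<in>UNIV. g u $ i $ l * c m j l u))"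
      using u by (simp add: Nx_static[OF p(1,3)] b h p(2) pd_g xpoly_def pderiv_pCons)
        (simp add: algebra_simps sum.distrib sum_subtractf sum_negf flip: sum_distrib_left)
  qed
  then have "2 * ((\<Sum>l\<in>UNIV. c i j l u * g u $ l $ m) + (\<Sum>l\<in>UNIV. c m j l u * g u $ l $ i))
    + (\<Sum>l\<in>UNIV. c j i l u * g u $ l $ m) + (\<Sum>l\<in>UNIV. c m j l u * g u $ l $ i) - (\<Sum>l\<in>UNIV. c j m l u * g u $ l $ i) = 0"
    by (simp add: g_sym[OF u, of i] algebra_simps sum.distrib sum_subtractf sum_distrib_left)
  then show ?thesis using c_skew[OF u, of i j m] c_skew[OF u, of j m i] by simp
qed

end

section \<open>Partial derivatives on R^n and the entries of an inverse matrix\<close>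

lemma pd_eqI: "(f has_derivative f') (at u) \<Longrightarrow> pd i f u = f' (axis i 1)"
  unfolding pd_def by (metis frechet_derivative_at)

lemma has_derivative_frechet: "f differentiable (at u) \<Longrightarrow> (f has_derivative frechet_derivative f (at u)) (at u)"
  using frechet_derivative_works by blast

lemma pd_cong_open:
  assumes "open U" "u \<in> U" "\<And>v. v \<in> U \<Longrightarrow> f v = h v"
  shows "pd i f u = pd i h u"
proof -
  have "(f has_derivative d) (at u) \<longleftrightarrow> (h has_derivative d) (at u)" for d
    using has_derivative_transform_within_open[OF _ assms(1,2), of f d UNIV h]
      has_derivative_transform_within_open[OF _ assms(1,2), of h d UNIV f] assms(3) by auto
  then show ?thesis by (simp add: pd_def frechet_derivative_def)
qed

lemma differentiable_cong_open:
  assumes "open U" "u \<in> U" "\<And>v. v \<in> U \<Longrightarrow> f v = h v" "f differentiable (at u)"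
  shows "h differentiable (at u)"
  using assms has_derivative_transform_within_open[of f _ u UNIV U h] unfolding differentiable_def by blast

lemma pd_add: "f differentiable (at u) \<Longrightarrow> h differentiable (at u) \<Longrightarrow> pd i (\<lambda>v. f v + h v) u = pd i f u + pd i h u"
  by (subst pd_eqI[OF has_derivative_add]) (auto intro: has_derivative_frechet simp: pd_def)

lemma pd_diff: "f differentiable (at u) \<Longrightarrow> h differentiable (at u) \<Longrightarrow> pd i (\<lambda>v. f v - h v) u = pd i f u - pd i h u"
  by (subst pd_eqI[OF has_derivative_diff]) (auto intro: has_derivative_frechet simp: pd_def)

lemma pd_uminus: "f differentiable (at u) \<Longrightarrow> pd i (\<lambda>v. - f v) u = - pd i f u"
  by (subst pd_eqI[OF has_derivative_minus]) (auto intro: has_derivative_frechet simp: pd_def)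

lemma pd_mult: "f differentiable (at u) \<Longrightarrow> h differentiable (at u) \<Longrightarrow>
    pd i (\<lambda>v. f v * h v) u = f u * pd i h u + pd i f u * h u"
  by (subst pd_eqI[OF has_derivative_mult]) (auto intro: has_derivative_frechet simp: pd_def)

lemma pd_sum: "(\<And>j. j \<in> J \<Longrightarrow> f j differentiable (at u)) \<Longrightarrow> pd i (\<lambda>v. \<Sum>j\<in>J. f j v) u = (\<Sum>j\<in>J. pd i (f j) u)"
  by (subst pd_eqI[OF has_derivative_sum]) (auto intro: has_derivative_frechet simp: pd_def)

lemma pd_const: "pd i (\<lambda>v. c) u = 0"
  by (subst pd_eqI[OF has_derivative_const]) auto

lemma pd_component: "pd i (\<lambda>v. v $ j) u = (if i = j then 1 else 0)"
proof -
  have "((\<lambda>v. v $ j) has_derivative (\<lambda>v. v $ j)) (at u)"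
    by (rule bounded_linear_imp_has_derivative) (rule bounded_linear_vec_nth)
  from pd_eqI[OF this] show ?thesis by (simp add: axis_def)
qed

lemma differentiable_component: "(\<lambda>v. v $ j) differentiable (at u)"
  using bounded_linear_imp_differentiable bounded_linear_vec_nth by blast

lemma differentiable_sum_family:
  "(\<And>j. j \<in> J \<Longrightarrow> f j differentiable (at u)) \<Longrightarrow> (\<lambda>v. \<Sum>j\<in>J. f j v) differentiable (at u)"
  by (induction J rule: infinite_finite_induct) auto

lemma differentiable_det:
  fixes M :: "'a::real_normed_vector \<Rightarrow> real ^ 'n ^ 'n"
  assumes "\<And>i j. (\<lambda>v. M v $ i $ j) differentiable (at u)"
  shows "(\<lambda>v. det (M v)) differentiable (at u)"
proof -
  have "(\<lambda>v. \<Prod>i\<in>I. M v $ i $ p i) differentiable (at u)" for p I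
    using assms by (induction I rule: infinite_finite_induct) auto
  then show ?thesis unfolding det_def by (intro differentiable_sum_family differentiable_mult) auto
qed

lemma matrix_inv_works:
  fixes A :: "real ^ 'n ^ 'n"
  assumes "det A \<noteq> 0"
  shows "A ** matrix_inv A = mat 1" "matrix_inv A ** A = mat 1"
proof -
  have "\<exists>B. A ** B = mat 1 \<and> B ** A = mat 1"
    using assms invertible_det_nz[of A] by (simp add: invertible_def)
  from someI_ex[OF this] show "A ** matrix_inv A = mat 1" "matrix_inv A ** A = mat 1"
    by (simp_all add: matrix_inv_def)
qed

text \<open>Column \<open>j\<close> of the inverse solves a linear system with right-hand side
  \<open>axis j 1\<close>. The quotient of determinants makes the differentiability of the inverse
  visible.\<close>

lemma matrix_inv_cramer:
  fixes A :: "real ^ 'n ^ 'n"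
  assumes "det A \<noteq> 0"
  shows "matrix_inv A $ i $ j = det (\<chi> k l. if l = i then axis j 1 $ k else A $ k $ l) / det A"
proof -
  have "A ** matrix_inv A = mat 1"
    using assms by (simp add: matrix_inv_works)
  then have "A *v (matrix_inv A *v axis j 1) = axis j 1"
    by (simp add: matrix_vector_mul_assoc)
  with cramer[OF assms] have "matrix_inv A *v axis j 1 = (\<chi> k. det (\<chi> i l. if l = k then axis j 1 $ i else A $ i $ l) / det A)"
    by blast
  then have "(matrix_inv A *v axis j 1) $ i = det (\<chi> k l. if l = i then axis j 1 $ k else A $ k $ l) / det A"
    by simp
  then show ?thesis by (simp add: matrix_vector_mult_basis column_def)
qed

subsection \<open>The flat connection\<close>

context third_order_hamiltonian begin

definition G :: "'n \<Rightarrow> 'n \<Rightarrow> real ^ 'n \<Rightarrow> real" where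
  "G i j u = matrix_inv (g u) $ i $ j"

text \<open>\<open>\<Gamma> j m l\<close> stands for \<open>\<Gamma>\<^sup>j\<^bsub>m l\<^esub> = g\<^sup>j\<^sup>q c\<^bsub>q m l\<^esub>\<close>, the coefficients of a flat connection.\<close>

definition \<Gamma> :: "'n \<Rightarrow> 'n \<Rightarrow> 'n \<Rightarrow> real ^ 'n \<Rightarrow> real" where
  "\<Gamma> j m l u = (\<Sum>q\<in>UNIV. G m q u * c q j l u)"

lemma differentiable_g: "u \<in> U \<Longrightarrow> (\<lambda>u. g u $ i $ j) differentiable (at u)"
  using smooth_on_differentiable[OF open_U smooth_g] .

lemma differentiable_c: "u \<in> U \<Longrightarrow> c i j k differentiable (at u)"
  using smooth_on_differentiable[OF open_U smooth_c] .

lemma differentiable_G: "u \<in> U \<Longrightarrow> G i j differentiable (at u)"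
proof -
  assume u: "u \<in> U"
  have "(\<lambda>v. det (g v)) differentiable (at u)"
    by (intro differentiable_det differentiable_g u)
  moreover have "(\<lambda>v. det (\<chi> k l. if l = i then axis j 1 $ k else g v $ k $ l)) differentiable (at u)"
  proof (rule differentiable_det)
    show "(\<lambda>v. (\<chi> k l. if l = i then axis j 1 $ k else g v $ k $ l) $ k $ l) differentiable (at u)" for k l
      using differentiable_g[OF u] by (cases "l = i") auto
  qed
  ultimately have "(\<lambda>v. det (\<chi> k l. if l = i then axis j 1 $ k else g v $ k $ l) / det (g v)) differentiable (at u)"
    using det_g[OF u] by (intro differentiable_divide) auto
  then show ?thesis
    by (rule differentiable_cong_open[OF open_U u, rotated]) (simp add: G_def matrix_inv_cramer det_g)
qed

lemma differentiable_\<Gamma>: "u \<in> U \<Longrightarrow> \<Gamma> i j k differentiable (at u)"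
  unfolding \<Gamma>_def[abs_def] by (intro differentiable_sum_family differentiable_mult differentiable_G differentiable_c)

lemma G_g:
  assumes "u \<in> U"
  shows "(\<Sum>k\<in>UNIV. G i k u * g u $ k $ j) = (if i = j then 1 else 0)"
    and "(\<Sum>k\<in>UNIV. g u $ i $ k * G k j u) = (if i = j then 1 else 0)"
proof -
  have "(matrix_inv (g u) ** g u) $ i $ j = (mat 1 :: real^'n^'n) $ i $ j"
    "(g u ** matrix_inv (g u)) $ i $ j = (mat 1 :: real^'n^'n) $ i $ j"
    using det_g[OF assms] by (simp_all add: matrix_inv_works)
  then show "(\<Sum>k\<in>UNIV. G i k u * g u $ k $ j) = (if i = j then 1 else 0)"
    "(\<Sum>k\<in>UNIV. g u $ i $ k * G k j u) = (if i = j then 1 else 0)"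
    by (simp_all add: matrix_matrix_mult_def mat_def G_def)
qed

lemma raise_lower:
  assumes "u \<in> U"
  shows "(\<Sum>k\<in>UNIV. G i k u * (\<Sum>b\<in>UNIV. g u $ k $ b * X b)) = X i"
    and "(\<Sum>k\<in>UNIV. g u $ i $ k * (\<Sum>b\<in>UNIV. G k b u * X b)) = X i"
proof -
  have "(\<Sum>k\<in>UNIV. G i k u * (\<Sum>b\<in>UNIV. g u $ k $ b * X b)) = (\<Sum>b\<in>UNIV. (\<Sum>k\<in>UNIV. G i k u * g u $ k $ b) * X b)"
    by (simp add: sum_distrib_left sum_distrib_right mult.assoc) (rule sum.swap)
  then show "(\<Sum>k\<in>UNIV. G i k u * (\<Sum>b\<in>UNIV. g u $ k $ b * X b)) = X i"
    by (simp add: G_g assms if_distrib[where f="\<lambda>x. x * _"] cong: if_cong)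
  have "(\<Sum>k\<in>UNIV. g u $ i $ k * (\<Sum>b\<in>UNIV. G k b u * X b)) = (\<Sum>b\<in>UNIV. (\<Sum>k\<in>UNIV. g u $ i $ k * G k b u) * X b)"
    by (simp add: sum_distrib_left sum_distrib_right mult.assoc) (rule sum.swap)
  then show "(\<Sum>k\<in>UNIV. g u $ i $ k * (\<Sum>b\<in>UNIV. G k b u * X b)) = X i"
    by (simp add: G_g assms if_distrib[where f="\<lambda>x. x * _"] cong: if_cong)
qed

lemma raise_cancel:
  assumes "u \<in> U" "\<And>i. (\<Sum>a\<in>UNIV. g u $ i $ a * X a) = (\<Sum>a\<in>UNIV. g u $ i $ a * Y a)"
  shows "X a = Y a"
  using raise_lower(1)[OF assms(1), of a X] raise_lower(1)[OF assms(1), of a Y] assms(2) by simp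

lemma lower_cancel:
  assumes "u \<in> U" "\<And>i. (\<Sum>a\<in>UNIV. G i a u * X a) = (\<Sum>a\<in>UNIV. G i a u * Y a)"
  shows "X a = Y a"
  using raise_lower(2)[OF assms(1), of a X] raise_lower(2)[OF assms(1), of a Y] assms(2) by simp

lemma G_sym: "u \<in> U \<Longrightarrow> G i j u = G j i u"
proof -
  assume u: "u \<in> U"
  have "transpose (matrix_inv (g u)) = matrix_inv (g u)"
  proof -
    have "g u ** transpose (matrix_inv (g u)) = mat 1"
      using det_g[OF u] sym_g[OF u] matrix_transpose_mul[of "matrix_inv (g u)" "g u"]
      by (simp add: matrix_inv_works transpose_mat)
    then have "matrix_inv (g u) ** (g u ** transpose (matrix_inv (g u))) = matrix_inv (g u)" by simp
    then show ?thesis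
      using det_g[OF u] by (simp add: matrix_mul_assoc matrix_inv_works)
  qed
  then have "transpose (matrix_inv (g u)) $ i $ j = matrix_inv (g u) $ i $ j" by simp
  then show ?thesis by (simp add: transpose_def G_def)
qed

lemma c_eq: "u \<in> U \<Longrightarrow> c i j k u = (\<Sum>a\<in>UNIV. g u $ i $ a * \<Gamma> j a k u)"
  unfolding \<Gamma>_def by (simp add: raise_lower)

lemma c_low_eq: "c_low g c i j k u = (\<Sum>q\<in>UNIV. G i q u * \<Gamma> q j k u)"
  unfolding c_low_def \<Gamma>_def G_def
  by (simp add: sum_distrib_left mult.assoc)

lemma \<Gamma>_eq: "u \<in> U \<Longrightarrow> \<Gamma> i j k u = (\<Sum>b\<in>UNIV. g u $ i $ b * c_low g c b j k u)"
  unfolding c_low_eq by (simp add: raise_lower)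

text \<open>The contractions in \<open>c_skew\<close> are \<open>\<Gamma>\<close> with both lower
  indices raised; nondegeneracy of \<open>g\<close> cancels the two factors.\<close>

lemma \<Gamma>_skew: assumes u: "u \<in> U" shows "\<Gamma> j m l u = - \<Gamma> j l m u"
proof -
  have "(\<Sum>a\<in>UNIV. g u $ i $ a * (\<Sum>l\<in>UNIV. g u $ m $ l * (\<Gamma> j a l u + \<Gamma> j l a u))) = 0" for i m
  proof -
    have "(\<Sum>l\<in>UNIV. c i j l u * g u $ l $ m) = (\<Sum>a\<in>UNIV. g u $ i $ a * (\<Sum>l\<in>UNIV. g u $ m $ l * \<Gamma> j a l u))"
      by (simp add: c_eq u sum_distrib_right sum_distrib_left g_sym[OF u, of m] mult_ac) (rule sum.swap)
    moreover have "(\<Sum>l\<in>UNIV. c m j l u * g u $ l $ i) = (\<Sum>a\<in>UNIV. g u $ i $ a * (\<Sum>l\<in>UNIV. g u $ m $ l * \<Gamma> j l a u))"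
      by (simp add: c_eq u sum_distrib_right sum_distrib_left g_sym[OF u, of i] mult_ac)
    ultimately show ?thesis using c_skew[OF u, of i j m]
      by (simp add: distrib_left sum.distrib)
  qed
  then have 1: "(\<Sum>l\<in>UNIV. g u $ m $ l * (\<Gamma> j a l u + \<Gamma> j l a u)) = 0" for m a
    using raise_cancel[OF u, of "\<lambda>a. \<Sum>l\<in>UNIV. g u $ m $ l * (\<Gamma> j a l u + \<Gamma> j l a u)" "\<lambda>_. 0" a] by simp
  have "\<Gamma> j m l u + \<Gamma> j l m u = 0"
    using raise_cancel[OF u, of "\<lambda>l. \<Gamma> j m l u + \<Gamma> j l m u" "\<lambda>_. 0" l] 1 by simp
  then show ?thesis by simp
qed

lemma c_low_skew: "u \<in> U \<Longrightarrow> c_low g c i j k u = - c_low g c i k j u"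
  using \<Gamma>_skew[of u _ j k] by (simp add: c_low_eq sum_negf)

text \<open>The three sums in \<open>c_cyclic\<close> are brought to one common triple contraction
  with \<open>g\<close>, and the three factors are cancelled one after the other.\<close>

lemma c_low_cyclic:
  assumes u: "u \<in> U" shows "c_low g c i j k u + c_low g c j k i u + c_low g c k i j u = 0"
proof -
  let ?T = "\<lambda>i j k. c_low g c i j k u"
  have e: "(\<Sum>l\<in>UNIV. c j i l u * g u $ l $ m)
     = (\<Sum>a\<in>UNIV. \<Sum>b\<in>UNIV. \<Sum>l\<in>UNIV. g u $ j $ a * (g u $ i $ b * (g u $ m $ l * ?T b a l)))" for i j m
  proof -
    have "(\<Sum>l\<in>UNIV. c j i l u * g u $ l $ m)
      = (\<Sum>l\<in>UNIV. \<Sum>a\<in>UNIV. \<Sum>b\<in>UNIV. g u $ j $ a * (g u $ i $ b * (g u $ m $ l * ?T b a l)))"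
      by (simp add: c_eq \<Gamma>_eq u sum_distrib_right sum_distrib_left g_sym[OF u, of m] mult_ac)
    also have "\<dots> = (\<Sum>a\<in>UNIV. \<Sum>l\<in>UNIV. \<Sum>b\<in>UNIV. g u $ j $ a * (g u $ i $ b * (g u $ m $ l * ?T b a l)))"
      by (rule sum.swap)
    also have "\<dots> = (\<Sum>a\<in>UNIV. \<Sum>b\<in>UNIV. \<Sum>l\<in>UNIV. g u $ j $ a * (g u $ i $ b * (g u $ m $ l * ?T b a l)))"
      by (rule sum.cong[OF refl], rule sum.swap)
    finally show ?thesis .
  qed
  have S: "(\<Sum>a\<in>UNIV. \<Sum>b\<in>UNIV. \<Sum>l\<in>UNIV. F a b l) = (\<Sum>l\<in>UNIV. \<Sum>a\<in>UNIV. \<Sum>b\<in>UNIV. F a b l)"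
    for F :: "'n \<Rightarrow> 'n \<Rightarrow> 'n \<Rightarrow> real"
    by (subst sum.swap[of "\<lambda>l a. \<Sum>b\<in>UNIV. F a b l"]) (rule sum.cong[OF refl], rule sum.swap)
  have "(\<Sum>a\<in>UNIV. g u $ j $ a * (\<Sum>b\<in>UNIV. g u $ i $ b * (\<Sum>l\<in>UNIV. g u $ m $ l * (?T b a l + ?T a l b + ?T l b a)))) = 0" for i j m
  proof -
    have "(\<Sum>l\<in>UNIV. c m j l u * g u $ l $ i)
      = (\<Sum>a\<in>UNIV. \<Sum>b\<in>UNIV. \<Sum>l\<in>UNIV. g u $ j $ a * (g u $ i $ b * (g u $ m $ l * ?T a l b)))"
      unfolding e[of m j i] S[of "\<lambda>a b l. g u $ j $ a * (g u $ i $ b * (g u $ m $ l * ?T a l b))"]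
      by (simp add: mult_ac)
    moreover have "(\<Sum>l\<in>UNIV. c i m l u * g u $ l $ j)
      = (\<Sum>a\<in>UNIV. \<Sum>b\<in>UNIV. \<Sum>l\<in>UNIV. g u $ j $ a * (g u $ i $ b * (g u $ m $ l * ?T l b a)))"
      unfolding e[of i m j] S[of "\<lambda>a b l. g u $ i $ a * (g u $ m $ b * (g u $ j $ l * ?T b a l))"]
      by (simp add: mult_ac)
    ultimately show ?thesis
      using c_cyclic[OF u, of j i m] unfolding e[of j i m]
      by (simp add: sum_distrib_left distrib_left sum.distrib)
  qed
  then have "(\<Sum>b\<in>UNIV. g u $ i $ b * (\<Sum>l\<in>UNIV. g u $ m $ l * (?T b a l + ?T a l b + ?T l b a))) = 0" for i m a
    using raise_cancel[OF u, of "\<lambda>a. \<Sum>b\<in>UNIV. g u $ i $ b * (\<Sum>l\<in>UNIV. g u $ m $ l * (?T b a l + ?T a l b + ?T l b a))" "\<lambda>_. 0" a] by simp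
  then have "(\<Sum>l\<in>UNIV. g u $ m $ l * (?T b a l + ?T a l b + ?T l b a)) = 0" for m a b
    using raise_cancel[OF u, of "\<lambda>b. \<Sum>l\<in>UNIV. g u $ m $ l * (?T b a l + ?T a l b + ?T l b a)" "\<lambda>_. 0" b] by simp
  then have "?T b a l + ?T a l b + ?T l b a = 0" for a b l
    using raise_cancel[OF u, of "\<lambda>l. ?T b a l + ?T a l b + ?T l b a" "\<lambda>_. 0" l] by simp
  then show ?thesis using \<open>?T i j k + ?T j k i + ?T k i j = 0\<close> by blast
qed

text \<open>Obtained by differentiating the product of \<open>G\<close> and \<open>g\<close>. It
  says that the metric \<open>G\<close> is parallel for the connection
  \<open>\<Gamma>\<close>.\<close>

lemma pd_G:
  assumes u: "u \<in> U"
  shows "pd k (G m p) u = - c_low g c m p k u - c_low g c p m k u"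
proof -
  have "(\<Sum>q\<in>UNIV. g u $ p $ q * pd k (G m q) u) = (\<Sum>q\<in>UNIV. g u $ p $ q * (- c_low g c m q k u - c_low g c q m k u))" for p
  proof -
    have "pd k (\<lambda>u. \<Sum>q\<in>UNIV. G m q u * g u $ q $ p) u = pd k (\<lambda>u. if m = p then 1 else 0) u"
      by (rule pd_cong_open[OF open_U u]) (simp add: G_g)
    then have "(\<Sum>q\<in>UNIV. G m q u * (c q p k u + c p q k u)) + (\<Sum>q\<in>UNIV. pd k (G m q) u * g u $ q $ p) = 0"
      by (simp add: pd_const pd_sum pd_mult differentiable_G differentiable_g u pd_g sum.distrib)
    moreover have "(\<Sum>q\<in>UNIV. pd k (G m q) u * g u $ q $ p) = (\<Sum>q\<in>UNIV. g u $ p $ q * pd k (G m q) u)"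
      by (simp add: g_sym[OF u, of p] mult.commute)
    moreover have "(\<Sum>q\<in>UNIV. G m q u * c q p k u) = (\<Sum>q\<in>UNIV. g u $ p $ q * c_low g c q m k u)"
      by (simp add: \<Gamma>_eq[OF u, symmetric] \<Gamma>_def)
    moreover have "(\<Sum>q\<in>UNIV. G m q u * c p q k u) = (\<Sum>q\<in>UNIV. g u $ p $ q * c_low g c m q k u)"
      by (simp add: c_eq[OF u] c_low_eq sum_distrib_left mult_ac) (rule sum.swap)
    ultimately show ?thesis
      by (simp add: distrib_left right_diff_distrib sum.distrib sum_subtractf sum_negf)
  qed
  then show ?thesis by (rule raise_cancel[OF u])
qed

text \<open>This is \<open>pd_c_sym\<close> with \<open>c\<close> expressed through \<open>g\<close>
  and \<open>\<Gamma>\<close>. Given \<open>pd_G\<close>, it is the last of the four classical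
  equations for g and c with one index raised.\<close>

lemma pd_\<Gamma>:
  assumes u: "u \<in> U"
  shows "pd k (\<Gamma> j m l) u = (\<Sum>b\<in>UNIV. \<Gamma> j b k u * \<Gamma> b m l u)"
proof -
  have "(\<Sum>a\<in>UNIV. g u $ m $ a * (\<Sum>l\<in>UNIV. g u $ i $ l * pd k (\<Gamma> j a l) u))
     = (\<Sum>a\<in>UNIV. g u $ m $ a * (\<Sum>l\<in>UNIV. g u $ i $ l * (\<Sum>b\<in>UNIV. \<Gamma> j b k u * \<Gamma> b a l u)))" for i m
  proof -
    have pc: "pd k (c m j l) u = (\<Sum>a\<in>UNIV. g u $ m $ a * pd k (\<Gamma> j a l) u) + (\<Sum>a\<in>UNIV. pd k (\<lambda>u. g u $ m $ a) u * \<Gamma> j a l u)" for l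
    proof -
      have "pd k (c m j l) u = pd k (\<lambda>u. \<Sum>a\<in>UNIV. g u $ m $ a * \<Gamma> j a l u) u"
        by (rule pd_cong_open[OF open_U u]) (rule c_eq)
      then show ?thesis by (simp add: pd_sum pd_mult differentiable_\<Gamma> differentiable_g u sum.distrib)
    qed
    have gs: "pd k (\<lambda>u. g u $ m $ a) u = pd k (\<lambda>u. g u $ a $ m) u" for a m
      by (simp add: pd_g u)
    \<comment> \<open>The terms in which \<open>g\<close> is differentiated cancel against the
      second sum of \<open>pd_c_sym\<close>, since exchanging the two contracted indices changes the
      sign of \<open>\<Gamma>\<close>.\<close>
    have canc: "(\<Sum>l\<in>UNIV. g u $ i $ l * (\<Sum>a\<in>UNIV. pd k (\<lambda>u. g u $ m $ a) u * \<Gamma> j a l u))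
        + (\<Sum>l\<in>UNIV. c i j l u * pd k (\<lambda>u. g u $ l $ m) u) = 0"
    proof -
      have "(\<Sum>l\<in>UNIV. c i j l u * pd k (\<lambda>u. g u $ l $ m) u) = (\<Sum>l\<in>UNIV. \<Sum>a\<in>UNIV. g u $ i $ a * (pd k (\<lambda>u. g u $ m $ l) u * \<Gamma> j a l u))"
        by (simp add: c_eq[OF u] sum_distrib_right sum_distrib_left gs[of m] mult_ac)
      also have "\<dots> = (\<Sum>a\<in>UNIV. \<Sum>l\<in>UNIV. g u $ i $ a * (pd k (\<lambda>u. g u $ m $ l) u * \<Gamma> j a l u))"
        by (rule sum.swap)
      also have "\<dots> = - (\<Sum>l\<in>UNIV. g u $ i $ l * (\<Sum>a\<in>UNIV. pd k (\<lambda>u. g u $ m $ a) u * \<Gamma> j a l u))"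
        by (subst \<Gamma>_skew[OF u]) (simp add: sum_distrib_left sum_negf)
      finally show ?thesis by simp
    qed
    \<comment> \<open>By the cyclic and skew identities the difference of the two \<open>c\<close>
      becomes a single \<open>c\<close> after contraction with \<open>g\<close>, which leaves a
      product of two \<open>\<Gamma>\<close>.\<close>
    have last: "(\<Sum>l\<in>UNIV. (c i m l u - c m i l u) * c l j k u)
      = - (\<Sum>a\<in>UNIV. g u $ m $ a * (\<Sum>l\<in>UNIV. g u $ i $ l * (\<Sum>b\<in>UNIV. \<Gamma> j b k u * \<Gamma> b a l u)))"
    proof -
      have T: "(\<Sum>l\<in>UNIV. (c i m l u - c m i l u) * g u $ l $ b) = - (\<Sum>l\<in>UNIV. c m b l u * g u $ l $ i)" for b
        using c_cyclic[OF u, of m i b] c_cyclic[OF u, of i m b] c_skew[OF u, of b m i] c_skew[OF u, of i b m] c_skew[OF u, of m i b]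
        by (simp add: left_diff_distrib sum_subtractf)
      have "(\<Sum>l\<in>UNIV. (c i m l u - c m i l u) * c l j k u)
         = (\<Sum>l\<in>UNIV. \<Sum>b\<in>UNIV. (c i m l u - c m i l u) * g u $ l $ b * \<Gamma> j b k u)"
        by (simp add: c_eq[OF u, of _ j] sum_distrib_left mult.assoc)
      also have "\<dots> = (\<Sum>b\<in>UNIV. (\<Sum>l\<in>UNIV. (c i m l u - c m i l u) * g u $ l $ b) * \<Gamma> j b k u)"
        by (subst sum.swap) (simp add: sum_distrib_right)
      also have "\<dots> = - (\<Sum>b\<in>UNIV. \<Sum>l\<in>UNIV. \<Sum>a\<in>UNIV. g u $ m $ a * (g u $ i $ l * (\<Gamma> j b k u * \<Gamma> b a l u)))"
        unfolding T by (simp add: c_eq[OF u, of m] sum_distrib_left sum_distrib_right g_sym[OF u, of i] mult_ac flip: sum_negf)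
      also have "(\<Sum>b\<in>UNIV. \<Sum>l\<in>UNIV. \<Sum>a\<in>UNIV. g u $ m $ a * (g u $ i $ l * (\<Gamma> j b k u * \<Gamma> b a l u)))
        = (\<Sum>l\<in>UNIV. \<Sum>b\<in>UNIV. \<Sum>a\<in>UNIV. g u $ m $ a * (g u $ i $ l * (\<Gamma> j b k u * \<Gamma> b a l u)))"
        by (rule sum.swap)
      also have "\<dots> = (\<Sum>l\<in>UNIV. \<Sum>a\<in>UNIV. \<Sum>b\<in>UNIV. g u $ m $ a * (g u $ i $ l * (\<Gamma> j b k u * \<Gamma> b a l u)))"
        by (rule sum.cong[OF refl], rule sum.swap)
      also have "\<dots> = (\<Sum>a\<in>UNIV. \<Sum>l\<in>UNIV. \<Sum>b\<in>UNIV. g u $ m $ a * (g u $ i $ l * (\<Gamma> j b k u * \<Gamma> b a l u)))"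
        by (rule sum.swap)
      finally show ?thesis by (simp add: sum_distrib_left)
    qed
    have "(\<Sum>l\<in>UNIV. g u $ i $ l * pd k (c m j l) u) = (\<Sum>a\<in>UNIV. g u $ m $ a * (\<Sum>l\<in>UNIV. g u $ i $ l * pd k (\<Gamma> j a l) u))
        + (\<Sum>l\<in>UNIV. g u $ i $ l * (\<Sum>a\<in>UNIV. pd k (\<lambda>u. g u $ m $ a) u * \<Gamma> j a l u))"
      unfolding pc by (simp add: distrib_left sum.distrib sum_distrib_left mult_ac) (rule sum.swap)
    then show ?thesis using pd_c_sym[OF u, of i k m j] canc last by simp
  qed
  then have "(\<Sum>l\<in>UNIV. g u $ i $ l * pd k (\<Gamma> j m l) u) = (\<Sum>l\<in>UNIV. g u $ i $ l * (\<Sum>b\<in>UNIV. \<Gamma> j b k u * \<Gamma> b m l u))" for i m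
    by (rule raise_cancel[OF u])
  then show ?thesis by (rule raise_cancel[OF u])
qed

subsection \<open>Fluxes and the flat connection\<close>

text \<open>In index notation: \<open>v\<^sub>a\<close>, the covariant derivative \<open>v\<^sup>s\<^bsub>, l\<^esub> - \<Gamma>\<^sup>s\<^bsub>i l\<^esub> v\<^sup>i\<close>, and minus its lowered version,
  which is the value of \<open>\<partial>\<psi>\<^sub>a / \<partial>b\<^sup>l\<close>.\<close>

definition flux_low :: "('n \<Rightarrow> real ^ 'n \<Rightarrow> real) \<Rightarrow> 'n \<Rightarrow> real ^ 'n \<Rightarrow> real" where
  "flux_low v a u = (\<Sum>i\<in>UNIV. G a i u * v i u)"

definition flux_cov :: "('n \<Rightarrow> real ^ 'n \<Rightarrow> real) \<Rightarrow> 'n \<Rightarrow> 'n \<Rightarrow> real ^ 'n \<Rightarrow> real" where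
  "flux_cov v s l u = pd l (v s) u - (\<Sum>i\<in>UNIV. \<Gamma> s i l u * v i u)"

definition flux_cov_low :: "('n \<Rightarrow> real ^ 'n \<Rightarrow> real) \<Rightarrow> 'n \<Rightarrow> 'n \<Rightarrow> real ^ 'n \<Rightarrow> real" where
  "flux_cov_low v a l u = - (\<Sum>b\<in>UNIV. G a b u * flux_cov v b l u)"

lemma \<Gamma>_flux_low:
  assumes u: "u \<in> U"
  shows "(\<Sum>m\<in>UNIV. \<Gamma> m a j u * flux_low v m u) = (\<Sum>i\<in>UNIV. c_low g c i a j u * v i u)"
proof -
  have "(\<Sum>m\<in>UNIV. \<Gamma> m a j u * flux_low v m u) = (\<Sum>m\<in>UNIV. \<Sum>i\<in>UNIV. G i m u * \<Gamma> m a j u * v i u)"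
    by (simp add: flux_low_def sum_distrib_left G_sym[OF u] mult_ac)
  also have "\<dots> = (\<Sum>i\<in>UNIV. c_low g c i a j u * v i u)"
    by (subst sum.swap) (simp add: c_low_eq sum_distrib_right)
  finally show ?thesis .
qed

lemma flux_cov_low_eq:
  "flux_cov_low v a j u = (\<Sum>i\<in>UNIV. c_low g c a i j u * v i u) - (\<Sum>b\<in>UNIV. G a b u * pd j (v b) u)"
proof -
  have "(\<Sum>b\<in>UNIV. G a b u * (\<Sum>i\<in>UNIV. \<Gamma> b i j u * v i u)) = (\<Sum>i\<in>UNIV. c_low g c a i j u * v i u)"
    by (simp add: c_low_eq sum_distrib_left sum_distrib_right mult.assoc) (rule sum.swap)
  then show ?thesis
    by (simp add: flux_cov_low_def flux_cov_def right_diff_distrib sum_subtractf)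
qed

text \<open>The two conditions differ by a contraction of \<open>v\<close> with a combination of
  \<open>c_low\<close> that is zero by the cyclic and skew identities. The right-hand side is the
  Helmholtz condition for the covector \<open>\<psi>\<close>.\<close>

lemma symmetric_iff_flux_cov_low:
  assumes u: "u \<in> U"
  shows "(\<Sum>m\<in>UNIV. G a m u * pd j (v m) u) = (\<Sum>m\<in>UNIV. G j m u * pd a (v m) u) \<longleftrightarrow>
    flux_cov_low v a j u - (\<Sum>m\<in>UNIV. \<Gamma> m a j u * flux_low v m u) = flux_cov_low v j a u"
proof -
  have "c_low g c a i j u - c_low g c i a j u - c_low g c j i a u = 0" for i
    using c_low_cyclic[OF u, of a i j] c_low_skew[OF u, of i a j] c_low_skew[OF u, of j i a] by simp
  then have "(\<Sum>i\<in>UNIV. (c_low g c a i j u - c_low g c i a j u - c_low g c j i a u) * v i u) = 0" by simp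
  then show ?thesis
    unfolding \<Gamma>_flux_low[OF u] flux_cov_low_eq by (simp add: left_diff_distrib sum_subtractf) linarith
qed

text \<open>Since \<open>G\<close> is parallel, lowering the index commutes with covariant
  differentiation.\<close>

lemma flux_low_parallel:
  assumes u: "u \<in> U" and v: "\<And>i. v i differentiable (at u)"
  shows "pd l (flux_low v a) u = - flux_cov_low v a l u - (\<Sum>m\<in>UNIV. \<Gamma> m a l u * flux_low v m u)"
  unfolding \<Gamma>_flux_low[OF u] flux_cov_low_eq
  unfolding flux_low_def[abs_def]
  by (simp add: pd_sum pd_mult differentiable_G u v pd_G sum.distrib sum_subtractf left_diff_distrib sum_negf)

lemma differentiable_flux_cov:
  assumes u: "u \<in> U" and v: "\<And>i. v i differentiable (at u)" "\<And>i l. pd l (v i) differentiable (at u)"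
  shows "flux_cov v s l differentiable (at u)"
  unfolding flux_cov_def[abs_def]
  by (intro differentiable_diff differentiable_sum_family differentiable_mult v differentiable_\<Gamma> u)

lemma differentiable_flux_cov_low:
  assumes u: "u \<in> U" and v: "\<And>i. v i differentiable (at u)" "\<And>i l. pd l (v i) differentiable (at u)"
  shows "flux_cov_low v s l differentiable (at u)"
  unfolding flux_cov_low_def[abs_def]
  by (intro differentiable_minus differentiable_sum_family differentiable_mult differentiable_flux_cov v differentiable_G u)

text \<open>By \<open>pd_\<Gamma>\<close> the terms with undifferentiated \<open>v\<close> cancel,
  and the defect of the second-derivative condition is left.\<close>

lemma pd_flux_cov:
  assumes u: "u \<in> U" and v: "\<And>i. v i differentiable (at u)" "\<And>i l. pd l (v i) differentiable (at u)"
  shows "pd j (flux_cov v s l) u - (\<Sum>b\<in>UNIV. \<Gamma> s b j u * flux_cov v b l u)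
    = pd j (pd l (v s)) u - (\<Sum>m\<in>UNIV. \<Gamma> s m j u * pd l (v m) u) - (\<Sum>m\<in>UNIV. \<Gamma> s m l u * pd j (v m) u)"
proof -
  have "pd j (flux_cov v s l) u = pd j (pd l (v s)) u - (\<Sum>i\<in>UNIV. \<Gamma> s i l u * pd j (v i) u)
    - (\<Sum>i\<in>UNIV. (\<Sum>b\<in>UNIV. \<Gamma> s b j u * \<Gamma> b i l u) * v i u)"
    unfolding flux_cov_def[abs_def]
    by (simp add: pd_diff pd_sum pd_mult v differentiable_\<Gamma> u differentiable_sum_family pd_\<Gamma> sum.distrib)
  moreover have "(\<Sum>i\<in>UNIV. (\<Sum>b\<in>UNIV. \<Gamma> s b j u * \<Gamma> b i l u) * v i u) = (\<Sum>b\<in>UNIV. \<Gamma> s b j u * (\<Sum>i\<in>UNIV. \<Gamma> b i l u * v i u))"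
    by (simp add: sum_distrib_left sum_distrib_right mult.assoc) (rule sum.swap)
  ultimately show ?thesis by (simp add: flux_cov_def right_diff_distrib sum_subtractf)
qed

lemma pd_flux_cov_low:
  assumes u: "u \<in> U" and v: "\<And>i. v i differentiable (at u)" "\<And>i l. pd l (v i) differentiable (at u)"
  shows "pd j (flux_cov_low v a l) u + (\<Sum>m\<in>UNIV. \<Gamma> m a j u * flux_cov_low v m l u)
    = - (\<Sum>s\<in>UNIV. G a s u * (pd j (flux_cov v s l) u - (\<Sum>b\<in>UNIV. \<Gamma> s b j u * flux_cov v b l u)))"
proof -
  have "pd j (flux_cov_low v a l) u = (\<Sum>b\<in>UNIV. c_low g c a b j u * flux_cov v b l u) + (\<Sum>b\<in>UNIV. c_low g c b a j u * flux_cov v b l u)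
      - (\<Sum>b\<in>UNIV. G a b u * pd j (flux_cov v b l) u)"
    unfolding flux_cov_low_def[abs_def]
    by (simp add: pd_uminus pd_sum pd_mult differentiable_G u differentiable_flux_cov v differentiable_sum_family pd_G
        sum.distrib sum_subtractf left_diff_distrib sum_negf)
  moreover have "(\<Sum>m\<in>UNIV. \<Gamma> m a j u * flux_cov_low v m l u) = - (\<Sum>b\<in>UNIV. c_low g c b a j u * flux_cov v b l u)"
    using \<Gamma>_flux_low[OF u, of a j "\<lambda>i. flux_cov v i l"] by (simp add: flux_low_def flux_cov_low_def sum_negf)
  moreover have "(\<Sum>b\<in>UNIV. c_low g c a b j u * flux_cov v b l u) = (\<Sum>s\<in>UNIV. G a s u * (\<Sum>b\<in>UNIV. \<Gamma> s b j u * flux_cov v b l u))"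
    by (simp add: c_low_eq sum_distrib_left sum_distrib_right mult.assoc) (rule sum.swap)
  ultimately show ?thesis by (simp add: right_diff_distrib sum_subtractf)
qed

text \<open>The covariant derivative of \<open>flux_cov_low\<close> is, up to sign, the defect of
  the left-hand condition with its index lowered, and \<open>G\<close> is invertible.\<close>

lemma second_derivative_iff_parallel:
  assumes u: "u \<in> U" and v: "\<And>i. v i differentiable (at u)" "\<And>i l. pd l (v i) differentiable (at u)"
  shows "(\<forall>s. pd j (pd l (v s)) u = (\<Sum>m\<in>UNIV. \<Gamma> s m j u * pd l (v m) u) + (\<Sum>m\<in>UNIV. \<Gamma> s m l u * pd j (v m) u)) \<longleftrightarrow>
     (\<forall>a. pd j (flux_cov_low v a l) u = - (\<Sum>m\<in>UNIV. \<Gamma> m a j u * flux_cov_low v m l u))" (is "?L \<longleftrightarrow> ?R")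
proof -
  define X where "X s = pd j (flux_cov v s l) u - (\<Sum>b\<in>UNIV. \<Gamma> s b j u * flux_cov v b l u)" for s
  have L: "?L \<longleftrightarrow> (\<forall>s. X s = 0)"
    unfolding X_def pd_flux_cov[OF assms] by (simp add: algebra_simps)
  have "pd j (flux_cov_low v a l) u = - (\<Sum>m\<in>UNIV. \<Gamma> m a j u * flux_cov_low v m l u) \<longleftrightarrow> (\<Sum>s\<in>UNIV. G a s u * X s) = 0" for a
    using pd_flux_cov_low[where v=v and j=j and a=a and l=l, OF u v] unfolding X_def by linarith
  then have R: "?R \<longleftrightarrow> (\<forall>a. (\<Sum>s\<in>UNIV. G a s u * X s) = 0)" by simp
  have "(\<forall>a. (\<Sum>s\<in>UNIV. G a s u * X s) = 0) \<longleftrightarrow> (\<forall>s. X s = 0)"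
    using lower_cancel[OF u, of X "\<lambda>_. 0"] by auto
  then show ?thesis using L R by blast
qed

lemma cyclic_condition:
  assumes v: "\<And>u i. u \<in> U \<Longrightarrow> v i differentiable (at u)" "\<And>u i l. u \<in> U \<Longrightarrow> pd l (v i) differentiable (at u)"
    and 1: "\<And>u a j. u \<in> U \<Longrightarrow> (\<Sum>m\<in>UNIV. G a m u * pd j (v m) u) = (\<Sum>m\<in>UNIV. G j m u * pd a (v m) u)"
    and 3: "\<And>u j l s. u \<in> U \<Longrightarrow> pd j (pd l (v s)) u = (\<Sum>m\<in>UNIV. \<Gamma> s m j u * pd l (v m) u) + (\<Sum>m\<in>UNIV. \<Gamma> s m l u * pd j (v m) u)"
    and u: "u \<in> U"
  shows "(\<Sum>m\<in>UNIV. c_low g c m l a u * pd j (v m) u + c_low g c m j l u * pd a (v m) u + c_low g c m a j u * pd l (v m) u) = 0"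
proof -
  \<comment> \<open>The metric derivative from \<open>pd_G\<close> and the substituted second
    derivatives share the terms with \<open>c_low g c a m l\<close>, which cancel; two of the four
    sums remain.\<close>
  have d: "pd l (\<lambda>u. \<Sum>m\<in>UNIV. G a m u * pd j (v m) u) u
     = (\<Sum>m\<in>UNIV. c_low g c a m j u * pd l (v m) u) - (\<Sum>m\<in>UNIV. c_low g c m a l u * pd j (v m) u)" for a j
  proof -
    have "(\<Sum>m\<in>UNIV. G a m u * (\<Sum>i\<in>UNIV. \<Gamma> m i l u * pd j (v i) u)) = (\<Sum>i\<in>UNIV. c_low g c a i l u * pd j (v i) u)" for j l
      by (simp add: c_low_eq sum_distrib_left sum_distrib_right mult.assoc) (rule sum.swap)
    then show ?thesis
      by (simp add: pd_sum pd_mult differentiable_G v u pd_G 3[OF u] distrib_left left_diff_distrib sum.distrib sum_subtractf sum_negf)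
  qed
  have "pd l (\<lambda>u. \<Sum>m\<in>UNIV. G a m u * pd j (v m) u) u = pd l (\<lambda>u. \<Sum>m\<in>UNIV. G j m u * pd a (v m) u) u"
    by (rule pd_cong_open[OF open_U u 1])
  then have "(\<Sum>m\<in>UNIV. c_low g c a m j u * pd l (v m) u) - (\<Sum>m\<in>UNIV. c_low g c m a l u * pd j (v m) u)
    - ((\<Sum>m\<in>UNIV. c_low g c j m a u * pd l (v m) u) - (\<Sum>m\<in>UNIV. c_low g c m j l u * pd a (v m) u)) = 0"
    unfolding d by simp
  moreover have "c_low g c a m j u - c_low g c j m a u = c_low g c m a j u" for m
    using c_low_cyclic[OF u, of a m j] c_low_skew[OF u, of j m a] c_low_skew[OF u, of m j a] by simp
  then have "(\<Sum>m\<in>UNIV. c_low g c a m j u * pd l (v m) u) - (\<Sum>m\<in>UNIV. c_low g c j m a u * pd l (v m) u)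
      = (\<Sum>m\<in>UNIV. c_low g c m a j u * pd l (v m) u)"
    by (simp flip: sum_subtractf left_diff_distrib)
  moreover have "(\<Sum>m\<in>UNIV. c_low g c m a l u * pd j (v m) u) = - (\<Sum>m\<in>UNIV. c_low g c m l a u * pd j (v m) u)"
    using c_low_skew[OF u, of _ a l] by (simp add: sum_negf)
  ultimately show ?thesis by (simp add: sum.distrib)
qed

section \<open>Necessity of the conditions\<close>

lemma differentiable_add_const: "f differentiable (at u) \<Longrightarrow> (\<lambda>v. f v + d) differentiable (at u)"
  by (intro differentiable_add) auto

lemma ex_static_jet1:
  assumes "u \<in> U"
  obtains p where "p \<in> jdom 1 U" "jvec 1 p = u" "\<And>k. p (Dep 2 k) = 0"
proof
  let ?p = "case_jvar 0 (\<lambda>s i. if s = 1 then u $ i else (0::real))"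
  show ju: "jvec 1 ?p = u" by (simp add: vec_eq_iff)
  show "?p \<in> jdom 1 U" using assms by (simp add: jdom_def ju del: One_nat_def)
qed auto

lemma hamiltonian_system_imp:
  fixes V :: "real ^ 'n \<Rightarrow> real ^ 'n"
  assumes V: "\<And>i. smooth_on U (\<lambda>u. V u $ i)" and hs: "hamiltonian_system U g c V" and u: "u \<in> U"
  shows "(\<Sum>m\<in>UNIV. G a m u * pd j (\<lambda>u. V u $ m) u) = (\<Sum>m\<in>UNIV. G j m u * pd a (\<lambda>u. V u $ m) u)"
    and "pd j (pd l (\<lambda>u. V u $ s)) u = (\<Sum>m\<in>UNIV. \<Gamma> s m j u * pd l (\<lambda>u. V u $ m) u) + (\<Sum>m\<in>UNIV. \<Gamma> s m l u * pd j (\<lambda>u. V u $ m) u)"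
proof -
  define B :: "'n jet set" where "B = jdom (Suc 0) U"
  interpret B: jet_domain B
    unfolding B_def by unfold_locales (rule open_jdom[OF open_U])
  have BU: "B \<subseteq> jdom (Suc 0) U" by (simp add: B_def)
  obtain h k where h: "diff_fun_on B h"
    and eq: "\<And>p i. p \<in> B \<Longrightarrow> V (jvec 1 p) $ i + k $ i = - first_order_op 1 g c (var_deriv h) i p"
    using hs unfolding hamiltonian_system_def B_def by auto
  define \<psi> where "\<psi> a = var_deriv h a" for a
  have d\<psi>: "diff_fun_on B (\<psi> a)" for a unfolding \<psi>_def by (rule B.diff_fun_var_deriv[OF h])
  \<comment> \<open>The additive constant is absorbed into the flux, which leaves the derivatives
    unchanged.\<close>
  define v where "v i u = V u $ i + k $ i" for i u
  have V_diff: "(\<lambda>u. V u $ i) differentiable (at w)" "pd l (\<lambda>u. V u $ i) differentiable (at w)" if "w \<in> U" for i l w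
    using smooth_on_differentiable[OF open_U V that] smooth_on_differentiable[OF open_U smooth_on_pd[OF V] that] by auto
  have v_diff: "v i differentiable (at w)" if "w \<in> U" for i w
    unfolding v_def[abs_def] by (rule differentiable_add_const[OF V_diff(1)[OF that]])
  have pdv: "pd l (v i) w = pd l (\<lambda>u. V u $ i) w" if "w \<in> U" for l i w
    unfolding v_def[abs_def] using that by (simp add: pd_add V_diff pd_const)
  have v_diff2: "pd l (v i) differentiable (at w)" if "w \<in> U" for i l w
    by (rule differentiable_cong_open[OF open_U that _ V_diff(2)[OF that, of l i]]) (simp add: pdv)
  have dg: "diff_fun_on B (\<lambda>p. g (jvec (Suc 0) p) $ i $ j)" for i j
    by (rule B.diff_fun_jvec[OF open_U smooth_g BU])
  have dc: "diff_fun_on B (\<lambda>p. c i j l (jvec (Suc 0) p))" for i j l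
    by (rule B.diff_fun_jvec[OF open_U smooth_c BU])
  have dV: "diff_fun_on B (\<lambda>p. V (jvec (Suc 0) p) $ i)" for i
    by (rule B.diff_fun_jvec[OF open_U V BU])
  note jg = B.jpd_jvec[OF open_U smooth_g BU] and jc = B.jpd_jvec[OF open_U smooth_c BU] and jV = B.jpd_jvec[OF open_U V BU]
  note intros = B.diff_fun_add B.diff_fun_mult B.diff_fun_diff B.diff_fun_uminus B.diff_fun_sum B.diff_fun_const
    B.diff_fun_coord B.diff_fun_total_deriv B.diff_fun_jpd dg dc dV d\<psi>
  have jU: "jvec (Suc 0) p \<in> U" if "p \<in> B" for p using that by (simp add: B_def jdom_def)
  define R where "R i p = (\<Sum>j\<in>UNIV. g (jvec (Suc 0) p) $ i $ j * total_deriv (\<psi> j) p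
      + (\<Sum>l\<in>UNIV. c i j l (jvec (Suc 0) p) * p (Dep (Suc (Suc 0)) l)) * \<psi> j p)" for i p
  have R: "v i (jvec (Suc 0) p) = - R i p" if "p \<in> B" for i p
    using eq[OF that] by (simp add: first_order_op_def R_def \<psi>_def v_def)
  have jR: "jpd a (R i) p = - jpd a (\<lambda>p. V (jvec (Suc 0) p) $ i) p" if p: "p \<in> B" for a i p
  proof -
    have "jpd a (R i) p = jpd a (\<lambda>p. - V (jvec (Suc 0) p) $ i - k $ i) p"
      by (rule B.jpd_cong[OF _ p], drule R[where i = i]) (simp add: v_def)
    then show ?thesis using p by (simp add: B.jpd_diff B.jpd_uminus intros B.jpd_const)
  qed
  \<comment> \<open>At orders above 2 the right-hand side depends on the top variables only through
    g D \<open>\<psi>\<close>, with leading coefficients g times the derivatives of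
    \<open>\<psi>\<close>, while the flux does not contain them. The descent stops at 2, where b_xx
    also enters explicitly.\<close>
  have dep_step: "\<forall>j. B.dep_below r (\<psi> j)" if r: "2 \<le> r" and IH: "\<forall>j. B.dep_below (Suc r) (\<psi> j)" for r
  proof -
    have top: "jpd (Dep r l) (\<psi> a) p = 0" if p: "p \<in> B" for l a p
    proof -
      have "(\<Sum>j\<in>UNIV. g (jvec (Suc 0) p) $ i $ j * jpd (Dep r l) (\<psi> j) p) = 0" for i
      proof -
        have "jpd (Dep (Suc r) l) (R i) p = (\<Sum>j\<in>UNIV. g (jvec (Suc 0) p) $ i $ j * jpd (Dep r l) (\<psi> j) p)"
          unfolding R_def using p r IH
          by (simp add: B.jpd_sum B.jpd_add B.jpd_mult intros jg jc B.jpd_coord B.jpd_Suc_total_deriv_top B.dep_belowD[of "Suc r"])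
        then show ?thesis using jR[OF p] r p by (simp add: jV)
      qed
      then show ?thesis using raise_cancel[OF jU[OF p], of "\<lambda>j. jpd (Dep r l) (\<psi> j) p" "\<lambda>_. 0" a] by simp
    qed
    show ?thesis unfolding B.dep_below_def
    proof (intro allI impI ballI)
      fix j s i p assume "r \<le> s" "p \<in> B"
      then show "jpd (Dep s i) (\<psi> j) p = 0"
        using top B.dep_belowD[OF IH[rule_format], of s p i j] by (cases "s = r") simp_all
    qed
  qed
  obtain n where "\<forall>j. B.dep_below n (\<psi> j)" using B.ex_dep_below_family[of \<psi>] d\<psi> by blast
  then have "\<forall>j. B.dep_below (max n 2) (\<psi> j)" using B.dep_below_mono[of n _ "max n 2"] by simp
  then have "\<forall>j. B.dep_below 2 (\<psi> j)"
    by (rule inc_induct[where j = "max n 2" and P = "\<lambda>r. \<forall>j. B.dep_below r (\<psi> j)", rotated]) (rule dep_step, simp_all)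
  then have dep2: "B.dep_below (Suc (Suc 0)) (\<psi> j)" for j by (simp add: numeral_2_eq_2)
  have jpd1_up: "(\<Sum>j\<in>UNIV. g (jvec (Suc 0) p) $ i $ j * jpd (Dep (Suc 0) l) (\<psi> j) p) = - (\<Sum>j\<in>UNIV. c i j l (jvec (Suc 0) p) * \<psi> j p)"
    if p: "p \<in> B" for i l p
  proof -
    have "jpd (Dep (Suc (Suc 0)) l) (R i) p = (\<Sum>j\<in>UNIV. g (jvec (Suc 0) p) $ i $ j * jpd (Dep (Suc 0) l) (\<psi> j) p + c i j l (jvec (Suc 0) p) * \<psi> j p)"
      unfolding R_def using p
      by (simp add: B.jpd_sum B.jpd_add B.jpd_mult intros jg jc B.jpd_coord B.jpd_Suc_total_deriv_top[OF d\<psi> dep2]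
         B.dep_belowD[OF dep2] if_distrib[where f="\<lambda>x. _ * x"] cong: if_cong)
    then show ?thesis using jR[OF p] p by (simp add: jV sum.distrib)
  qed
  have c_up: "(\<Sum>j\<in>UNIV. c i j l w * X j) = (\<Sum>a\<in>UNIV. g w $ i $ a * (\<Sum>m\<in>UNIV. \<Gamma> m a l w * X m))" if "w \<in> U" for i l w X
    by (simp add: c_eq[OF that] sum_distrib_left sum_distrib_right mult.assoc) (rule sum.swap)
  have jpd1: "jpd (Dep (Suc 0) l) (\<psi> a) p = - (\<Sum>m\<in>UNIV. \<Gamma> m a l (jvec (Suc 0) p) * \<psi> m p)" if p: "p \<in> B" for a l p
    by (rule raise_cancel[OF jU[OF p]]) (simp add: jpd1_up[OF p] c_up[OF jU[OF p]] sum_negf)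
  \<comment> \<open>Jets with u_x = 0. There the equation reads g D \<open>\<psi>\<close> = - v, and
    D annihilates functions of u. The condition persists when u varies, so derivatives in u can be
    taken within this set.\<close>
  define stat where "stat p \<longleftrightarrow> p \<in> B \<and> (\<forall>k. p (Dep (Suc (Suc 0)) k) = 0)" for p
  have D\<psi>: "total_deriv (\<psi> a) p = - flux_low v a (jvec (Suc 0) p)" if p: "stat p" for a p
  proof (rule raise_cancel[where X = "\<lambda>a. total_deriv (\<psi> a) p" and Y = "\<lambda>a. - flux_low v a (jvec (Suc 0) p)"])
    show "jvec (Suc 0) p \<in> U" using p jU by (simp add: stat_def)
    then show "(\<Sum>j\<in>UNIV. g (jvec (Suc 0) p) $ i $ j * total_deriv (\<psi> j) p) = (\<Sum>j\<in>UNIV. g (jvec (Suc 0) p) $ i $ j * - flux_low v j (jvec (Suc 0) p))" for i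
      using R[of p i] p by (simp add: R_def stat_def flux_low_def raise_lower sum_negf)
  qed
  have Djpd1: "total_deriv (jpd (Dep (Suc 0) l) (\<psi> a)) p = (\<Sum>m\<in>UNIV. \<Gamma> m a l (jvec (Suc 0) p) * flux_low v m (jvec (Suc 0) p))"
    if st: "stat p" for a l p
  proof (rule raise_cancel[where X = "\<lambda>a. total_deriv (jpd (Dep (Suc 0) l) (\<psi> a)) p" and Y = "\<lambda>a. \<Sum>m\<in>UNIV. \<Gamma> m a l (jvec (Suc 0) p) * flux_low v m (jvec (Suc 0) p)"])
    have p: "p \<in> B" and z: "\<And>k. p (Dep (Suc (Suc 0)) k) = 0" using st by (auto simp: stat_def)
    show U: "jvec (Suc 0) p \<in> U" by (rule jU[OF p])
    fix i
    have Dg: "total_deriv (\<lambda>p. g (jvec (Suc 0) p) $ i $ j) p = 0" "total_deriv (\<lambda>p. c i j l (jvec (Suc 0) p)) p = 0" for j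
      using B.total_deriv_jvec[OF open_U smooth_g BU p] B.total_deriv_jvec[OF open_U smooth_c BU p] by (simp_all add: z)
    have "total_deriv (\<lambda>p. \<Sum>j\<in>UNIV. g (jvec (Suc 0) p) $ i $ j * jpd (Dep (Suc 0) l) (\<psi> j) p) p
       = total_deriv (\<lambda>p. - (\<Sum>j\<in>UNIV. c i j l (jvec (Suc 0) p) * \<psi> j p)) p"
      by (rule B.total_deriv_cong[OF jpd1_up p])
    then have "(\<Sum>j\<in>UNIV. g (jvec (Suc 0) p) $ i $ j * total_deriv (jpd (Dep (Suc 0) l) (\<psi> j)) p) =
       - (\<Sum>j\<in>UNIV. c i j l (jvec (Suc 0) p) * total_deriv (\<psi> j) p)"
      using p by (simp add: B.total_deriv_sum B.total_deriv_mult B.total_deriv_uminus intros Dg)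
    then show "(\<Sum>j\<in>UNIV. g (jvec (Suc 0) p) $ i $ j * total_deriv (jpd (Dep (Suc 0) l) (\<psi> j)) p) =
       (\<Sum>j\<in>UNIV. g (jvec (Suc 0) p) $ i $ j * (\<Sum>m\<in>UNIV. \<Gamma> m j l (jvec (Suc 0) p) * flux_low v m (jvec (Suc 0) p)))"
      by (simp add: D\<psi>[OF st] sum_negf c_up[OF U, symmetric])
  qed
  \<comment> \<open>The derivative of the equation in u^l; commuting it with D produces the
    derivative of \<open>\<psi>\<close> in b^l.\<close>
  have jpd0: "jpd (Dep 0 l) (\<psi> a) p = flux_cov_low v a l (jvec (Suc 0) p)" if st: "stat p" for a l p
  proof (rule raise_cancel[where X = "\<lambda>a. jpd (Dep 0 l) (\<psi> a) p" and Y = "\<lambda>a. flux_cov_low v a l (jvec (Suc 0) p)"])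
    have p: "p \<in> B" and z: "\<And>k. p (Dep (Suc (Suc 0)) k) = 0" using st by (auto simp: stat_def)
    let ?u = "jvec (Suc 0) p"
    show U: "?u \<in> U" by (rule jU[OF p])
    fix i
    have "jpd (Dep (Suc 0) l) (R i) p = (\<Sum>j\<in>UNIV. g ?u $ i $ j * (total_deriv (jpd (Dep (Suc 0) l) (\<psi> j)) p + jpd (Dep 0 l) (\<psi> j) p)
        + pd l (\<lambda>u. g u $ i $ j) ?u * total_deriv (\<psi> j) p)"
      unfolding R_def using p
      by (simp add: B.jpd_sum B.jpd_add B.jpd_mult intros jg jc B.jpd_coord B.jpd_total_deriv(3) z)
    then have 1: "pd l (v i) ?u = - (\<Sum>j\<in>UNIV. g ?u $ i $ j * jpd (Dep 0 l) (\<psi> j) p)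
        - (\<Sum>j\<in>UNIV. g ?u $ i $ j * (\<Sum>m\<in>UNIV. \<Gamma> m j l ?u * flux_low v m ?u))
        + (\<Sum>j\<in>UNIV. (c i j l ?u + c j i l ?u) * flux_low v j ?u)"
      using jR[OF p, of "Dep (Suc 0) l" i] p U
      by (simp add: jV pdv Djpd1[OF st] D\<psi>[OF st] pd_g distrib_left sum.distrib sum_subtractf)
    have "(\<Sum>j\<in>UNIV. c j i l ?u * flux_low v j ?u) = (\<Sum>a\<in>UNIV. \<Gamma> i a l ?u * v a ?u)"
    proof -
      have "(\<Sum>j\<in>UNIV. c j i l ?u * flux_low v j ?u) = (\<Sum>j\<in>UNIV. \<Sum>a\<in>UNIV. \<Gamma> i a l ?u * (g ?u $ a $ j * flux_low v j ?u))"
        by (simp add: c_eq[OF U] sum_distrib_left sum_distrib_right g_sym[OF U] mult_ac)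
      also have "\<dots> = (\<Sum>a\<in>UNIV. \<Gamma> i a l ?u * (\<Sum>j\<in>UNIV. g ?u $ a $ j * flux_low v j ?u))"
        by (subst sum.swap) (simp add: sum_distrib_left)
      finally show ?thesis unfolding flux_low_def raise_lower(2)[OF U] .
    qed
    then have "(\<Sum>j\<in>UNIV. g ?u $ i $ j * jpd (Dep 0 l) (\<psi> j) p) = - flux_cov v i l ?u"
      using 1 by (simp add: c_up[OF U, symmetric] distrib_right sum.distrib flux_cov_def)
    also have "\<dots> = (\<Sum>j\<in>UNIV. g ?u $ i $ j * flux_cov_low v j l ?u)"
      by (simp add: flux_cov_low_def sum_negf raise_lower[OF U])
    finally show "(\<Sum>j\<in>UNIV. g ?u $ i $ j * jpd (Dep 0 l) (\<psi> j) p) = (\<Sum>j\<in>UNIV. g ?u $ i $ j * flux_cov_low v j l ?u)" .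
  qed
  obtain p where p: "stat p" "jvec (Suc 0) p = u"
    using ex_static_jet1[OF u] by (auto simp: stat_def B_def numeral_2_eq_2)
  have pB: "p \<in> B" using p by (simp add: stat_def)
  have "flux_cov_low v a j u - (\<Sum>m\<in>UNIV. \<Gamma> m a j u * flux_low v m u) = flux_cov_low v j a u" for a j
    using B.helmholtz[OF h pB, of a j] B.var_deriv_order1[OF dep2 pB, of a j]
    by (simp add: jpd0[OF p(1)] Djpd1[OF p(1)] p(2) flip: \<psi>_def)
  then show "(\<Sum>m\<in>UNIV. G a m u * pd j (\<lambda>u. V u $ m) u) = (\<Sum>m\<in>UNIV. G j m u * pd a (\<lambda>u. V u $ m) u)"
    using symmetric_iff_flux_cov_low[OF u, of a j v] by (simp add: pdv u)
  \<comment> \<open>Mixed derivatives of \<open>\<psi>\<close> in u^j and b^l are computed in both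
    orders: from \<open>jpd0\<close> as a function of u, and from the parallel equation
    differentiated in b.\<close>
  have par: "pd j (flux_cov_low v a l) u = - (\<Sum>m\<in>UNIV. \<Gamma> m a j u * flux_cov_low v m l u)" for a j l
  proof -
    have "jpd (Dep (Suc 0) j) (jpd (Dep 0 l) (\<psi> a)) p = pd j (flux_cov_low v a l) u"
    proof (rule jpd_eqI)
      have "((\<lambda>t. flux_cov_low v a l (u + (t - p (Dep (Suc 0) j)) *\<^sub>R axis j 1)) has_field_derivative pd j (flux_cov_low v a l) u) (at (p (Dep (Suc 0) j)))"
        by (intro DERIV_along_axis differentiable_flux_cov_low u v_diff v_diff2)
      then have D: "((\<lambda>t. flux_cov_low v a l (jvec (Suc 0) (p(Dep (Suc 0) j := t)))) has_field_derivative pd j (flux_cov_low v a l) u) (at (p (Dep (Suc 0) j)))"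
        by (simp add: line_jvec p(2))
      have ev: "\<forall>\<^sub>F t in nhds (p (Dep (Suc 0) j)). jpd (Dep 0 l) (\<psi> a) (p(Dep (Suc 0) j := t)) = flux_cov_low v a l (jvec (Suc 0) (p(Dep (Suc 0) j := t)))"
        using B.eventually_line[OF pB] by eventually_elim (rule jpd0, use p(1) in \<open>auto simp: stat_def\<close>)
      show "((\<lambda>t. jpd (Dep 0 l) (\<psi> a) (p(Dep (Suc 0) j := t))) has_field_derivative pd j (flux_cov_low v a l) u) (at (p (Dep (Suc 0) j)))"
        using DERIV_cong_ev[OF refl ev refl] D by blast
    qed
    moreover have "jpd (Dep 0 l) (jpd (Dep (Suc 0) j) (\<psi> a)) p = - (\<Sum>m\<in>UNIV. \<Gamma> m a j u * flux_cov_low v m l u)"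
    proof (rule raise_cancel[where X = "\<lambda>a. jpd (Dep 0 l) (jpd (Dep (Suc 0) j) (\<psi> a)) p" and Y = "\<lambda>a. - (\<Sum>m\<in>UNIV. \<Gamma> m a j u * flux_cov_low v m l u)", OF u])
      fix i
      have "jpd (Dep 0 l) (\<lambda>p. \<Sum>m\<in>UNIV. g (jvec (Suc 0) p) $ i $ m * jpd (Dep (Suc 0) j) (\<psi> m) p) p
         = jpd (Dep 0 l) (\<lambda>p. - (\<Sum>m\<in>UNIV. c i m j (jvec (Suc 0) p) * \<psi> m p)) p"
        by (rule B.jpd_cong[OF jpd1_up pB])
      then have "(\<Sum>m\<in>UNIV. g u $ i $ m * jpd (Dep 0 l) (jpd (Dep (Suc 0) j) (\<psi> m)) p) = - (\<Sum>m\<in>UNIV. c i m j u * flux_cov_low v m l u)"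
        using pB by (simp add: B.jpd_sum B.jpd_mult B.jpd_uminus intros jg jc jpd0[OF p(1)] p(2))
      then show "(\<Sum>a\<in>UNIV. g u $ i $ a * jpd (Dep 0 l) (jpd (Dep (Suc 0) j) (\<psi> a)) p)
        = (\<Sum>a\<in>UNIV. g u $ i $ a * - (\<Sum>m\<in>UNIV. \<Gamma> m a j u * flux_cov_low v m l u))"
        by (simp add: c_up[OF u] sum_negf)
    qed
    ultimately show ?thesis using B.jpd_commute[OF d\<psi> pB] by simp
  qed
  have "pd j (pd l (v s)) u = (\<Sum>m\<in>UNIV. \<Gamma> s m j u * pd l (v m) u) + (\<Sum>m\<in>UNIV. \<Gamma> s m l u * pd j (v m) u)"
    using second_derivative_iff_parallel[OF u, of v j l] v_diff[OF u] v_diff2[OF u] par by blast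
  moreover have "pd j (pd l (v s)) u = pd j (pd l (\<lambda>u. V u $ s)) u"
    by (rule pd_cong_open[OF open_U u pdv])
  ultimately show "pd j (pd l (\<lambda>u. V u $ s)) u = (\<Sum>m\<in>UNIV. \<Gamma> s m j u * pd l (\<lambda>u. V u $ m) u) + (\<Sum>m\<in>UNIV. \<Gamma> s m l u * pd j (\<lambda>u. V u $ m) u)"
    by (simp add: pdv u)
qed

end

section \<open>Sufficiency of the conditions\<close>

lemma pd_zero_imp_constant:
  fixes f :: "real ^ 'n::finite \<Rightarrow> real"
  assumes "open U" "connected U"
    and f: "\<And>u. u \<in> U \<Longrightarrow> f differentiable (at u)" and 0: "\<And>u i. u \<in> U \<Longrightarrow> pd i f u = 0"
  shows "\<exists>d. \<forall>u\<in>U. f u = d"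
proof -
  have D: "(f has_derivative (\<lambda>h. 0)) (at u)" if u: "u \<in> U" for u
  proof -
    have lin: "linear (frechet_derivative f (at u))" by (rule linear_frechet_derivative[OF f[OF u]])
    have "frechet_derivative f (at u) h = 0" for h
    proof -
      have "frechet_derivative f (at u) h = frechet_derivative f (at u) (\<Sum>i\<in>UNIV. h $ i *\<^sub>R axis i 1)"
        using basis_expansion[of h] by (simp add: scalar_mult_eq_scaleR)
      also have "\<dots> = (\<Sum>i\<in>UNIV. h $ i *\<^sub>R frechet_derivative f (at u) (axis i 1))"
        by (simp add: linear_sum[OF lin] linear_scale[OF lin])
      finally show ?thesis using 0[OF u] by (simp add: pd_def)
    qed
    then have "frechet_derivative f (at u) = (\<lambda>h. 0)" by (rule ext)
    then show ?thesis using has_derivative_frechet[OF f[OF u]] by simp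
  qed
  have "continuous_on U f"
    using has_derivative_continuous[OF D] by (simp add: continuous_on_eq_continuous_at[OF assms(1)])
  then have "f constant_on U"
    using has_derivative_zero_connected_constant_on[OF assms(2,1), of "{}" f] has_derivative_at_withinI[OF D] by simp
  then show ?thesis by (simp add: constant_on_def)
qed

lemma affine_if_constant_partials:
  fixes f :: "real ^ 'n::finite \<Rightarrow> real"
  assumes "open U" "connected U"
    and f: "\<And>u. u \<in> U \<Longrightarrow> f differentiable (at u)" and c: "\<And>u i. u \<in> U \<Longrightarrow> pd i f u = r i"
  shows "\<exists>d. \<forall>u\<in>U. f u = (\<Sum>i\<in>UNIV. r i * u $ i) + d"
proof -
  have "\<exists>d. \<forall>u\<in>U. f u - (\<Sum>i\<in>UNIV. r i * u $ i) = d"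
  proof (rule pd_zero_imp_constant[OF assms(1,2)])
    have d: "(\<lambda>u. \<Sum>i\<in>UNIV. r i * u $ i) differentiable (at u)" for u :: "real ^ 'n"
      by (intro differentiable_sum_family differentiable_mult differentiable_component) auto
    then show "(\<lambda>u. f u - (\<Sum>i\<in>UNIV. r i * u $ i)) differentiable (at u)" if "u \<in> U" for u
      using f[OF that] by (intro differentiable_diff)
    show "pd i (\<lambda>u. f u - (\<Sum>i\<in>UNIV. r i * u $ i)) u = 0" if "u \<in> U" for u i
      using f[OF that] d c[OF that]
      by (simp add: pd_diff pd_sum pd_mult pd_const pd_component differentiable_component differentiable_mult
         if_distrib[where f="\<lambda>x. _ * x"] cong: if_cong)
  qed
  then show ?thesis by (auto simp: algebra_simps)
qed

context third_order_hamiltonian begin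

text \<open>By flatness and skewness of the connection the second derivatives of a parallel covector vanish.\<close>

lemma parallel_affine:
  assumes conn: "connected U"
    and X: "\<And>a u. u \<in> U \<Longrightarrow> X a differentiable (at u)"
    and par: "\<And>a j u. u \<in> U \<Longrightarrow> pd j (X a) u = - (\<Sum>m\<in>UNIV. \<Gamma> m a j u * X m u)"
  shows "\<exists>R S. \<forall>a. \<forall>u\<in>U. X a u = (\<Sum>l\<in>UNIV. R a l * u $ l) + S a \<and> (\<forall>l. pd l (X a) u = R a l)"
proof -
  have "\<exists>d. \<forall>u\<in>U. pd l (X a) u = d" for a l
  proof (rule pd_zero_imp_constant[OF open_U conn])
    fix u assume u: "u \<in> U"
    have d: "(\<lambda>u. - (\<Sum>m\<in>UNIV. \<Gamma> m a l u * X m u)) differentiable (at u)"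
      by (intro differentiable_minus differentiable_sum_family differentiable_mult differentiable_\<Gamma> X u)
    then show "pd l (X a) differentiable (at u)"
      by (rule differentiable_cong_open[OF open_U u, rotated]) (simp add: par)
    fix k
    have "pd k (pd l (X a)) u = pd k (\<lambda>u. - (\<Sum>m\<in>UNIV. \<Gamma> m a l u * X m u)) u"
      by (rule pd_cong_open[OF open_U u]) (rule par)
    also have "\<dots> = (\<Sum>m\<in>UNIV. \<Gamma> m a l u * (\<Sum>b\<in>UNIV. \<Gamma> b m k u * X b u)) - (\<Sum>m\<in>UNIV. (\<Sum>b\<in>UNIV. \<Gamma> m b k u * \<Gamma> b a l u) * X m u)"
      by (simp add: pd_uminus pd_sum pd_mult differentiable_\<Gamma> X u differentiable_sum_family pd_\<Gamma> par sum.distrib sum_subtractf)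
    also have "(\<Sum>m\<in>UNIV. (\<Sum>b\<in>UNIV. \<Gamma> m b k u * \<Gamma> b a l u) * X m u) = (\<Sum>m\<in>UNIV. \<Gamma> m a l u * (\<Sum>b\<in>UNIV. \<Gamma> b m k u * X b u))"
      by (simp add: sum_distrib_left sum_distrib_right) (subst sum.swap, simp add: mult_ac)
    finally show "pd k (pd l (X a)) u = 0" by simp
  qed
  then have "\<forall>a l. \<exists>d. \<forall>u\<in>U. pd l (X a) u = d" by blast
  then obtain R where R: "\<And>a l u. u \<in> U \<Longrightarrow> pd l (X a) u = R a l" by metis
  have "\<exists>d. \<forall>u\<in>U. X a u = (\<Sum>l\<in>UNIV. R a l * u $ l) + d" for a
    by (rule affine_if_constant_partials[OF open_U conn X R])
  then have "\<forall>a. \<exists>d. \<forall>u\<in>U. X a u = (\<Sum>l\<in>UNIV. R a l * u $ l) + d" by blast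
  then obtain S where "\<And>a u. u \<in> U \<Longrightarrow> X a u = (\<Sum>l\<in>UNIV. R a l * u $ l) + S a" by metis
  then show ?thesis using R by blast
qed

end

text \<open>A solution of the Helmholtz conditions that is affine in \<open>b\<^sub>x\<close> and linear in \<open>(b, x)\<close>; the density
  comes from the homotopy formula \<open>\<integral> b\<^sup>a E\<^sub>a(x, t b, t b\<^sub>x) dt\<close> over \<open>[0, 1]\<close>.\<close>

definition affine_density ::
    "('n::finite \<Rightarrow> 'n \<Rightarrow> 'n \<Rightarrow> real) \<Rightarrow> ('n \<Rightarrow> 'n \<Rightarrow> real) \<Rightarrow> ('n \<Rightarrow> 'n \<Rightarrow> real) \<Rightarrow> ('n \<Rightarrow> real) \<Rightarrow> 'n jet \<Rightarrow> real" where
  "affine_density P Q R S p =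
     (\<Sum>a\<in>UNIV. \<Sum>m\<in>UNIV. \<Sum>l\<in>UNIV. P a m l / 3 * (p (Dep 0 a) * (p (Dep 0 m) * p (Dep (Suc 0) l))))
   + (\<Sum>a\<in>UNIV. \<Sum>m\<in>UNIV. Q a m / 2 * (p (Dep 0 a) * p (Dep 0 m)))
   + p Indep * ((\<Sum>a\<in>UNIV. \<Sum>l\<in>UNIV. R a l / 2 * (p (Dep 0 a) * p (Dep (Suc 0) l))) + (\<Sum>a\<in>UNIV. S a * p (Dep 0 a)))"

context jet_domain begin

lemma diff_fun_affine_density: "diff_fun_on A (affine_density P Q R S)"
  unfolding affine_density_def[abs_def]
  by (intro diff_fun_add diff_fun_sum diff_fun_mult diff_fun_const diff_fun_coord)

text \<open>The assumptions are the Helmholtz conditions of the covector on the right, separated by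
  monomials in x, b and b_x.\<close>

lemma var_deriv_affine_density:
  assumes P: "\<And>a m l. P a m l = - P l m a" "\<And>a j l. P a j l - P a l j = P j a l"
    and R: "\<And>a l. R a l = - R l a" "\<And>a j. Q a j - R a j = Q j a"
    and p: "p \<in> A"
  shows "var_deriv (affine_density P Q R S) a p = (\<Sum>m\<in>UNIV. ((\<Sum>l\<in>UNIV. P a m l * p (Dep (Suc 0) l)) + Q a m) * p (Dep 0 m))
     + p Indep * ((\<Sum>l\<in>UNIV. R a l * p (Dep (Suc 0) l)) + S a)"
proof -
  note intros = diff_fun_add diff_fun_sum diff_fun_mult diff_fun_const diff_fun_coord
  note ifd = if_distrib[where f="\<lambda>x. x * _"] if_distrib[where f="\<lambda>x. _ * x"]
  have ifs: "(\<Sum>l\<in>(UNIV::'n set). if b then F l else 0) = (if b then (\<Sum>l\<in>UNIV. F l) else 0)" for b and F :: "'n \<Rightarrow> real"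
    by simp
  have j0: "jpd (Dep 0 a) (affine_density P Q R S) p =
     (\<Sum>m\<in>UNIV. \<Sum>l\<in>UNIV. P a m l / 3 * (p (Dep 0 m) * p (Dep (Suc 0) l)))
     + (\<Sum>m\<in>UNIV. \<Sum>l\<in>UNIV. P m a l / 3 * (p (Dep 0 m) * p (Dep (Suc 0) l)))
     + (\<Sum>m\<in>UNIV. Q a m / 2 * p (Dep 0 m)) + (\<Sum>m\<in>UNIV. Q m a / 2 * p (Dep 0 m))
     + p Indep * ((\<Sum>l\<in>UNIV. R a l / 2 * p (Dep (Suc 0) l)) + S a)"
    unfolding affine_density_def[abs_def] using p
    by (simp add: jpd_add jpd_sum jpd_mult jpd_const jpd_coord intros del: times_divide_eq_left times_divide_eq_right)
      (simp add: distrib_left sum.distrib ifd ifs cong: if_cong del: times_divide_eq_left times_divide_eq_right)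
  have j1: "jpd (Dep (Suc 0) a) (affine_density P Q R S) q =
     (\<Sum>m\<in>UNIV. \<Sum>l\<in>UNIV. P m l a / 3 * (q (Dep 0 m) * q (Dep 0 l)))
     + q Indep * (\<Sum>m\<in>UNIV. R m a / 2 * q (Dep 0 m))" if "q \<in> A" for q
    unfolding affine_density_def[abs_def] using that
    by (simp add: jpd_add jpd_sum jpd_mult jpd_const jpd_coord intros del: times_divide_eq_left times_divide_eq_right)
      (simp add: distrib_left sum.distrib ifd ifs cong: if_cong del: times_divide_eq_left times_divide_eq_right)
  have "dep_below (Suc (Suc 0)) (affine_density P Q R S)"
    unfolding dep_below_def affine_density_def[abs_def]
    by (auto simp add: jpd_add jpd_sum jpd_mult jpd_const jpd_coord intros simp del: times_divide_eq_left times_divide_eq_right)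
  from var_deriv_order1[OF this p]
  have "var_deriv (affine_density P Q R S) a p = jpd (Dep 0 a) (affine_density P Q R S) p
      - total_deriv (\<lambda>q. (\<Sum>m\<in>UNIV. \<Sum>l\<in>UNIV. P m l a / 3 * (q (Dep 0 m) * q (Dep 0 l)))
         + q Indep * (\<Sum>m\<in>UNIV. R m a / 2 * q (Dep 0 m))) p"
    using total_deriv_cong[OF j1 p] by simp
  also have "total_deriv (\<lambda>q. (\<Sum>m\<in>UNIV. \<Sum>l\<in>UNIV. P m l a / 3 * (q (Dep 0 m) * q (Dep 0 l)))
         + q Indep * (\<Sum>m\<in>UNIV. R m a / 2 * q (Dep 0 m))) p
     = (\<Sum>m\<in>UNIV. \<Sum>l\<in>UNIV. P m l a / 3 * (p (Dep 0 m) * p (Dep (Suc 0) l)))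
      + (\<Sum>m\<in>UNIV. \<Sum>l\<in>UNIV. P m l a / 3 * (p (Dep (Suc 0) m) * p (Dep 0 l)))
      + p Indep * (\<Sum>m\<in>UNIV. R m a / 2 * p (Dep (Suc 0) m)) + (\<Sum>m\<in>UNIV. R m a / 2 * p (Dep 0 m))"
    using p by (simp add: total_deriv_add total_deriv_sum total_deriv_mult total_deriv_const total_deriv_coord intros
       del: times_divide_eq_left times_divide_eq_right) (simp add: distrib_left sum.distrib)
  also have "(\<Sum>m\<in>UNIV. \<Sum>l\<in>UNIV. P m l a / 3 * (p (Dep (Suc 0) m) * p (Dep 0 l)))
     = (\<Sum>m\<in>UNIV. \<Sum>l\<in>UNIV. P l m a / 3 * (p (Dep 0 m) * p (Dep (Suc 0) l)))"
    by (subst sum.swap) (simp add: mult_ac)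
  finally have "var_deriv (affine_density P Q R S) a p =
      (\<Sum>m\<in>UNIV. \<Sum>l\<in>UNIV. (P a m l + P m a l - P m l a - P l m a) / 3 * (p (Dep 0 m) * p (Dep (Suc 0) l)))
    + (\<Sum>m\<in>UNIV. (Q a m + Q m a - R m a) / 2 * p (Dep 0 m))
    + p Indep * ((\<Sum>l\<in>UNIV. (R a l - R l a) / 2 * p (Dep (Suc 0) l)) + S a)"
    unfolding j0 by (simp add: sum.distrib sum_subtractf diff_divide_distrib add_divide_distrib left_diff_distrib distrib_right right_diff_distrib distrib_left)
  \<comment> \<open>By \<open>P(2)\<close> the two middle terms add up to \<open>P a m l\<close>,
    and by \<open>P(1)\<close> so does the last one with its sign: three copies in all.\<close>
  moreover have "(P a m l + P m a l - P m l a - P l m a) / 3 = P a m l" for m l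
    using P(1)[of l m a] P(2)[of m a l] by simp
  moreover have "(Q a m + Q m a - R m a) / 2 = Q a m" for m using R(2)[of a m] R(1)[of a m] by simp
  moreover have "(R a l - R l a) / 2 = R a l" for l using R(1)[of a l] by simp
  ultimately have "var_deriv (affine_density P Q R S) a p =
      (\<Sum>m\<in>UNIV. \<Sum>l\<in>UNIV. P a m l * (p (Dep 0 m) * p (Dep (Suc 0) l))) + (\<Sum>m\<in>UNIV. Q a m * p (Dep 0 m))
      + p Indep * ((\<Sum>l\<in>UNIV. R a l * p (Dep (Suc 0) l)) + S a)"
    by (simp only:)
  then show ?thesis
    by (simp add: distrib_left sum.distrib sum_distrib_left mult_ac)
qed

end

context third_order_hamiltonian begin

lemma hamiltonian_systemI:
  fixes V :: "real ^ 'n \<Rightarrow> real ^ 'n"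
  assumes conn: "connected U" and V: "\<And>i. smooth_on U (\<lambda>u. V u $ i)"
    and 1: "\<And>u a j. u \<in> U \<Longrightarrow> (\<Sum>m\<in>UNIV. G a m u * pd j (\<lambda>u. V u $ m) u) = (\<Sum>m\<in>UNIV. G j m u * pd a (\<lambda>u. V u $ m) u)"
    and 3: "\<And>u j l s. u \<in> U \<Longrightarrow> pd j (pd l (\<lambda>u. V u $ s)) u = (\<Sum>m\<in>UNIV. \<Gamma> s m j u * pd l (\<lambda>u. V u $ m) u) + (\<Sum>m\<in>UNIV. \<Gamma> s m l u * pd j (\<lambda>u. V u $ m) u)"
  shows "hamiltonian_system U g c V"
proof -
  define B :: "'n jet set" where "B = jdom (Suc 0) U"
  interpret B: jet_domain B
    unfolding B_def by unfold_locales (rule open_jdom[OF open_U])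
  define v where "v i u = V u $ i" for i u
  have v_eq: "v i = (\<lambda>u. V u $ i)" for i by (simp add: v_def fun_eq_iff)
  have v: "v i differentiable (at w)" "pd l (v i) differentiable (at w)" if "w \<in> U" for i l w
    unfolding v_eq using smooth_on_differentiable[OF open_U V that] smooth_on_differentiable[OF open_U smooth_on_pd[OF V] that] by auto
  define M where "M = flux_cov_low v"
  define W where "W = flux_low v"
  \<comment> \<open>The covector is sought as M b + x N. For u_x = 0 its total derivative is M u +
    N, which has to equal - W.\<close>
  define N where "N a u = - W a u - (\<Sum>k\<in>UNIV. M a k u * u $ k)" for a u
  have M_diff: "M a l differentiable (at u)" if "u \<in> U" for a l u
    unfolding M_def by (intro differentiable_flux_cov_low that v)
  have W_diff: "W a differentiable (at u)" if "u \<in> U" for a u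
    unfolding W_def flux_low_def[abs_def] by (intro differentiable_sum_family differentiable_mult differentiable_G that v)
  have N_diff: "N a differentiable (at u)" if "u \<in> U" for a u
    unfolding N_def[abs_def]
    by (intro differentiable_diff differentiable_minus differentiable_sum_family differentiable_mult M_diff W_diff that differentiable_component)
  have M_par: "pd j (M a l) u = - (\<Sum>m\<in>UNIV. \<Gamma> m a j u * M m l u)" if u: "u \<in> U" for a l j u
    using second_derivative_iff_parallel[OF u, of v j l] v[OF u] 3[OF u] by (simp add: M_def v_eq)
  have W_par: "pd l (W a) u = - M a l u - (\<Sum>m\<in>UNIV. \<Gamma> m a l u * W m u)" if u: "u \<in> U" for a l u
    unfolding W_def M_def by (rule flux_low_parallel[OF u v(1)[OF u]])
  have N_par: "pd j (N a) u = - (\<Sum>m\<in>UNIV. \<Gamma> m a j u * N m u)" if u: "u \<in> U" for a j u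
  proof -
    have "pd j (N a) u = - pd j (W a) u - (\<Sum>k\<in>UNIV. pd j (M a k) u * u $ k) - M a j u"
      unfolding N_def[abs_def] using u
      by (simp add: pd_diff pd_uminus pd_sum pd_mult M_diff W_diff differentiable_component differentiable_sum_family
        pd_component sum.distrib if_distrib[where f="\<lambda>x. _ * x"] cong: if_cong)
    also have "\<dots> = (\<Sum>m\<in>UNIV. \<Gamma> m a j u * W m u) + (\<Sum>k\<in>UNIV. (\<Sum>m\<in>UNIV. \<Gamma> m a j u * M m k u) * u $ k)"
      by (simp add: W_par M_par u sum_negf)
    also have "(\<Sum>k\<in>UNIV. (\<Sum>m\<in>UNIV. \<Gamma> m a j u * M m k u) * u $ k) = (\<Sum>m\<in>UNIV. \<Gamma> m a j u * (\<Sum>k\<in>UNIV. M m k u * u $ k))"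
      by (simp add: sum_distrib_left sum_distrib_right mult.assoc) (rule sum.swap)
    finally have "pd j (N a) u = (\<Sum>m\<in>UNIV. \<Gamma> m a j u * W m u) + (\<Sum>m\<in>UNIV. \<Gamma> m a j u * (\<Sum>k\<in>UNIV. M m k u * u $ k))" .
    moreover have "(\<Sum>m\<in>UNIV. \<Gamma> m a j u * N m u) = - (\<Sum>m\<in>UNIV. \<Gamma> m a j u * W m u) - (\<Sum>m\<in>UNIV. \<Gamma> m a j u * (\<Sum>k\<in>UNIV. M m k u * u $ k))"
      by (simp add: N_def right_diff_distrib sum_subtractf sum_negf)
    ultimately show ?thesis by simp
  qed
  have "\<forall>m. \<exists>P Q. \<forall>a. \<forall>u\<in>U. M a m u = (\<Sum>l\<in>UNIV. P a l * u $ l) + Q a \<and> (\<forall>l. pd l (M a m) u = P a l)"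
    by (intro allI parallel_affine[OF conn M_diff M_par])
  then obtain P' Q' where PQ': "\<And>m a u. u \<in> U \<Longrightarrow> M a m u = (\<Sum>l\<in>UNIV. P' m a l * u $ l) + Q' m a \<and> (\<forall>l. pd l (M a m) u = P' m a l)"
    by metis
  define P where "P a m l = P' m a l" for a m l
  define Q where "Q a m = Q' m a" for a m
  have M: "M a m u = (\<Sum>l\<in>UNIV. P a m l * u $ l) + Q a m" and MP: "pd l (M a m) u = P a m l" if "u \<in> U" for a m l u
    using PQ'[OF that] by (simp_all add: P_def Q_def)
  have "\<exists>R S. \<forall>a. \<forall>u\<in>U. N a u = (\<Sum>l\<in>UNIV. R a l * u $ l) + S a \<and> (\<forall>l. pd l (N a) u = R a l)"
    by (rule parallel_affine[OF conn N_diff N_par])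
  then obtain R S where N: "\<And>a u. u \<in> U \<Longrightarrow> N a u = (\<Sum>l\<in>UNIV. R a l * u $ l) + S a"
    and NR: "\<And>a l u. u \<in> U \<Longrightarrow> pd l (N a) u = R a l" by metis
  have P_\<Gamma>: "P a m l = - (\<Sum>k\<in>UNIV. \<Gamma> k a l u * M k m u)" and R_\<Gamma>: "R a l = - (\<Sum>k\<in>UNIV. \<Gamma> k a l u * N k u)" if "u \<in> U" for a m l u
    using MP[OF that] NR[OF that] M_par[OF that] N_par[OF that] by simp_all
  show ?thesis
  proof (cases "U = {}")
    case True
    \<comment> \<open>Without a point of \<open>U\<close> the coefficients satisfy no relations, so
      the zero density is chosen.\<close>
    show ?thesis unfolding hamiltonian_system_def
    proof (intro exI conjI)
      show "diff_fun_on (jdom 1 U) (\<lambda>_. 0)" using B.diff_fun_const[of 0] by (simp add: B_def)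
    qed (simp add: jdom_def True)
  next
    case False
    then obtain u0 where u0: "u0 \<in> U" by blast
    have P1: "P a m l = - P l m a" and R1: "R a l = - R l a" for a m l
      using P_\<Gamma>[OF u0, of a m l] P_\<Gamma>[OF u0, of l m a] R_\<Gamma>[OF u0, of a l] R_\<Gamma>[OF u0, of l a] \<Gamma>_skew[OF u0, of _ a l]
      by (simp_all add: sum_negf)
    \<comment> \<open>The symmetry condition, written as an affine function of u that vanishes on
      \<open>U\<close>. Its slope and its constant term are the two remaining Helmholtz conditions
      \<open>P2\<close> and \<open>R2\<close>.\<close>
    have key: "(\<Sum>l\<in>UNIV. (P a j l - P a l j - P j a l) * u $ l) + (Q a j - R a j - Q j a) = 0" if u: "u \<in> U" for a j u
    proof -
      have "M a j u - (\<Sum>m\<in>UNIV. \<Gamma> m a j u * W m u) = M j a u"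
        using symmetric_iff_flux_cov_low[OF u, of a j v] 1[OF u, of a j] by (simp add: v_eq M_def W_def)
      moreover have "(\<Sum>m\<in>UNIV. \<Gamma> m a j u * W m u) = R a j + (\<Sum>k\<in>UNIV. P a k j * u $ k)"
      proof -
        have "(\<Sum>m\<in>UNIV. \<Gamma> m a j u * W m u) = (\<Sum>m\<in>UNIV. \<Gamma> m a j u * (- N m u - (\<Sum>k\<in>UNIV. M m k u * u $ k)))"
          by (simp add: N_def)
        also have "\<dots> = R a j - (\<Sum>m\<in>UNIV. \<Sum>k\<in>UNIV. \<Gamma> m a j u * M m k u * u $ k)"
          by (simp add: R_\<Gamma>[OF u] right_diff_distrib sum_subtractf sum_distrib_left sum_negf mult.assoc)
        also have "(\<Sum>m\<in>UNIV. \<Sum>k\<in>UNIV. \<Gamma> m a j u * M m k u * u $ k) = - (\<Sum>k\<in>UNIV. P a k j * u $ k)"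
          by (subst sum.swap) (simp add: P_\<Gamma>[OF u] sum_distrib_right sum_negf)
        finally show ?thesis by simp
      qed
      ultimately show ?thesis by (simp add: M[OF u] left_diff_distrib sum_subtractf)
    qed
    have P2: "P a j l - P a l j = P j a l" for a j l
    proof -
      have "pd l (\<lambda>u. (\<Sum>l\<in>UNIV. (P a j l - P a l j - P j a l) * u $ l) + (Q a j - R a j - Q j a)) u0 = pd l (\<lambda>u. 0) u0"
        by (rule pd_cong_open[OF open_U u0 key])
      then show ?thesis
        by (simp add: pd_add pd_sum pd_mult pd_const pd_component differentiable_component differentiable_sum_family differentiable_mult
           if_distrib[where f="\<lambda>x. _ * x"] cong: if_cong)
    qed
    have R2: "Q a j - R a j = Q j a" for a j using key[OF u0, of a j] by (simp add: P2)
    define E where "E a p = (\<Sum>m\<in>UNIV. ((\<Sum>l\<in>UNIV. P a m l * p (Dep (Suc 0) l)) + Q a m) * p (Dep 0 m))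
     + p Indep * ((\<Sum>l\<in>UNIV. R a l * p (Dep (Suc 0) l)) + S a)" for a p
    have vd: "var_deriv (affine_density P Q R S) a p = E a p" if "p \<in> B" for a p
      unfolding E_def by (rule B.var_deriv_affine_density[OF P1 P2 R1 R2 that])
    have "V (jvec 1 p) $ i + 0 $ i = - first_order_op 1 g c (var_deriv (affine_density P Q R S)) i p" if p: "p \<in> B" for p i
    proof -
      let ?u = "jvec (Suc 0) p"
      have U: "?u \<in> U" using p by (simp add: B_def jdom_def)
      have E': "E a p = (\<Sum>m\<in>UNIV. M a m ?u * p (Dep 0 m)) + p Indep * N a ?u" for a
        by (simp add: E_def M[OF U] N[OF U])
      \<comment> \<open>The sum over \<open>l\<close> is the parallel transport of \<open>E\<close>;
        it cancels the term with \<open>c\<close> in the first-order operator and leaves - g W,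
        which is minus the flux.\<close>
      have DE: "total_deriv (var_deriv (affine_density P Q R S) a) p = - W a ?u - (\<Sum>l\<in>UNIV. p (Dep (Suc (Suc 0)) l) * (\<Sum>k\<in>UNIV. \<Gamma> k a l ?u * E k p))" for a
      proof -
        have "total_deriv (var_deriv (affine_density P Q R S) a) p = total_deriv (E a) p"
          by (rule B.total_deriv_cong[OF vd p])
        also have "\<dots> = (\<Sum>m\<in>UNIV. M a m ?u * p (Dep (Suc 0) m)) + (\<Sum>m\<in>UNIV. (\<Sum>l\<in>UNIV. P a m l * p (Dep (Suc (Suc 0)) l)) * p (Dep 0 m))
            + (p Indep * (\<Sum>l\<in>UNIV. R a l * p (Dep (Suc (Suc 0)) l)) + N a ?u)"
          unfolding E_def[abs_def] using p
          by (simp add: B.total_deriv_add B.total_deriv_sum B.total_deriv_mult B.total_deriv_const B.total_deriv_coord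
            B.diff_fun_add B.diff_fun_sum B.diff_fun_mult B.diff_fun_const B.diff_fun_coord M[OF U] N[OF U] sum.distrib)
        also have "(\<Sum>m\<in>UNIV. (\<Sum>l\<in>UNIV. P a m l * p (Dep (Suc (Suc 0)) l)) * p (Dep 0 m))
            = - (\<Sum>l\<in>UNIV. p (Dep (Suc (Suc 0)) l) * (\<Sum>k\<in>UNIV. \<Gamma> k a l ?u * (\<Sum>m\<in>UNIV. M k m ?u * p (Dep 0 m))))"
        proof -
          have "(\<Sum>m\<in>UNIV. (\<Sum>l\<in>UNIV. P a m l * p (Dep (Suc (Suc 0)) l)) * p (Dep 0 m))
             = (\<Sum>l\<in>UNIV. p (Dep (Suc (Suc 0)) l) * (\<Sum>m\<in>UNIV. P a m l * p (Dep 0 m)))"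
            by (simp add: sum_distrib_left sum_distrib_right mult_ac) (rule sum.swap)
          moreover have "(\<Sum>m\<in>UNIV. P a m l * p (Dep 0 m)) = - (\<Sum>k\<in>UNIV. \<Gamma> k a l ?u * (\<Sum>m\<in>UNIV. M k m ?u * p (Dep 0 m)))" for l
            by (simp add: P_\<Gamma>[OF U] sum_distrib_left sum_distrib_right sum_negf mult.assoc) (rule sum.swap)
          ultimately show ?thesis by (simp add: sum_negf)
        qed
        also have "p Indep * (\<Sum>l\<in>UNIV. R a l * p (Dep (Suc (Suc 0)) l)) = - (\<Sum>l\<in>UNIV. p (Dep (Suc (Suc 0)) l) * (\<Sum>k\<in>UNIV. \<Gamma> k a l ?u * (p Indep * N k ?u)))"
          by (simp add: R_\<Gamma>[OF U] sum_distrib_left sum_distrib_right sum_negf mult_ac)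
        finally show ?thesis
          by (simp add: E' N_def[of a] distrib_left sum.distrib)
      qed
      have "first_order_op 1 g c (var_deriv (affine_density P Q R S)) i p
        = (\<Sum>j\<in>UNIV. g ?u $ i $ j * total_deriv (var_deriv (affine_density P Q R S) j) p) + (\<Sum>j\<in>UNIV. (\<Sum>l\<in>UNIV. c i j l ?u * p (Dep (Suc (Suc 0)) l)) * E j p)"
        by (simp add: first_order_op_def vd[OF p] sum.distrib)
      also have "(\<Sum>j\<in>UNIV. (\<Sum>l\<in>UNIV. c i j l ?u * p (Dep (Suc (Suc 0)) l)) * E j p)
         = (\<Sum>a\<in>UNIV. g ?u $ i $ a * (\<Sum>l\<in>UNIV. p (Dep (Suc (Suc 0)) l) * (\<Sum>j\<in>UNIV. \<Gamma> j a l ?u * E j p)))"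
      proof -
        have "(\<Sum>j\<in>UNIV. (\<Sum>l\<in>UNIV. c i j l ?u * p (Dep (Suc (Suc 0)) l)) * E j p)
          = (\<Sum>l\<in>UNIV. p (Dep (Suc (Suc 0)) l) * (\<Sum>j\<in>UNIV. c i j l ?u * E j p))"
          by (simp add: sum_distrib_left sum_distrib_right mult_ac) (rule sum.swap)
        also have "\<dots> = (\<Sum>l\<in>UNIV. p (Dep (Suc (Suc 0)) l) * (\<Sum>a\<in>UNIV. g ?u $ i $ a * (\<Sum>j\<in>UNIV. \<Gamma> j a l ?u * E j p)))"
        proof -
          have "(\<Sum>j\<in>UNIV. c i j l ?u * E j p) = (\<Sum>a\<in>UNIV. g ?u $ i $ a * (\<Sum>j\<in>UNIV. \<Gamma> j a l ?u * E j p))" for l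
            by (simp add: c_eq[OF U] sum_distrib_left sum_distrib_right mult.assoc) (rule sum.swap)
          then show ?thesis by simp
        qed
        also have "\<dots> = (\<Sum>l\<in>UNIV. \<Sum>a\<in>UNIV. g ?u $ i $ a * (p (Dep (Suc (Suc 0)) l) * (\<Sum>j\<in>UNIV. \<Gamma> j a l ?u * E j p)))"
          by (simp add: sum_distrib_left mult.left_commute)
        also have "\<dots> = (\<Sum>a\<in>UNIV. \<Sum>l\<in>UNIV. g ?u $ i $ a * (p (Dep (Suc (Suc 0)) l) * (\<Sum>j\<in>UNIV. \<Gamma> j a l ?u * E j p)))"
          by (rule sum.swap)
        finally show ?thesis by (simp add: sum_distrib_left)
      qed
      finally have "first_order_op 1 g c (var_deriv (affine_density P Q R S)) i p = - (\<Sum>j\<in>UNIV. g ?u $ i $ j * W j ?u)"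
        by (simp add: DE right_diff_distrib sum_subtractf sum_negf)
      then show ?thesis
        unfolding W_def flux_low_def raise_lower(2)[OF U] by (simp add: v_def)
    qed
    then show ?thesis unfolding hamiltonian_system_def B_def[symmetric] One_nat_def[symmetric]
      using B.diff_fun_affine_density[of P Q R S] by (intro exI[of _ "affine_density P Q R S"] exI[of _ 0]) (auto simp: B_def)
  qed
qed

end

section \<open>The equivalence\<close>

theorem theorem1:
  fixes U :: "(real ^ 'n::finite) set"
    and g :: "real ^ 'n \<Rightarrow> real ^ 'n ^ 'n"
    and c :: "'n \<Rightarrow> 'n \<Rightarrow> 'n \<Rightarrow> real ^ 'n \<Rightarrow> real"
    and V :: "real ^ 'n \<Rightarrow> real ^ 'n"
  assumes "open U" and "connected U"
    and "\<And>i j. smooth_on U (\<lambda>u. g u $ i $ j)"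
    and "\<And>i j k. smooth_on U (c i j k)"
    and "\<And>i. smooth_on U (\<lambda>u. V u $ i)"
    and "\<And>u. u \<in> U \<Longrightarrow> transpose (g u) = g u"
    and "\<And>u. u \<in> U \<Longrightarrow> det (g u) \<noteq> 0"
    and "hamiltonian_operator U g c"
    and "strictly_hyperbolic U V"
  shows "hamiltonian_system U g c V \<longleftrightarrow>
    (\<forall>u\<in>U.
      (\<forall>i j. (\<Sum>m\<in>UNIV. matrix_inv (g u) $ i $ m * jac V u $ m $ j)
           = (\<Sum>m\<in>UNIV. matrix_inv (g u) $ j $ m * jac V u $ m $ i)) \<and>
      (\<forall>i k l. (\<Sum>m\<in>UNIV. c_low g c m k l u * jac V u $ m $ i
                 + c_low g c m i k u * jac V u $ m $ l
                 + c_low g c m l i u * jac V u $ m $ k) = 0) \<and>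
      (\<forall>i j k. pd j (pd i (\<lambda>v. V v $ k)) u
           = (\<Sum>s\<in>UNIV. \<Sum>m\<in>UNIV. g u $ k $ s * c_low g c s m j u * jac V u $ m $ i
                 + g u $ k $ s * c_low g c s m i u * jac V u $ m $ j)))"
proof -
  interpret third_order_hamiltonian U g c
    by unfold_locales (fact assms)+
  let ?v = "\<lambda>i u. V u $ i"
  have rhs3: "(\<Sum>s\<in>UNIV. \<Sum>m\<in>UNIV. g u $ k $ s * c_low g c s m j u * jac V u $ m $ i
                 + g u $ k $ s * c_low g c s m i u * jac V u $ m $ j)
      = (\<Sum>m\<in>UNIV. \<Gamma> k m j u * pd i (?v m) u) + (\<Sum>m\<in>UNIV. \<Gamma> k m i u * pd j (?v m) u)" if "u \<in> U" for u i j k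
  proof -
    have "(\<Sum>s\<in>UNIV. \<Sum>m\<in>UNIV. g u $ k $ s * c_low g c s m j u * x m) = (\<Sum>m\<in>UNIV. \<Gamma> k m j u * x m)" for x j
      by (subst sum.swap) (simp add: \<Gamma>_eq[OF that] sum_distrib_right)
    then show ?thesis by (simp add: sum.distrib jac_def)
  qed
  have V: "?v i differentiable (at u)" "pd l (?v i) differentiable (at u)" if "u \<in> U" for u i l
    using smooth_on_differentiable[OF open_U assms(5) that] smooth_on_differentiable[OF open_U smooth_on_pd[OF assms(5)] that] by auto
  show ?thesis
  proof (intro iffI ballI conjI allI, goal_cases)
    case (1 u i j)
    from hamiltonian_system_imp(1)[OF assms(5) 1] show ?case by (simp add: jac_def G_def)
  next
    case (2 u i k l)
    have "(\<Sum>m\<in>UNIV. c_low g c m k l u * pd i (?v m) u + c_low g c m i k u * pd l (?v m) u + c_low g c m l i u * pd k (?v m) u) = 0"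
      by (rule cyclic_condition[where v="?v" and l=k and a=l and j=i, OF V])
        (use hamiltonian_system_imp[OF assms(5) 2(1)] 2(2) in auto)
    then show ?case by (simp add: jac_def)
  next
    case (3 u i j k)
    from hamiltonian_system_imp(2)[OF assms(5) 3] show ?case by (simp add: rhs3[OF 3(2)])
  next
    case 4
    show ?case
    proof (rule hamiltonian_systemI[OF assms(2,5)])
      fix u a j assume "u \<in> U"
      with 4 show "(\<Sum>m\<in>UNIV. G a m u * pd j (?v m) u) = (\<Sum>m\<in>UNIV. G j m u * pd a (?v m) u)"
        by (simp add: jac_def G_def)
    next
      fix u j l s assume u: "u \<in> U"
      with 4 rhs3[OF u] show "pd j (pd l (?v s)) u = (\<Sum>m\<in>UNIV. \<Gamma> s m j u * pd l (?v m) u) + (\<Sum>m\<in>UNIV. \<Gamma> s m l u * pd j (?v m) u)"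
        by simp
    qed
  qed
qed

end
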